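(* Let $r$ be a positive integer. (i) Suppose that $p$ is odd. Let $\nu_l$ be integers with $1 \leq \nu_l \leq (p-1)/2$ for $l \in \{0, \dots, r-1\}$. Then the set $$\left\{ \left. h(\nu_i,i)\, \bigl(X^{(p^i)}\bigr)^{p-\nu_i},\ \bigl(Y^{(p^i)}\bigr)^{p-\nu_i}\, h(\nu_i,i)\ \right|\ 0 \leq i \leq r-1 \right\}$$ generates the Jacobson radical ${\rm rad}\,\mathcal{U}_r$ as a two-sided ideal of $\mathcal{U}_r$. (ii) Suppose that $p=2$. Then the set $$\left\{ \left. \mu_m^{(i+1)} X^{(m)} X^{(2^i)},\ Y^{(2^i)} Y^{(m)} \mu_m^{(i+1)}\ \right|\ 0 \leq i \leq r-1,\ 0 \leq m \leq 2^i-1 \right\}$$ generates the Jacobson radical ${\rm rad}\,\mathcal{U}_r$ as a two-sided ideal of $\mathcal{U}_r$.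
   Context: $k$ is an algebraically closed field of characteristic $p>0$. Let $X,Y,H$ be the standard basis of $\mathfrak{sl}_2(\mathbb{C})$ ($X=\begin{pmatrix}0&1\\0&0\end{pmatrix}$, $Y=\begin{pmatrix}0&0\\1&0\end{pmatrix}$, $H=\begin{pmatrix}1&0\\0&-1\end{pmatrix}$) and $\mathcal{U}_{\mathbb{C}}$ its universal enveloping algebra. For $m\ge 0$ put $X^{(m)}=X^m/m!$, $Y^{(m)}=Y^m/m!$, and for $c\in\mathbb{Z}$ put $\binom{H+c}{m}=\frac{1}{m!}\prod_{i=0}^{m-1}(H+c-i)$. Let $\mathcal{U}_{\mathbb{Z}}$ be the subring of $\mathcal{U}_{\mathbb{C}}$ generated by all $X^{(m)},Y^{(m)}$ ($m\ge0$), and let $\mathcal{U}=\mathcal{U}_{\mathbb{Z}}\otimes_{\mathbb{Z}}k$ (the hyperalgebra of ${\rm SL}_2$ over $k$); the images in $\mathcal{U}$ of elements of $\mathcal{U}_{\mathbb{Z}}$ are denoted by the same symbols. $\mathcal{U}$ has $k$-basis $Y^{(m)}\binom{H}{n}X^{(m')}$ ($m,n,m'\ge0$). For $r\ge1$, $\mathcal{U}_r$ is the $k$-subalgebra of $\mathcal{U}$ generated by $X^{(n)},Y^{(n)}$ with $0\le n\le p^r-1$; it has dimension $p^{3r}$, with $k$-basis the elements $Y^{(m)}\binom{H}{n}X^{(m')}$ with $0\le m,n,m'\le p^r-1$ (it is the hyperalgebra of the $r$-th Frobenius kernel of ${\rm SL}_2$). The Jacobson radical ${\rm rad}\,R$ of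 a finite-dimensional $k$-algebra $R$ is its largest nilpotent two-sided ideal. For $a\in\mathbb{Z}$ and $s\ge1$ set $\mu_a^{(s)}=\binom{H-a-1}{p^s-1}\in\mathcal{U}_s$. If $p$ is odd, set, for $\nu\in\{1,\dots,(p-1)/2\}$ and $i\ge0$, $$h(\nu,i)=\binom{H+2p^i\nu}{2p^i\nu}+\binom{H+2p^i\nu-1}{2p^i\nu}\in\mathcal{U}_{i+1}.$$ *)

theory Defs
  imports "HOL-Analysis.Determinants" "HOL-Library.Poly_Mapping"
    "HOL-Computational_Algebra.Polynomial"
begin

text \<open>
  Rings are handled through the sort \<open>{ring, monoid_mult}\<close> (rings with unit, possibly trivial);
  a subring is a set \<open>A\<close>, and ideals are taken relative to \<open>A\<close>.
\<close>

definition two_sided_ideal :: "'a::{ring, monoid_mult} set \<Rightarrow> 'a set \<Rightarrow> bool" where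
  "two_sided_ideal A I \<longleftrightarrow>
     I \<subseteq> A \<and> 0 \<in> I \<and> (\<forall>x\<in>I. \<forall>y\<in>I. x - y \<in> I) \<and> (\<forall>a\<in>A. \<forall>x\<in>I. a * x \<in> I \<and> x * a \<in> I)"

definition ideal_gen :: "'a::{ring, monoid_mult} set \<Rightarrow> 'a set \<Rightarrow> 'a set" where
  "ideal_gen A S = \<Inter> {I. two_sided_ideal A I \<and> S \<subseteq> I}"

definition is_subring :: "'a::{ring, monoid_mult} set \<Rightarrow> bool" where
  "is_subring A \<longleftrightarrow> 1 \<in> A \<and> (\<forall>x\<in>A. \<forall>y\<in>A. x - y \<in> A \<and> x * y \<in> A)"

definition subring_gen :: "'a::{ring, monoid_mult} set \<Rightarrow> 'a set" where
  "subring_gen S = \<Inter> {A. is_subring A \<and> S \<subseteq> A}"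

text \<open>\<open>I ^ n = 0\<close> means that all \<open>n\<close>-fold products of elements of \<open>I\<close> vanish.\<close>

definition nilpotent_ideal :: "'a::{ring, monoid_mult} set \<Rightarrow> bool" where
  "nilpotent_ideal I \<longleftrightarrow> (\<exists>n. \<forall>xs. length xs = n \<and> set xs \<subseteq> I \<longrightarrow> prod_list xs = 0)"

text \<open>
  The radical as the largest nilpotent two-sided ideal; it is meant for rings \<open>A\<close> in which there is
  one, such as finite-dimensional algebras. (An algebra is unital and contains its scalars, so ideals of
  the ring are ideals of the algebra.)
\<close>

definition jacobson_radical :: "'a::{ring, monoid_mult} set \<Rightarrow> 'a set" where
  "jacobson_radical A = (GREATEST I. two_sided_ideal A I \<and> nilpotent_ideal I)"

lemma two_sided_ideal_ideal_gen_UNIV: "two_sided_ideal UNIV (ideal_gen UNIV S)"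
  unfolding two_sided_ideal_def ideal_gen_def by auto

lemma subset_ideal_gen: "S \<subseteq> ideal_gen A S"
  unfolding ideal_gen_def by auto

lemma is_subring_subring_gen: "is_subring (subring_gen S)"
  unfolding is_subring_def subring_gen_def by auto

lemma subset_subring_gen: "S \<subseteq> subring_gen S"
  unfolding subring_gen_def by auto

lemma is_subring_closed:
  assumes "is_subring A"
  shows "1 \<in> A" "0 \<in> A" "x \<in> A \<Longrightarrow> - x \<in> A"
    "x \<in> A \<Longrightarrow> y \<in> A \<Longrightarrow> x - y \<in> A"
    "x \<in> A \<Longrightarrow> y \<in> A \<Longrightarrow> x + y \<in> A"
    "x \<in> A \<Longrightarrow> y \<in> A \<Longrightarrow> x * y \<in> A"
proof -
  have diff: "\<And>x y. x \<in> A \<Longrightarrow> y \<in> A \<Longrightarrow> x - y \<in> A"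
    using assms unfolding is_subring_def by blast
  show one: "1 \<in> A" using assms unfolding is_subring_def by blast
  show zero: "0 \<in> A" using diff[OF one one] by simp
  have minus: "\<And>x. x \<in> A \<Longrightarrow> - x \<in> A" using diff[OF zero] by fastforce
  show "x \<in> A \<Longrightarrow> - x \<in> A" by (rule minus)
  show "x \<in> A \<Longrightarrow> y \<in> A \<Longrightarrow> x - y \<in> A" by (rule diff)
  show "x \<in> A \<Longrightarrow> y \<in> A \<Longrightarrow> x + y \<in> A" using diff[of x "- y"] minus[of y] by simp
  show "x \<in> A \<Longrightarrow> y \<in> A \<Longrightarrow> x * y \<in> A" using assms unfolding is_subring_def by blast
qed

definition cong_mod :: "'a::{ring, monoid_mult} set \<Rightarrow> 'a \<Rightarrow> 'a \<Rightarrow> bool" where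
  "cong_mod R x y \<longleftrightarrow> x - y \<in> ideal_gen UNIV R"

context
  fixes R :: "'a::{ring, monoid_mult} set"
begin

private lemma ig:
  "0 \<in> ideal_gen UNIV R"
  "x \<in> ideal_gen UNIV R \<Longrightarrow> y \<in> ideal_gen UNIV R \<Longrightarrow> x - y \<in> ideal_gen UNIV R"
  "x \<in> ideal_gen UNIV R \<Longrightarrow> a * x \<in> ideal_gen UNIV R"
  "x \<in> ideal_gen UNIV R \<Longrightarrow> x * a \<in> ideal_gen UNIV R"
  using two_sided_ideal_ideal_gen_UNIV[of R] unfolding two_sided_ideal_def by auto

private lemma ig_minus: "x \<in> ideal_gen UNIV R \<Longrightarrow> - x \<in> ideal_gen UNIV R"
  using ig(2)[OF ig(1)] by fastforce

private lemma ig_add: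
  "x \<in> ideal_gen UNIV R \<Longrightarrow> y \<in> ideal_gen UNIV R \<Longrightarrow> x + y \<in> ideal_gen UNIV R"
  using ig(2)[of x "- y"] ig_minus[of y] by simp

lemma equivp_cong_mod: "equivp (cong_mod R)"
proof (rule equivpI)
  show "reflp (cong_mod R)" by (rule reflpI) (simp add: cong_mod_def ig(1))
  show "symp (cong_mod R)"
    by (rule sympI) (use ig_minus in \<open>fastforce simp: cong_mod_def\<close>)
  show "transp (cong_mod R)"
  proof (rule transpI)
    fix x y z assume "cong_mod R x y" "cong_mod R y z"
    then show "cong_mod R x z" using ig_add[of "x - y" "y - z"] by (simp add: cong_mod_def)
  qed
qed

lemma cong_mod_add: "cong_mod R x x' \<Longrightarrow> cong_mod R y y' \<Longrightarrow> cong_mod R (x + y) (x' + y')"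
  using ig_add[of "x - x'" "y - y'"] by (simp add: cong_mod_def algebra_simps)

lemma cong_mod_diff: "cong_mod R x x' \<Longrightarrow> cong_mod R y y' \<Longrightarrow> cong_mod R (x - y) (x' - y')"
  using ig(2)[of "x - x'" "y - y'"] by (simp add: cong_mod_def algebra_simps)

lemma cong_mod_uminus: "cong_mod R x x' \<Longrightarrow> cong_mod R (- x) (- x')"
  using ig_minus[of "x - x'"] by (simp add: cong_mod_def)

lemma cong_mod_mult: "cong_mod R x x' \<Longrightarrow> cong_mod R y y' \<Longrightarrow> cong_mod R (x * y) (x' * y')"
  using ig_add[OF ig(4)[of "x - x'" y] ig(3)[of "y - y'" x']]
  by (simp add: cong_mod_def algebra_simps)

end

typedef sl2 = "{A :: complex^2^2. trace A = 0}"
  by (rule exI[of _ 0]) (simp add: trace_def)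

datatype 'a word = Word "'a list"

instantiation word :: (type) monoid_add
begin
definition "0 = Word []"
fun plus_word :: "'a word \<Rightarrow> 'a word \<Rightarrow> 'a word" where
  "Word u + Word v = Word (u @ v)"
instance
proof
  fix a b c :: "'a word"
  show "a + b + c = a + (b + c)" by (cases a; cases b; cases c) simp
  show "0 + a = a" by (cases a) (simp add: zero_word_def)
  show "a + 0 = a" by (cases a) (simp add: zero_word_def)
qed
end

text \<open>
  \<open>Poly_Mapping\<close> multiplies by convolution along an additively written index monoid, so
  finitely supported complex functions on words form the free algebra on the set \<open>sl2\<close>.
  Modulo the linear relations it is the tensor algebra of the vector space \<open>sl2\<close>.
\<close>

type_synonym free_sl2 = "sl2 word \<Rightarrow>\<^sub>0 complex"

definition free_gen :: "sl2 \<Rightarrow> free_sl2" where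
  "free_gen x = Poly_Mapping.single (Word [x]) 1"

definition free_const :: "complex \<Rightarrow> free_sl2" where
  "free_const c = Poly_Mapping.single 0 c"

definition uea_relations :: "free_sl2 set" where
  "uea_relations =
     {free_gen z - (free_gen x + free_gen y) | x y z. Rep_sl2 z = Rep_sl2 x + Rep_sl2 y}
   \<union> {free_gen z - free_const c * free_gen x | c x z. Rep_sl2 z = (\<chi> i j. c * Rep_sl2 x $ i $ j)}
   \<union> {free_gen z - (free_gen x * free_gen y - free_gen y * free_gen x) | x y z.
        Rep_sl2 z = Rep_sl2 x ** Rep_sl2 y - Rep_sl2 y ** Rep_sl2 x}"

quotient_type uea_sl2 = free_sl2 / "cong_mod uea_relations"
  by (rule equivp_cong_mod)

instantiation uea_sl2 :: "{ring, monoid_mult}"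
begin
lift_definition zero_uea_sl2 :: uea_sl2 is 0 .
lift_definition one_uea_sl2 :: uea_sl2 is 1 .
lift_definition plus_uea_sl2 :: "uea_sl2 \<Rightarrow> uea_sl2 \<Rightarrow> uea_sl2" is "(+)" by (rule cong_mod_add)
lift_definition minus_uea_sl2 :: "uea_sl2 \<Rightarrow> uea_sl2 \<Rightarrow> uea_sl2" is "(-)" by (rule cong_mod_diff)
lift_definition uminus_uea_sl2 :: "uea_sl2 \<Rightarrow> uea_sl2" is uminus by (rule cong_mod_uminus)
lift_definition times_uea_sl2 :: "uea_sl2 \<Rightarrow> uea_sl2 \<Rightarrow> uea_sl2" is "(*)" by (rule cong_mod_mult)
instance
proof
  have eq: "x = y \<Longrightarrow> cong_mod uea_relations x y" for x y
    using equivp_reflp[OF equivp_cong_mod] by auto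
  fix a b c :: uea_sl2
  show "a + b + c = a + (b + c)" by transfer (rule eq, simp add: add.assoc)
  show "a + b = b + a" by transfer (rule eq, simp add: add.commute)
  show "0 + a = a" by transfer (rule eq, simp)
  show "- a + a = 0" by transfer (rule eq, simp)
  show "a - b = a + - b" by transfer (rule eq, simp)
  show "a * b * c = a * (b * c)" by transfer (rule eq, simp add: mult.assoc)
  show "(a + b) * c = a * c + b * c" by transfer (rule eq, simp add: algebra_simps)
  show "a * (b + c) = a * b + a * c" by transfer (rule eq, simp add: algebra_simps)
  show "1 * a = a" by transfer (rule eq, simp)
  show "a * 1 = a" by transfer (rule eq, simp)
qed
end

lift_definition uea_gen :: "sl2 \<Rightarrow> uea_sl2" is free_gen .
lift_definition uea_const :: "complex \<Rightarrow> uea_sl2" is free_const .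

definition UX :: uea_sl2 where "UX = uea_gen (Abs_sl2 (vector [vector [0, 1], vector [0, 0]]))"
definition UY :: uea_sl2 where "UY = uea_gen (Abs_sl2 (vector [vector [0, 0], vector [1, 0]]))"
definition UH :: uea_sl2 where "UH = uea_gen (Abs_sl2 (vector [vector [1, 0], vector [0, -1]]))"

lemma sl2_basis_mem:
  "(vector [vector [0, 1], vector [0, 0]] :: complex^2^2) \<in> {A. trace A = 0}"
  "(vector [vector [0, 0], vector [1, 0]] :: complex^2^2) \<in> {A. trace A = 0}"
  "(vector [vector [1, 0], vector [0, -1]] :: complex^2^2) \<in> {A. trace A = 0}"
  by (simp_all add: trace_def sum_2)

definition divpow :: "uea_sl2 \<Rightarrow> nat \<Rightarrow> uea_sl2" where
  "divpow x m = uea_const (1 / fact m) * x ^ m"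

definition Hbinom :: "int \<Rightarrow> nat \<Rightarrow> uea_sl2" where
  "Hbinom c m = uea_const (1 / fact m)
     * prod_list (map (\<lambda>i. UH + uea_const (of_int (c - int i))) [0..<m])"

typedef uea_Z = "subring_gen ({divpow UX m | m. True} \<union> {divpow UY m | m. True})"
  using is_subring_closed(1)[OF is_subring_subring_gen] by blast

setup_lifting type_definition_uea_Z

instantiation uea_Z :: "{ring, monoid_mult}"
begin
lift_definition zero_uea_Z :: uea_Z is 0 by (rule is_subring_closed[OF is_subring_subring_gen])
lift_definition one_uea_Z :: uea_Z is 1 by (rule is_subring_closed[OF is_subring_subring_gen])
lift_definition plus_uea_Z :: "uea_Z \<Rightarrow> uea_Z \<Rightarrow> uea_Z" is "(+)"
  by (rule is_subring_closed[OF is_subring_subring_gen])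
lift_definition minus_uea_Z :: "uea_Z \<Rightarrow> uea_Z \<Rightarrow> uea_Z" is "(-)"
  by (rule is_subring_closed[OF is_subring_subring_gen])
lift_definition uminus_uea_Z :: "uea_Z \<Rightarrow> uea_Z" is uminus
  by (rule is_subring_closed[OF is_subring_subring_gen])
lift_definition times_uea_Z :: "uea_Z \<Rightarrow> uea_Z \<Rightarrow> uea_Z" is "(*)"
  by (rule is_subring_closed[OF is_subring_subring_gen])
instance
  by standard (transfer; simp add: algebra_simps)+
end

text \<open>
  The tensor product over the integers of two unital rings: the integral monoid ring of the
  multiplicative monoid of the product, modulo biadditivity.
\<close>

datatype ('a, 'b) pure_tensor = Pure 'a 'b

instantiation pure_tensor :: (monoid_mult, monoid_mult) monoid_add
begin
definition "0 = Pure 1 1"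
fun plus_pure_tensor :: "('a, 'b) pure_tensor \<Rightarrow> ('a, 'b) pure_tensor \<Rightarrow> ('a, 'b) pure_tensor" where
  "Pure a b + Pure a' b' = Pure (a * a') (b * b')"
instance
proof
  fix a b c :: "('a, 'b) pure_tensor"
  show "a + b + c = a + (b + c)" by (cases a; cases b; cases c) (simp add: mult.assoc)
  show "0 + a = a" by (cases a) (simp add: zero_pure_tensor_def)
  show "a + 0 = a" by (cases a) (simp add: zero_pure_tensor_def)
qed
end

definition pure_elem :: "'a \<Rightarrow> 'b \<Rightarrow> (('a, 'b) pure_tensor \<Rightarrow>\<^sub>0 int)" where
  "pure_elem a b = Poly_Mapping.single (Pure a b) 1"

definition tensor_relations ::
    "(('a::{ring, monoid_mult}, 'b::{ring, monoid_mult}) pure_tensor \<Rightarrow>\<^sub>0 int) set" where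
  "tensor_relations =
     {pure_elem (a + a') b - (pure_elem a b + pure_elem a' b) | a a' b. True}
   \<union> {pure_elem a (b + b') - (pure_elem a b + pure_elem a b') | a b b'. True}"

quotient_type (overloaded) ('a, 'b) tensor =
    "('a::{ring, monoid_mult}, 'b::{ring, monoid_mult}) pure_tensor \<Rightarrow>\<^sub>0 int"
    / "cong_mod tensor_relations"
  by (rule equivp_cong_mod)

instantiation tensor :: ("{ring, monoid_mult}", "{ring, monoid_mult}") "{ring, monoid_mult}"
begin
lift_definition zero_tensor :: "('a, 'b) tensor" is 0 .
lift_definition one_tensor :: "('a, 'b) tensor" is 1 .
lift_definition plus_tensor :: "('a, 'b) tensor \<Rightarrow> ('a, 'b) tensor \<Rightarrow> ('a, 'b) tensor" is "(+)"
  by (rule cong_mod_add)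
lift_definition minus_tensor :: "('a, 'b) tensor \<Rightarrow> ('a, 'b) tensor \<Rightarrow> ('a, 'b) tensor" is "(-)"
  by (rule cong_mod_diff)
lift_definition uminus_tensor :: "('a, 'b) tensor \<Rightarrow> ('a, 'b) tensor" is uminus
  by (rule cong_mod_uminus)
lift_definition times_tensor :: "('a, 'b) tensor \<Rightarrow> ('a, 'b) tensor \<Rightarrow> ('a, 'b) tensor" is "(*)"
  by (rule cong_mod_mult)
instance
proof
  have eq: "x = y \<Longrightarrow> cong_mod tensor_relations x y" for x y :: "('a, 'b) pure_tensor \<Rightarrow>\<^sub>0 int"
    using equivp_reflp[OF equivp_cong_mod] by auto
  fix a b c :: "('a, 'b) tensor"
  show "a + b + c = a + (b + c)" by transfer (rule eq, simp add: add.assoc)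
  show "a + b = b + a" by transfer (rule eq, simp add: add.commute)
  show "0 + a = a" by transfer (rule eq, simp)
  show "- a + a = 0" by transfer (rule eq, simp)
  show "a - b = a + - b" by transfer (rule eq, simp)
  show "a * b * c = a * (b * c)" by transfer (rule eq, simp add: mult.assoc)
  show "(a + b) * c = a * c + b * c" by transfer (rule eq, simp add: algebra_simps)
  show "a * (b + c) = a * b + a * c" by transfer (rule eq, simp add: algebra_simps)
  show "1 * a = a" by transfer (rule eq, simp)
  show "a * 1 = a" by transfer (rule eq, simp)
qed
end

lift_definition tensor_of :: "'a::{ring, monoid_mult} \<Rightarrow> 'b::{ring, monoid_mult} \<Rightarrow> ('a, 'b) tensor"
  is pure_elem .

type_synonym 'k hyperalg = "(uea_Z, 'k) tensor"

text \<open>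
  The image in the hyperalgebra of an element of the integral form. It is only meaningful on the
  integral form, which by Kostant's theorem contains \<open>Hbinom c m\<close> for every integer \<open>c\<close>.
\<close>

definition hyp :: "uea_sl2 \<Rightarrow> 'k::field hyperalg" where
  "hyp u = tensor_of (Abs_uea_Z u) 1"

definition hyp_scalar :: "'k::field \<Rightarrow> 'k hyperalg" where
  "hyp_scalar c = tensor_of 1 c"

definition hX :: "nat \<Rightarrow> 'k::field hyperalg" where "hX m = hyp (divpow UX m)"
definition hY :: "nat \<Rightarrow> 'k::field hyperalg" where "hY m = hyp (divpow UY m)"
definition hH :: "int \<Rightarrow> nat \<Rightarrow> 'k::field hyperalg" where "hH c m = hyp (Hbinom c m)"

text \<open>The subalgebra generated by a set is the subring generated by it and the scalars.\<close>

definition hyperalg_sub :: "nat \<Rightarrow> nat \<Rightarrow> 'k::field hyperalg set" where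
  "hyperalg_sub p r =
     subring_gen (range hyp_scalar \<union> {hX n | n. n \<le> p ^ r - 1} \<union> {hY n | n. n \<le> p ^ r - 1})"

definition mu :: "nat \<Rightarrow> int \<Rightarrow> nat \<Rightarrow> 'k::field hyperalg" where
  "mu p a s = hH (- a - 1) (p ^ s - 1)"

definition hnu :: "nat \<Rightarrow> nat \<Rightarrow> nat \<Rightarrow> 'k::field hyperalg" where
  "hnu p \<nu> i = hH (int (2 * p ^ i * \<nu>)) (2 * p ^ i * \<nu>) + hH (int (2 * p ^ i * \<nu>) - 1) (2 * p ^ i * \<nu>)"

end

theory Submission
  imports Defs "HOL-Number_Theory.Cong" "HOL-Computational_Algebra.Formal_Power_Series"
begin

text \<open>
  Let \<open>J\<close> be the ideal generated by the given elements.

  \<open>J\<close> is nilpotent: with \<open>e a\<close> the idempotent of the weight \<open>a\<close> modulo \<open>p^r\<close>, the elements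
  \<open>Y m (e a) (X n)\<close> span the algebra. Filter it by \<open>n\<close> and then, inside each baby Verma module \<open>Y m (e a)\<close>,
  by the positions of the digits at which adding \<open>a - m\<close> and \<open>m\<close> in base \<open>p\<close> produces a carry, compared
  lexicographically from the lowest digit. The algebra preserves this filtration, because \<open>X n\<close> and \<open>Y n\<close>
  act by binomial coefficients that vanish unless an addition is free of carries, and every generator of
  \<open>J\<close> moves it strictly.

  \<open>J\<close> contains every nilpotent ideal: by induction on \<open>s\<close>, modulo \<open>J\<close> the algebra is generated over the
  \<open>Y m\<close> with \<open>m < p^s\<close> by vectors that are killed by \<open>X n\<close> for \<open>0 < n < p^s\<close>, and such a vector of
  weight \<open>a\<close> is killed by \<open>Y m\<close> whenever \<open>p\<close> divides the binomial coefficient of \<open>a\<close> over \<open>m\<close>. In the step,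
  \<open>X (p^s)\<close> and \<open>Y (p^s)\<close> act on these vectors as restricted \<open>sl2\<close>, and the generators of \<open>J\<close> of level \<open>s\<close>
  are what makes this action semisimple. For \<open>s = r\<close> the vectors generate simple modules, which a nilpotent
  ideal annihilates; hence it annihilates \<open>1\<close> modulo \<open>J\<close>.
\<close>

section \<open>Binomial coefficients modulo a prime\<close>

text \<open>The generators express what holds in simple modules: if a vector of the restricted
  simple \<open>sl2\<close> module of highest weight l < p has a weight congruent to one of 0, ...,
  p - 2\<nu>, then y^(p - \<nu>) sends it below the lowest weight. Conversely one such relation per
  string of weight vectors is enough, because x y^(i+1) v = (i + 1)(a - i) y^i v for primitive v
  spreads it along the string; hence every \<nu> serves. The same range governs nilpotency: for a
  generator containing \<open>X n\<close> or \<open>Y n\<close> it ends at 2n - p^(i+1), and no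
  weight in it is compatible with two additions of n that are both free of carries. Here n is p^i (p
  - \<nu>) for odd p and 2^i + m for p = 2. The obstacle is that a generator of level s tests the
  residue of the whole weight modulo p^(s+1), while the layer argument sees only the digit of p^s. A
  vector whose residue is too large is therefore replaced by the lowest vector of its string over
  the lower levels, its image under some \<open>Y l\<close>, and recovered from it by
  \<open>X l\<close>.\<close>

definition ibinom :: "int \<Rightarrow> nat \<Rightarrow> int" where
  "ibinom a t = (if a \<ge> 0 then int (nat a choose t) else (-1) ^ t * int (nat (int t - a - 1) choose t))"

lemma of_int_ibinom: "(of_int (ibinom a t) :: 'a::field_char_0) = of_int a gchoose t"
proof (cases "a \<ge> 0")
  case True
  then obtain n where "a = int n" using nonneg_int_cases by blast
  then show ?thesis by (simp add: ibinom_def binomial_gbinomial)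
next
  case False
  then obtain n where n: "int t - a - 1 = int n" using nonneg_int_cases[of "int t - a - 1"] by auto
  have e: "of_nat t - of_int a - 1 = (of_nat n :: 'a)"
    using arg_cong[OF n, of "of_int :: int \<Rightarrow> 'a"] by simp
  have "(of_int (ibinom a t) :: 'a) = (- 1) ^ t * of_nat (n choose t)"
    using False n by (simp add: ibinom_def)
  also have "\<dots> = of_int a gchoose t"
    using gbinomial_negated_upper[of "of_int a :: 'a" t] e by (simp add: binomial_gbinomial)
  finally show ?thesis .
qed

lemma ibinom_0 [simp]: "ibinom a 0 = 1"
  by (simp add: ibinom_def)

lemma ibinom_of_nat [simp]: "ibinom (int n) t = int (n choose t)"
  by (simp add: ibinom_def)

lemma ibinom_0_left: "ibinom 0 t = (if t = 0 then 1 else 0)"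
  using ibinom_of_nat[of 0 t] by (cases t) auto

lemma ibinom_1 [simp]: "ibinom a (Suc 0) = a"
proof -
  have "(of_int (ibinom a (Suc 0)) :: rat) = of_int a" by (simp add: of_int_ibinom)
  then show ?thesis by (simp only: of_int_eq_iff)
qed

lemma ibinom_eq_0: "0 \<le> a \<Longrightarrow> a < int t \<Longrightarrow> ibinom a t = 0"
  by (simp add: ibinom_def)

lemma ibinom_Suc_Suc: "ibinom (a + 1) (Suc t) = ibinom a t + ibinom a (Suc t)"
proof -
  have "(of_int (ibinom (a + 1) (Suc t)) :: rat) = of_int (ibinom a t + ibinom a (Suc t))"
    by (simp add: of_int_ibinom gbinomial_Suc_Suc)
  then show ?thesis by (simp only: of_int_eq_iff)
qed

text \<open>Pascal's rule, run upwards and downwards in \<open>x\<close>, determines the binomial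
  coefficients at all integers from the column \<open>n = 0\<close> and the row
  \<open>x = 0\<close>. Weights may be negative, so Lucas' theorem is needed in this
  generality.\<close>

lemma pascal_unique:
  fixes F :: "int \<Rightarrow> nat \<Rightarrow> int" and p :: int
  assumes zero: "\<And>x. [F x 0 = 1] (mod p)" and left: "\<And>n. [F 0 (Suc n) = 0] (mod p)"
    and suc: "\<And>x n. [F (x + 1) (Suc n) = F x n + F x (Suc n)] (mod p)"
  shows "[ibinom x n = F x n] (mod p)"
proof (induction x arbitrary: n rule: int_induct[of _ 0])
  case base
  show ?case
    using zero[of 0] left by (cases n) (auto simp: ibinom_0_left cong_sym)
next
  case (step1 x)
  show ?case
  proof (cases n)
    case 0 then show ?thesis using zero cong_sym by auto
  next
    case (Suc m)
    have "[ibinom x m + ibinom x (Suc m) = F x m + F x (Suc m)] (mod p)"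
      by (intro cong_add step1.IH)
    then show ?thesis using suc[of x m] Suc by (auto simp: ibinom_Suc_Suc intro: cong_trans cong_sym)
  qed
next
  case (step2 x)
  show ?case
  proof (induction n)
    case 0 then show ?case using zero cong_sym by auto
  next
    case (Suc m)
    have "[ibinom x (Suc m) - ibinom (x - 1) m = F x (Suc m) - F (x - 1) m] (mod p)"
      by (intro cong_diff step2.IH Suc)
    moreover have "ibinom x (Suc m) - ibinom (x - 1) m = ibinom (x - 1) (Suc m)"
      using ibinom_Suc_Suc[of "x - 1" m] by simp
    moreover have "[F x (Suc m) - F (x - 1) m = F (x - 1) (Suc m)] (mod p)"
      using cong_diff[OF suc[of "x - 1" m] cong_refl[of "F (x - 1) m"]] by simp
    ultimately show ?case by (auto intro: cong_trans)
  qed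
qed

lemma prime_dvd_prime_power_choose:
  fixes p :: nat
  assumes p: "prime p" and k: "0 < k" "k < p ^ s"
  shows "p dvd (p ^ s choose k)"
proof (rule ccontr)
  assume "\<not> p dvd (p ^ s choose k)"
  then have "coprime (p ^ s) (p ^ s choose k)" using p by (simp add: prime_imp_coprime)
  moreover have "k * (p ^ s choose k) = p ^ s * ((p ^ s - 1) choose (k - 1))"
    using times_binomial_minus1_eq[of k "p ^ s"] k by simp
  ultimately have "p ^ s dvd k" by (metis coprime_dvd_mult_left_iff dvd_triv_left)
  then show False using k by (simp add: dvd_imp_le leD)
qed

text \<open>The product on the right satisfies the hypotheses of \<open>pascal_unique\<close>. The
  critical case of Pascal's rule is that the residue of \<open>x\<close> wraps around and that of
  \<open>n\<close> does not: then two neighbouring entries of row \<open>q - 1\<close> add up to an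
  inner entry of row \<open>q\<close>, which \<open>p\<close> divides.\<close>

lemma ibinom_lucas:
  fixes p :: nat
  assumes p: "prime p" and q: "q = p ^ s"
  shows "[ibinom x n = ibinom (x div int q) (n div q) * ibinom (x mod int q) (n mod q)] (mod int p)"
proof (rule pascal_unique[where F = "\<lambda>x n. ibinom (x div int q) (n div q) * ibinom (x mod int q) (n mod q)"])
  have q0: "q > 0" using p q prime_gt_0_nat by simp
  show "[ibinom (x div int q) (0 div q) * ibinom (x mod int q) (0 mod q) = 1] (mod int p)" for x by simp
  show "[ibinom (0 div int q) (Suc n div q) * ibinom (0 mod int q) (Suc n mod q) = 0] (mod int p)" for n
  proof -
    have "Suc n div q \<noteq> 0 \<or> Suc n mod q \<noteq> 0"
      by (metis div_mult_mod_eq add.right_neutral mult_0 nat.distinct(1))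
    then show ?thesis by (auto simp: ibinom_0_left)
  qed
  fix x :: int and n :: nat
  define xd nd nm where "xd = x div int q" and "nd = n div q" and "nm = n mod q"
  obtain xm where xm: "x mod int q = int xm"
    using nonneg_int_cases[of "x mod int q"] q0 by (auto simp: pos_mod_sign)
  have xmq: "xm < q" using pos_mod_bound[of "int q" x] q0 xm by simp
  have nmq: "nm < q" using q0 by (simp add: nm_def)
  have x: "x = xd * int q + int xm" unfolding xd_def xm[symmetric] by simp
  have n: "n = nd * q + nm" by (simp add: nd_def nm_def)
  have x1: "(x + 1) div int q = (if xm = q - 1 then xd + 1 else xd) \<and>
      (x + 1) mod int q = (if xm = q - 1 then 0 else int (xm + 1))"
  proof (cases "xm = q - 1")
    case True
    then have "x + 1 = (xd + 1) * int q" using x q0 by (simp add: algebra_simps of_nat_diff)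
    then show ?thesis using True q0 by simp
  next
    case False
    then have "x + 1 = int (xm + 1) + xd * int q" "xm + 1 < q" using x xmq by auto
    then show ?thesis using False q0
      by (simp only: div_mult_self1 mod_mult_self1 if_False zdiv_int[symmetric] zmod_int[symmetric]
          of_nat_eq_0_iff div_less mod_less simp_thms)
  qed
  have n1: "Suc n div q = (if nm = q - 1 then nd + 1 else nd) \<and>
      Suc n mod q = (if nm = q - 1 then 0 else nm + 1)"
  proof (cases "nm = q - 1")
    case True
    then have "Suc n = (nd + 1) * q" using n q0 by (simp add: algebra_simps)
    then show ?thesis using True q0 by simp
  next
    case False
    then have "Suc n = (nm + 1) + nd * q" "nm + 1 < q" using n nmq by auto
    then show ?thesis using False by (simp only: div_mult_self1 mod_mult_self1 div_less mod_less) simp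
  qed
  have ch: "[int ((q - 1) choose nm) + int ((q - 1) choose Suc nm) = 0] (mod int p)" if "nm \<noteq> q - 1"
  proof -
    have "(q - 1 choose nm) + (q - 1 choose Suc nm) = (q choose Suc nm)"
      using binomial_Suc_Suc[of "q - 1" nm] q0 by simp
    moreover have "p dvd (q choose Suc nm)" unfolding q
      by (rule prime_dvd_prime_power_choose[OF p]) (use that nmq q in auto)
    ultimately show ?thesis by (metis cong_0_iff int_dvd_int_iff of_nat_add)
  qed
  show "[ibinom ((x + 1) div int q) (Suc n div q) * ibinom ((x + 1) mod int q) (Suc n mod q) =
      ibinom (x div int q) (n div q) * ibinom (x mod int q) (n mod q) +
      ibinom (x div int q) (Suc n div q) * ibinom (x mod int q) (Suc n mod q)] (mod int p)"
    unfolding x1[THEN conjunct1] x1[THEN conjunct2] n1[THEN conjunct1] n1[THEN conjunct2] xm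
      xd_def[symmetric] nd_def[symmetric] nm_def[symmetric]
  proof (cases "xm = q - 1"; cases "nm = q - 1")
    assume "xm = q - 1" "nm \<noteq> q - 1"
    then show "[ibinom (if xm = q - 1 then xd + 1 else xd) (if nm = q - 1 then nd + 1 else nd) *
      ibinom (if xm = q - 1 then 0 else int (xm + 1)) (if nm = q - 1 then 0 else nm + 1) =
      ibinom xd nd * ibinom (int xm) nm +
      ibinom xd (if nm = q - 1 then nd + 1 else nd) * ibinom (int xm) (if nm = q - 1 then 0 else nm + 1)] (mod int p)"
      using cong_mult[OF cong_refl[of "ibinom xd nd"] ch]
      by (simp add: ibinom_0_left algebra_simps cong_sym)
  next
    assume "xm \<noteq> q - 1" "nm = q - 1"
    then show "[ibinom (if xm = q - 1 then xd + 1 else xd) (if nm = q - 1 then nd + 1 else nd) *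
      ibinom (if xm = q - 1 then 0 else int (xm + 1)) (if nm = q - 1 then 0 else nm + 1) =
      ibinom xd nd * ibinom (int xm) nm +
      ibinom xd (if nm = q - 1 then nd + 1 else nd) * ibinom (int xm) (if nm = q - 1 then 0 else nm + 1)] (mod int p)"
      using xmq by (simp add: binomial_eq_0)
  qed (use ibinom_Suc_Suc[of xd nd] ibinom_Suc_Suc[of "int xm" nm] in \<open>simp_all add: algebra_simps\<close>)
qed

lemma ibinom_cong_mod:
  fixes p :: nat
  assumes "prime p" "q = p ^ s" "t < q"
  shows "[ibinom x t = ibinom (x mod int q) t] (mod int p)"
  using ibinom_lucas[OF assms(1,2), of x t] assms(3) by simp

text \<open>Among the residues below \<open>q\<close> only \<open>q - 1\<close> has a nonzero
  binomial coefficient over \<open>q - 1\<close>. This is what makes the elements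
  \<open>B (- a - 1) (p ^ s - 1)\<close> weight idempotents.\<close>

lemma ibinom_indicator:
  fixes p :: nat
  assumes p: "prime p" and q: "q = p ^ s"
  shows "[ibinom (x - 1) (q - 1) = (if int q dvd x then 1 else 0)] (mod int p)"
proof -
  have q0: "q > 0" using p q prime_gt_0_nat by simp
  have i: "int (q - 1) = int q - 1" using q0 by simp
  have "[ibinom (x - 1) (q - 1) = ibinom ((x - 1) mod int q) (q - 1)] (mod int p)"
    using ibinom_cong_mod[OF p q] q0 by simp
  moreover have "ibinom ((x - 1) mod int q) (q - 1) = (if int q dvd x then 1 else 0)"
  proof (cases "int q dvd x")
    case True
    then obtain k where "x = int q * k" by blast
    then have "(x - 1) mod int q = int (q - 1)"
      using q0 by (intro int_mod_pos_eq[of _ _ "k - 1"]) (simp_all add: i algebra_simps)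
    then show ?thesis using True by (simp only: ibinom_of_nat) simp
  next
    case False
    have "(x - 1) mod int q \<noteq> int (q - 1)"
    proof
      assume h: "(x - 1) mod int q = int (q - 1)"
      have "x = int q * ((x - 1) div int q) + (x - 1) mod int q + 1" by simp
      then have "x = int q * ((x - 1) div int q + 1)" unfolding h i by (simp add: algebra_simps)
      then show False using False by (metis dvd_triv_left)
    qed
    moreover have "(x - 1) mod int q < int q" "0 \<le> (x - 1) mod int q" using q0 by auto
    ultimately have "ibinom ((x - 1) mod int q) (q - 1) = 0"
      using i by (intro ibinom_eq_0) linarith+
    then show ?thesis using False by simp
  qed
  ultimately show ?thesis by simp
qed

section \<open>Carries in base p\<close>

lemma div_mod_add_no_carry:
  fixes q :: int
  assumes "0 < q" "l mod q + n mod q < q"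
  shows "(l + n) mod q = l mod q + n mod q" "(l + n) div q = l div q + n div q"
proof -
  have e: "l + n = q * (l div q + n div q) + (l mod q + n mod q)"
    by (simp add: algebra_simps)
  have nn: "0 \<le> l mod q + n mod q" using assms(1) by simp
  show "(l + n) mod q = l mod q + n mod q" by (rule int_mod_pos_eq[OF e nn assms(2)])
  show "(l + n) div q = l div q + n div q" by (rule int_div_pos_eq[OF e nn assms(2)])
qed

lemma mod_add_carry:
  fixes q :: int
  assumes "0 < q" "q \<le> l mod q + n mod q"
  shows "(l + n) mod q = l mod q + n mod q - q"
proof (rule int_mod_pos_eq)
  show "l + n = q * (l div q + n div q + 1) + (l mod q + n mod q - q)"
    by (simp add: algebra_simps)
  show "l mod q + n mod q - q < q"
    using pos_mod_bound[OF assms(1), of l] pos_mod_bound[OF assms(1), of n] by linarith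
qed (use assms in auto)

text \<open>A nonzero lower factor in Lucas' theorem forces the residue of \<open>l + n\<close> to
  be at least that of \<open>n\<close>, and a carry would make it smaller.\<close>

lemma not_dvd_ibinom_step:
  fixes p :: nat
  assumes p: "prime p" and q: "q = p ^ s" and nd: "\<not> int p dvd ibinom (l + int n) n"
  shows "l mod int q + int (n mod q) < int q"
    and "\<not> int p dvd ibinom (l div int q + int (n div q)) (n div q)"
proof -
  have q0: "int q > 0" using p q prime_gt_0_nat by simp
  have L: "\<not> int p dvd ibinom ((l + int n) div int q) (n div q) * ibinom ((l + int n) mod int q) (n mod q)"
    using ibinom_lucas[OF p q, of "l + int n" n] nd cong_dvd_iff by blast
  then have "ibinom ((l + int n) mod int q) (n mod q) \<noteq> 0" by auto
  then have ge: "(l + int n) mod int q \<ge> int (n mod q)"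
    using ibinom_eq_0 q0 pos_mod_sign[OF q0] by (metis not_le)
  show lt: "l mod int q + int (n mod q) < int q"
    using mod_add_carry[OF q0, of l "int n"] ge pos_mod_bound[OF q0, of l]
    by (fastforce simp: zmod_int not_less)
  show "\<not> int p dvd ibinom (l div int q + int (n div q)) (n div q)"
    using div_mod_add_no_carry(2)[OF q0, of l "int n"] lt L by (auto simp: zdiv_int zmod_int)
qed

text \<open>Digits are added without incoming carries, and the lowest digit counts most.\<close>

fun carry_rank :: "int \<Rightarrow> nat \<Rightarrow> int \<Rightarrow> int \<Rightarrow> nat" where
  "carry_rank p 0 l m = 0"
| "carry_rank p (Suc r) l m =
     (if l mod p + m mod p \<ge> p then 2 ^ r else 0) + carry_rank p r (l div p) (m div p)"

lemma carry_rank_less: "carry_rank p r l m < 2 ^ r"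
proof (induction r arbitrary: l m)
  case (Suc r)
  have "carry_rank p r (l div p) (m div p) < 2 * 2 ^ r"
    using Suc.IH[of "l div p" "m div p"] by linarith
  then show ?case using Suc.IH[of "l div p" "m div p"] by simp
qed simp

lemma carry_rank_commute: "carry_rank p r l m = carry_rank p r m l"
  by (induction r arbitrary: l m) (simp_all add: add.commute)

text \<open>The summand \<open>n\<close> moves from \<open>l\<close>, where it is added without
  carries, to \<open>m\<close>. If the lowest digits of \<open>m\<close> and \<open>n\<close> do not
  carry, both sides test the same sum of three digits there. Otherwise the right-hand side carries
  while the left-hand side, whose digit has wrapped around, does not, and the lowest digit outweighs
  all others.\<close>

lemma carry_rank_shift:
  fixes p :: nat
  assumes p: "prime p" and nd: "\<not> int p dvd ibinom (l + int n) n"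
  shows "carry_rank p r l (m + int n) \<le> carry_rank p r (l + int n) m \<and>
    (\<forall>i<r. m mod int p ^ Suc i + int n mod int p ^ Suc i \<ge> int p ^ Suc i \<longrightarrow>
       carry_rank p r l (m + int n) < carry_rank p r (l + int n) m)"
  using nd
proof (induction r arbitrary: l m n)
  case 0 show ?case by simp
next
  case (Suc r)
  have p0: "int p > 0" using p prime_gt_0_nat by simp
  have nc: "l mod int p + int n mod int p < int p"
    and nd': "\<not> int p dvd ibinom (l div int p + int (n div p)) (n div p)"
    using not_dvd_ibinom_step[OF p _ Suc.prems, of p 1] by (simp_all add: zmod_int)
  have lm: "0 \<le> l mod int p" "l mod int p < int p" "0 \<le> m mod int p" "m mod int p < int p"
    "0 \<le> int n mod int p" "int n mod int p < int p" using p0 by auto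
  have l1: "(l + int n) mod int p = l mod int p + int n mod int p"
    and l2: "(l + int n) div int p = l div int p + int (n div p)"
    using div_mod_add_no_carry[OF p0 nc] by (simp_all add: zdiv_int)
  have IH: "carry_rank p r (l div p) (m div p + int (n div p)) \<le> carry_rank p r (l div p + int (n div p)) (m div p) \<and>
    (\<forall>i<r. (m div p) mod int p ^ Suc i + int (n div p) mod int p ^ Suc i \<ge> int p ^ Suc i \<longrightarrow>
       carry_rank p r (l div p) (m div p + int (n div p)) < carry_rank p r (l div p + int (n div p)) (m div p))"
    by (rule Suc.IH[OF nd'])
  show ?case
  proof (cases "m mod int p + int n mod int p < int p")
    case True
    have m1: "(m + int n) mod int p = m mod int p + int n mod int p"
      and m2: "(m + int n) div int p = m div int p + int (n div p)"
      using div_mod_add_no_carry[OF p0 True] by (simp_all add: zdiv_int)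
    have "carry_rank p r (l div p) (m div p + int (n div p)) < carry_rank p r (l div p + int (n div p)) (m div p)"
      if i: "i < Suc r" "m mod int p ^ Suc i + int n mod int p ^ Suc i \<ge> int p ^ Suc i" for i
    proof (cases i)
      case 0 then show ?thesis using i True by simp
    next
      case (Suc j)
      \<comment> \<open>The lowest digits of \<open>m\<close> and \<open>n\<close> contribute less
        than \<open>p\<close>, so a carry out of the first \<open>i + 1\<close> digits already comes
        from the \<open>i\<close> digits above the lowest.\<close>
      have "x mod int p ^ Suc i = int p * ((x div int p) mod int p ^ i) + x mod int p" for x
        using zmod_zmult2_eq[of "int p ^ i" x "int p"] by simp
      then have "int p * ((m div int p) mod int p ^ i) + m mod int p
          + (int p * ((int n div int p) mod int p ^ i) + int n mod int p) \<ge> int p * int p ^ i"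
        using i(2) by simp
      then have "int p * ((m div int p) mod int p ^ i + (int n div int p) mod int p ^ i + 1) > int p * int p ^ i"
        using True by (simp add: algebra_simps)
      then have "(m div int p) mod int p ^ i + (int n div int p) mod int p ^ i + 1 > int p ^ i"
        using p0 mult_less_cancel_left_pos by blast
      then show ?thesis using IH i(1) Suc by (auto simp: zdiv_int)
    qed
    then show ?thesis using IH by (simp add: m1 m2 l1 l2 add.assoc add.commute[of "m mod int p"]) 
  next
    case False
    have m1: "(m + int n) mod int p = m mod int p + int n mod int p - int p"
      using mod_add_carry[OF p0] False by simp
    have "carry_rank p (Suc r) l (m + int n) < 2 ^ r"
    proof -
      have "\<not> l mod int p + (m + int n) mod int p \<ge> int p"
        using m1 nc lm by linarith
      then show ?thesis using carry_rank_less[of p r "l div p" "(m + int n) div p"] by simp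
    qed
    moreover have "2 ^ r \<le> carry_rank p (Suc r) (l + int n) m"
    proof -
      have "(l + int n) mod int p + m mod int p \<ge> int p" using l1 False lm by linarith
      then show ?thesis by simp
    qed
    ultimately show ?thesis by auto
  qed
qed

section \<open>Kostant relations in the enveloping algebra\<close>

lemma free_const_commute: "free_const c * x = x * free_const c"
proof (induction x rule: Poly_Mapping.update_induct)
  case const show ?case by simp
next
  case (update f k v)
  have "Poly_Mapping.update k v f = f + Poly_Mapping.single k v"
    using update(1)
    by (intro poly_mapping_eqI) (auto simp: lookup_update lookup_add lookup_single in_keys_iff when_def)
  moreover have "free_const c * Poly_Mapping.single k v = Poly_Mapping.single k v * free_const c"
    by (simp add: free_const_def Poly_Mapping.mult_single mult.commute)
  ultimately show ?case using update(3) by (simp add: algebra_simps)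
qed

lemma cong_uea_refl: "x = y \<Longrightarrow> cong_mod uea_relations x y"
  using equivp_reflp[OF equivp_cong_mod] by auto

lemma uea_const_add: "uea_const (a + b) = uea_const a + uea_const b"
  by transfer (rule cong_uea_refl, simp add: free_const_def single_add)

lemma uea_const_mult: "uea_const (a * b) = uea_const a * uea_const b"
  by transfer (rule cong_uea_refl, simp add: free_const_def Poly_Mapping.mult_single)

lemma uea_const_0 [simp]: "uea_const 0 = 0"
  by transfer (rule cong_uea_refl, simp add: free_const_def)

lemma uea_const_1 [simp]: "uea_const 1 = 1"
  by transfer (rule cong_uea_refl, simp add: free_const_def)

lemma uea_const_commute: "uea_const c * x = x * uea_const c"
  by transfer (rule cong_uea_refl, rule free_const_commute)

lemma uea_const_left_commute: "x * (uea_const c * y) = uea_const c * (x * y)"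
  by (metis mult.assoc uea_const_commute)

lemma uea_const_diff: "uea_const (a - b) = uea_const a - uea_const b"
  using uea_const_add[of "a - b" b] by (simp add: algebra_simps)

lemma uea_const_inverse_mult: "c \<noteq> 0 \<Longrightarrow> uea_const c * (uea_const (1 / c) * x) = x"
  by (simp add: mult.assoc[symmetric] uea_const_mult[symmetric])

lemma uea_gen_scale:
  assumes "Rep_sl2 z = (\<chi> i j. c * Rep_sl2 x $ i $ j)"
  shows "uea_gen z = uea_const c * uea_gen x"
  using assms
  by transfer (auto simp: cong_mod_def uea_relations_def intro!: subsetD[OF subset_ideal_gen])

lemma uea_gen_bracket:
  assumes "Rep_sl2 z = Rep_sl2 x ** Rep_sl2 y - Rep_sl2 y ** Rep_sl2 x"
  shows "uea_gen z = uea_gen x * uea_gen y - uea_gen y * uea_gen x"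
  using assms
  by transfer (auto simp: cong_mod_def uea_relations_def intro!: subsetD[OF subset_ideal_gen])

lemma Rep_sl2_basis:
  "Rep_sl2 (Abs_sl2 (vector [vector [0, 1], vector [0, 0]])) = vector [vector [0, 1], vector [0, 0]]"
  "Rep_sl2 (Abs_sl2 (vector [vector [0, 0], vector [1, 0]])) = vector [vector [0, 0], vector [1, 0]]"
  "Rep_sl2 (Abs_sl2 (vector [vector [1, 0], vector [0, -1]])) = vector [vector [1, 0], vector [0, -1]]"
  by (rule Abs_sl2_inverse, rule sl2_basis_mem)+

lemma UX_UY: "UX * UY = UY * UX + UH"
proof -
  have "UH = UX * UY - UY * UX"
    unfolding UH_def UX_def UY_def
    by (rule uea_gen_bracket)
      (simp add: Rep_sl2_basis vec_eq_iff forall_2 matrix_matrix_mult_def sum_2)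
  then show ?thesis by (simp add: algebra_simps)
qed

lemma UH_UX: "UH * UX = UX * (uea_const 2 + UH)"
proof -
  define z :: sl2 where "z = Abs_sl2 (vector [vector [0, 2], vector [0, 0]])"
  have z: "Rep_sl2 z = vector [vector [0, 2], vector [0, 0]]"
    unfolding z_def by (rule Abs_sl2_inverse) (simp add: trace_def sum_2)
  have "uea_gen z = UH * UX - UX * UH"
    unfolding UH_def UX_def
    by (rule uea_gen_bracket)
      (simp add: z Rep_sl2_basis vec_eq_iff forall_2 matrix_matrix_mult_def sum_2)
  moreover have "uea_gen z = uea_const 2 * UX"
    unfolding UX_def
    by (rule uea_gen_scale) (simp add: z Rep_sl2_basis vec_eq_iff forall_2)
  ultimately show ?thesis by (simp add: algebra_simps uea_const_commute)
qed

lemma UH_UY: "UH * UY = UY * (uea_const (- 2) + UH)"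
proof -
  define z :: sl2 where "z = Abs_sl2 (vector [vector [0, 0], vector [- 2, 0]])"
  have z: "Rep_sl2 z = vector [vector [0, 0], vector [- 2, 0]]"
    unfolding z_def by (rule Abs_sl2_inverse) (simp add: trace_def sum_2)
  have "uea_gen z = UH * UY - UY * UH"
    unfolding UH_def UY_def
    by (rule uea_gen_bracket)
      (simp add: z Rep_sl2_basis vec_eq_iff forall_2 matrix_matrix_mult_def sum_2)
  moreover have "uea_gen z = uea_const (- 2) * UY"
    unfolding UY_def
    by (rule uea_gen_scale) (simp add: z Rep_sl2_basis vec_eq_iff forall_2)
  ultimately show ?thesis by (simp add: algebra_simps uea_const_commute)
qed

section \<open>Polynomials in the Cartan element\<close>

definition Hpoly :: "complex poly \<Rightarrow> uea_sl2" where
  "Hpoly f = fold_coeffs (\<lambda>a b. uea_const a + UH * b) f 0"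

lemma Hpoly_0 [simp]: "Hpoly 0 = 0"
  by (simp add: Hpoly_def)

lemma Hpoly_pCons [simp]: "Hpoly (pCons a f) = uea_const a + UH * Hpoly f"
  by (cases "f = 0"; cases "a = 0") (simp_all add: Hpoly_def)

lemma Hpoly_add: "Hpoly (f + g) = Hpoly f + Hpoly g"
  by (induction f g rule: poly_induct2) (simp_all add: uea_const_add algebra_simps)

lemma Hpoly_smult: "Hpoly (smult c f) = uea_const c * Hpoly f"
  by (induction f)
    (simp_all add: uea_const_mult[symmetric] distrib_left mult.assoc[symmetric] uea_const_commute[of _ UH] mult.commute)

text \<open>\<open>Hpoly\<close> is thus a ring homomorphism, and identities in \<open>UH\<close>
  can be checked on the values of complex polynomials.\<close>

lemma Hpoly_mult: "Hpoly (f * g) = Hpoly f * Hpoly g"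
  by (induction f) (simp_all add: Hpoly_add Hpoly_smult algebra_simps)

lemma Hpoly_1 [simp]: "Hpoly 1 = 1"
  by (simp add: one_pCons)

lemma Hpoly_sum: "Hpoly (sum f A) = (\<Sum>i\<in>A. Hpoly (f i))"
  by (induction A rule: infinite_finite_induct) (simp_all add: Hpoly_add)

lemma Hpoly_shift:
  assumes "UH * x = x * (uea_const d + UH)"
  shows "Hpoly f * x = x * Hpoly (f \<circ>\<^sub>p [:d, 1:])"
proof (induction f)
  case (pCons a f)
  have "Hpoly (pCons a f) * x = uea_const a * x + UH * (Hpoly f * x)"
    by (simp add: algebra_simps)
  also have "UH * (Hpoly f * x) = x * ((uea_const d + UH) * Hpoly (f \<circ>\<^sub>p [:d, 1:]))"
    unfolding pCons.IH by (simp add: mult.assoc[symmetric] assms)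
  finally have "Hpoly (pCons a f) * x = x * (uea_const a + (uea_const d + UH) * Hpoly (f \<circ>\<^sub>p [:d, 1:]))"
    by (simp add: distrib_left uea_const_commute)
  then show ?case
    by (simp add: pcompose_pCons Hpoly_add Hpoly_mult del: mult_pCons_left)
qed simp

lemma Hpoly_shift_power:
  assumes "UH * x = x * (uea_const d + UH)"
  shows "Hpoly f * x ^ n = x ^ n * Hpoly (f \<circ>\<^sub>p [:of_nat n * d, 1:])"
proof (induction n arbitrary: f)
  case (Suc n)
  have "f \<circ>\<^sub>p [:d, 1:] \<circ>\<^sub>p [:of_nat n * d, 1:] = f \<circ>\<^sub>p [:of_nat (Suc n) * d, 1:]"
    by (simp add: pcompose_assoc[symmetric] pcompose_pCons algebra_simps)
  then show ?case
    using Suc[of "f \<circ>\<^sub>p [:d, 1:]"] Hpoly_shift[OF assms, of f]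
    by (metis mult.assoc power_Suc)
qed (simp add: pcompose_idR)

lemma Hpoly_divpow:
  assumes "UH * x = x * (uea_const d + UH)"
  shows "Hpoly f * divpow x n = divpow x n * Hpoly (f \<circ>\<^sub>p [:of_nat n * d, 1:])"
  unfolding divpow_def by (metis Hpoly_shift_power[OF assms] mult.assoc uea_const_commute)

definition binom_poly :: "complex \<Rightarrow> nat \<Rightarrow> complex poly" where
  "binom_poly c t = smult (1 / fact t) (\<Prod>i<t. [:c - of_nat i, 1:])"

lemma poly_binom_poly [simp]: "poly (binom_poly c t) x = (x + c) gchoose t"
  by (simp add: binom_poly_def poly_prod gbinomial_prod_rev lessThan_atLeast0 algebra_simps)

lemma degree_binom_poly: "degree (binom_poly c t) \<le> t"
proof -
  have "degree (\<Prod>i<t. [:c - of_nat i, 1:]) \<le> sum (degree \<circ> (\<lambda>i. [:c - of_nat i, 1:])) {..<t}"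
    by (rule degree_prod_sum_le) simp
  then show ?thesis by (simp add: binom_poly_def)
qed

lemma Hbinom_eq_Hpoly: "Hbinom c t = Hpoly (binom_poly (of_int c) t)"
proof -
  have "prod_list (map (\<lambda>i. UH + uea_const (of_int (c - int i))) [0..<t])
      = Hpoly (\<Prod>i<t. [:of_int c - of_nat i, 1:])"
    by (induction t) (simp_all add: Hpoly_mult add.commute del: mult_pCons_right)
  then show ?thesis by (simp add: Hbinom_def binom_poly_def Hpoly_smult)
qed

lemma binom_poly_shift: "binom_poly c t \<circ>\<^sub>p [:d, 1:] = binom_poly (c + d) t"
  by (simp add: poly_eq_poly_eq_iff[symmetric] fun_eq_iff poly_pcompose algebra_simps)

lemma Hbinom_divpow_UX: "Hbinom c t * divpow UX n = divpow UX n * Hbinom (c + 2 * int n) t"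
  by (simp add: Hbinom_eq_Hpoly Hpoly_divpow[OF UH_UX] binom_poly_shift mult.commute)

lemma Hbinom_divpow_UY: "Hbinom c t * divpow UY n = divpow UY n * Hbinom (c - 2 * int n) t"
  by (simp add: Hbinom_eq_Hpoly Hpoly_divpow[OF UH_UY] binom_poly_shift mult.commute)

section \<open>Divided powers and their commutation\<close>

lemma divpow_0 [simp]: "divpow x 0 = 1"
  by (simp add: divpow_def)

lemma divpow_Suc: "x * divpow x n = uea_const (of_nat (Suc n)) * divpow x (Suc n)"
proof -
  have e: "(1::complex) / fact n = of_nat (Suc n) * (1 / fact (Suc n))"
    by (simp add: divide_simps del: of_nat_Suc)
  show ?thesis unfolding divpow_def e uea_const_mult
    by (simp only: uea_const_left_commute[of x] mult.assoc power_Suc)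
qed

lemma divpow_mult: "divpow x m * divpow x n = uea_const (of_nat ((m + n) choose m)) * divpow x (m + n)"
proof -
  have "(1 / fact m) * (1 / fact n) = (of_nat ((m + n) choose m) * (1 / fact (m + n)) :: complex)"
    by (subst binomial_fact) (simp_all add: divide_simps)
  then show ?thesis
    unfolding divpow_def
    by (metis (no_types, lifting) mult.assoc power_add uea_const_left_commute uea_const_mult)
qed

lemma UX_UY_power:
  "UX * UY ^ Suc m = UY ^ Suc m * UX + uea_const (of_nat (Suc m)) * (UY ^ m * Hpoly [:- of_nat m, 1:])"
proof (induction m)
  case 0 show ?case by (simp add: UX_UY)
next
  case (Suc m)
  \<comment> \<open>The first summand is the bracket of \<open>X\<close> with the last
    \<open>Y\<close>; the second is \<open>H - m\<close>, which becomes \<open>H - m - 2\<close> on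
    passing that \<open>Y\<close>.\<close>
  have P: "[:0, 1:] + smult (of_nat (Suc m)) [:- of_nat m - 2, 1:]
      = smult (of_nat (Suc (Suc m))) [:- of_nat (Suc m), 1 :: complex:]"
    by (simp add: algebra_simps)
  have "UX * UY ^ Suc (Suc m) = (UX * UY ^ Suc m) * UY" by (simp add: power_Suc2 mult.assoc del: power_Suc)
  also have "\<dots> = UY ^ Suc m * (UX * UY) + uea_const (of_nat (Suc m)) * (UY ^ m * (Hpoly [:- of_nat m, 1:] * UY))"
    unfolding Suc by (simp add: algebra_simps)
  also have "Hpoly [:- of_nat m, 1:] * UY = UY * Hpoly [:- of_nat m - 2, 1:]"
    by (simp only: Hpoly_shift[OF UH_UY]) (simp add: pcompose_pCons)
  also have "UY ^ Suc m * (UX * UY) + uea_const (of_nat (Suc m)) * (UY ^ m * (UY * Hpoly [:- of_nat m - 2, 1:]))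
     = UY ^ Suc (Suc m) * UX + UY ^ Suc m * (UH + uea_const (of_nat (Suc m)) * Hpoly [:- of_nat m - 2, 1:])"
    by (simp only: UX_UY distrib_left uea_const_left_commute[of UY] uea_const_left_commute[of "UY ^ m"]
        power_Suc2 mult.assoc add.assoc)
  also have "UH + uea_const (of_nat (Suc m)) * Hpoly [:- of_nat m - 2, 1:]
      = uea_const (of_nat (Suc (Suc m))) * Hpoly [:- of_nat (Suc m), 1:]"
  proof -
    have "UH + uea_const (of_nat (Suc m)) * Hpoly [:- of_nat m - 2, 1:]
        = Hpoly ([:0, 1:] + smult (of_nat (Suc m)) [:- of_nat m - 2, 1:])"
      by (simp only: Hpoly_add Hpoly_smult) simp
    then show ?thesis by (simp only: Hpoly_smult[symmetric] P)
  qed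
  finally show ?case by (simp only: uea_const_left_commute)
qed

text \<open>With integer exponents the commutation formula needs no case distinction on the exponent.\<close>

definition Yd :: "int \<Rightarrow> uea_sl2" where
  "Yd k = (if k < 0 then 0 else divpow UY (nat k))"

lemma UX_Yd: "UX * Yd k = Yd k * UX + Yd (k - 1) * Hpoly [:1 - of_int k, 1:]"
proof (cases "k \<ge> 1")
  case True
  then obtain m where k: "k = int (Suc m)"
    by (metis One_nat_def nonneg_int_cases not0_implies_Suc of_nat_0 zero_le_one order_trans not_one_le_zero)
  have e: "(1::complex) / fact (Suc m) * of_nat (Suc m) = 1 / fact m"
    by (simp add: divide_simps del: of_nat_Suc)
  have "UX * divpow UY (Suc m) = uea_const (1 / fact (Suc m)) * (UX * UY ^ Suc m)"
    by (simp only: divpow_def uea_const_left_commute)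
  also have "\<dots> = divpow UY (Suc m) * UX + divpow UY m * Hpoly [:- of_nat m, 1:]"
    unfolding UX_UY_power divpow_def e[symmetric] uea_const_mult
    by (simp only: distrib_left mult.assoc)
  finally have "UX * divpow UY (Suc m) = divpow UY (Suc m) * UX + divpow UY m * Hpoly [:- of_nat m, 1:]" .
  moreover have "Yd k = divpow UY (Suc m)" "Yd (k - 1) = divpow UY m" "1 - of_int k = (- of_nat m :: complex)"
    using k by (simp_all add: Yd_def nat_add_distrib)
  ultimately show ?thesis by (simp only:)
next
  case False
  then show ?thesis by (cases "k = 0") (auto simp: Yd_def)
qed

text \<open>Induction on \<open>n\<close>, multiplying by \<open>X\<close> from the left. In each
  summand \<open>X\<close> either passes through to the power of \<open>X\<close>
  (\<open>P t\<close>) or is used up in a bracket with \<open>Y\<close> (\<open>Q (Suc t)\<close>).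
  Collecting the terms with the same power of \<open>Y\<close>, \<open>P t + Q t\<close> has to be
  \<open>n + 1\<close> times the new summand.\<close>

lemma divpow_UX_Yd:
  "divpow UX n * Yd m =
    (\<Sum>t\<le>n. Yd (m - int t) * Hpoly (binom_poly (of_int (2 * int t - m - int n)) t) * divpow UX (n - t))"
proof (induction n)
  case 0 show ?case by (simp add: binom_poly_def)
next
  case (Suc n)
  define c :: "nat \<Rightarrow> complex" where "c t = of_int (2 * int t - m - int n)" for t
  define P where "P t = Yd (m - int t) *
    Hpoly (smult (of_nat (Suc n) - of_nat t) (binom_poly (c t - 2) t)) * divpow UX (Suc n - t)" for t
  define Q where "Q t = (case t of 0 \<Rightarrow> 0 | Suc s \<Rightarrow> Yd (m - int t) *
    (Hpoly [:1 - of_int (m - int s), 1:] * Hpoly (binom_poly (c s) s)) * divpow UX (Suc n - t))" for t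
  have step: "UX * (Yd (m - int t) * Hpoly (binom_poly (c t) t) * divpow UX (n - t)) = P t + Q (Suc t)"
    if t: "t \<le> n" for t
  proof -
    have b: "UX * Hpoly (binom_poly (c t) t) = Hpoly (binom_poly (c t - 2) t) * UX"
      by (simp add: Hpoly_shift[OF UH_UX] binom_poly_shift)
    have x: "UX * divpow UX (n - t) = uea_const (of_nat (Suc n) - of_nat t) * divpow UX (Suc n - t)"
      using divpow_Suc[of UX "n - t"] t by (simp add: of_nat_diff Suc_diff_le algebra_simps)
    have "UX * (Yd (m - int t) * Hpoly (binom_poly (c t) t) * divpow UX (n - t))
      = Yd (m - int t) * (UX * Hpoly (binom_poly (c t) t)) * divpow UX (n - t)
       + Yd (m - int t - 1) * Hpoly [:1 - of_int (m - int t), 1:] * Hpoly (binom_poly (c t) t) * divpow UX (n - t)"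
      by (simp only: mult.assoc[symmetric] UX_Yd distrib_right)
    also have "Yd (m - int t) * (UX * Hpoly (binom_poly (c t) t)) * divpow UX (n - t) = P t"
      unfolding b P_def Hpoly_smult by (simp only: mult.assoc x uea_const_left_commute)
    also have "Yd (m - int t - 1) * Hpoly [:1 - of_int (m - int t), 1:] * Hpoly (binom_poly (c t) t) * divpow UX (n - t)
        = Q (Suc t)"
      unfolding Q_def using t by (simp only: nat.case mult.assoc) (simp add: algebra_simps)
    finally show ?thesis .
  qed
  have PQ: "P t + Q t = uea_const (of_nat (Suc n)) * (Yd (m - int t) *
      Hpoly (binom_poly (of_int (2 * int t - m - int (Suc n))) t) * divpow UX (Suc n - t))"
    if t: "t \<le> Suc n" for t
  proof -
    \<comment> \<open>The identity behind \<open>P t + Q t\<close>. With \<open>t = s + 1\<close>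
      and y = H + c s it follows from Pascal's rule and t (y choose t) = (y - s) (y choose
      s).\<close>
    have "smult (of_nat (Suc n)) (binom_poly (c t - 1) t) = smult (of_nat (Suc n) - of_nat t) (binom_poly (c t - 2) t)
      + (case t of 0 \<Rightarrow> 0 | Suc s \<Rightarrow> [:1 - of_int (m - int s), 1:] * binom_poly (c s) s)"
    proof (cases t)
      case 0 then show ?thesis by (simp add: binom_poly_def)
    next
      case (Suc s)
      show ?thesis unfolding poly_eq_poly_eq_iff[symmetric]
      proof
        fix x :: complex
        define y where "y = x + c s"
        have c: "c t = c s + 2" by (simp add: c_def Suc)
        have a: "(y + 1) gchoose t = (y gchoose s) + (y gchoose t)"
          using gbinomial_Suc_Suc[of y s] Suc by simp
        have b: "of_nat t * (y gchoose t) = (y - of_nat s) * (y gchoose s)"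
          using gbinomial_mult_1[of y s] Suc by (simp add: algebra_simps)
        have d: "y = x + 2 * of_nat s - of_int m - of_nat n" by (simp add: y_def c_def)
        have "of_nat (Suc n) * ((y + 1) gchoose t) = (of_nat (Suc n) - of_nat t) * (y gchoose t)
           + of_nat t * (y gchoose t) + of_nat (Suc n) * (y gchoose s)"
          unfolding a by (simp add: algebra_simps)
        also have "\<dots> = (of_nat (Suc n) - of_nat t) * (y gchoose t) + (x + 1 - of_int m + of_nat s) * (y gchoose s)"
          unfolding b by (simp add: d algebra_simps)
        finally show "poly (smult (of_nat (Suc n)) (binom_poly (c t - 1) t)) x =
          poly (smult (of_nat (Suc n) - of_nat t) (binom_poly (c t - 2) t)
          + (case t of 0 \<Rightarrow> 0 | Suc s \<Rightarrow> [:1 - of_int (m - int s), 1:] * binom_poly (c s) s)) x"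
          using Suc c by (simp add: y_def algebra_simps del: of_nat_Suc)
      qed
    qed
    moreover have "of_int (2 * int t - m - int (Suc n)) = c t - 1" by (simp add: c_def)
    moreover have "P t + Q t = Yd (m - int t) * Hpoly (smult (of_nat (Suc n) - of_nat t) (binom_poly (c t - 2) t)
        + (case t of 0 \<Rightarrow> 0 | Suc s \<Rightarrow> [:1 - of_int (m - int s), 1:] * binom_poly (c s) s)) * divpow UX (Suc n - t)"
      unfolding P_def Q_def Hpoly_add
      by (cases t) (simp_all only: nat.case Hpoly_mult Hpoly_0 mult_zero_right mult_zero_left add_0_right distrib_left distrib_right)
    ultimately show ?thesis
      by (metis Hpoly_smult mult.assoc uea_const_left_commute)
  qed
  have "uea_const (of_nat (Suc n)) * (divpow UX (Suc n) * Yd m) = UX * (divpow UX n * Yd m)"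
    by (simp only: mult.assoc[symmetric] divpow_Suc)
  also have "\<dots> = (\<Sum>t\<le>n. UX * (Yd (m - int t) * Hpoly (binom_poly (c t) t) * divpow UX (n - t)))"
    unfolding Suc sum_distrib_left c_def ..
  also have "\<dots> = (\<Sum>t\<le>n. P t) + (\<Sum>t\<le>n. Q (Suc t))"
    by (simp add: step sum.distrib)
  also have "(\<Sum>t\<le>n. P t) = (\<Sum>t\<le>Suc n. P t)" by (simp add: P_def)
  also have "(\<Sum>t\<le>n. Q (Suc t)) = (\<Sum>t\<le>Suc n. Q t)"
    unfolding sum.atMost_Suc_shift by (simp add: Q_def)
  also have "(\<Sum>t\<le>Suc n. P t) + (\<Sum>t\<le>Suc n. Q t) = uea_const (of_nat (Suc n)) * (\<Sum>t\<le>Suc n. Yd (m - int t) *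
      Hpoly (binom_poly (of_int (2 * int t - m - int (Suc n))) t) * divpow UX (Suc n - t))"
    unfolding sum.distrib[symmetric] sum_distrib_left by (rule sum.cong) (auto simp only: atMost_iff PQ)
  finally have "uea_const (1 / of_nat (Suc n)) * (uea_const (of_nat (Suc n)) * (divpow UX (Suc n) * Yd m))
     = uea_const (1 / of_nat (Suc n)) * (uea_const (of_nat (Suc n)) * (\<Sum>t\<le>Suc n. Yd (m - int t) *
      Hpoly (binom_poly (of_int (2 * int t - m - int (Suc n))) t) * divpow UX (Suc n - t)))"
    by (rule arg_cong)
  then show ?case
    by (metis (no_types, lifting) of_nat_neq_0 uea_const_inverse_mult uea_const_left_commute)
qed

lemma divpow_UX_UY:
  "divpow UX n * divpow UY m =
    (\<Sum>t\<le>min m n. divpow UY (m - t) * Hbinom (2 * int t - int m - int n) t * divpow UX (n - t))"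
proof -
  have "divpow UX n * divpow UY m = (\<Sum>t\<le>n. Yd (int m - int t) *
      Hpoly (binom_poly (of_int (2 * int t - int m - int n)) t) * divpow UX (n - t))"
    using divpow_UX_Yd[of n "int m"] by (simp add: Yd_def)
  also have "\<dots> = (\<Sum>t\<le>min m n. Yd (int m - int t) *
      Hpoly (binom_poly (of_int (2 * int t - int m - int n)) t) * divpow UX (n - t))"
    by (rule sum.mono_neutral_right) (auto simp: Yd_def)
  also have "\<dots> = (\<Sum>t\<le>min m n. divpow UY (m - t) * Hbinom (2 * int t - int m - int n) t * divpow UX (n - t))"
    by (rule sum.cong) (auto simp: Yd_def Hbinom_eq_Hpoly nat_diff_distrib')
  finally show ?thesis .
qed

section \<open>Integer-valued polynomials and the integral form\<close>

lemma newton_expansion: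
  fixes f :: "complex poly" and q :: int
  assumes "\<And>n::nat. \<exists>z. poly f (of_nat n) = of_int (q * z)"
  shows "\<exists>c. f = (\<Sum>j\<le>degree f. smult (of_int (q * c j)) (binom_poly 0 j))"
proof -
  obtain v where v: "\<And>n::nat. poly f (of_nat n) = of_int (q * v n)" using assms by metis
  \<comment> \<open>The matrix of the binomial coefficients is unitriangular, so the coefficients
    can be solved for one at a time without denominators.\<close>
  have "\<exists>c. \<forall>n\<le>N. v n = (\<Sum>j\<le>N. c j * int (n choose j))" for N
  proof (induction N)
    case 0
    show ?case by (rule exI[of _ "\<lambda>_. v 0"]) simp
  next
    case (Suc N)
    then obtain c where c: "\<forall>n\<le>N. v n = (\<Sum>j\<le>N. c j * int (n choose j))" by blast
    define c' where "c' = c(Suc N := v (Suc N) - (\<Sum>j\<le>N. c j * int (Suc N choose j)))"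
    have s: "(\<Sum>j\<le>N. c' j * int (n choose j)) = (\<Sum>j\<le>N. c j * int (n choose j))" for n
      by (rule sum.cong) (auto simp: c'_def)
    have "\<forall>n\<le>Suc N. v n = (\<Sum>j\<le>Suc N. c' j * int (n choose j))"
    proof (intro allI impI)
      fix n assume n: "n \<le> Suc N"
      show "v n = (\<Sum>j\<le>Suc N. c' j * int (n choose j))"
      proof (cases "n = Suc N")
        case True
        then show ?thesis unfolding sum.atMost_Suc s by (simp add: c'_def)
      next
        case False
        then show ?thesis using n c unfolding sum.atMost_Suc s by simp
      qed
    qed
    then show ?case by blast
  qed
  then obtain c where c: "\<forall>n\<le>degree f. v n = (\<Sum>j\<le>degree f. c j * int (n choose j))" by blast
  let ?g = "\<Sum>j\<le>degree f. smult (of_int (q * c j)) (binom_poly 0 j)"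
  have "f = ?g"
  proof (rule poly_eqI_degree[where A = "of_nat ` {..degree f}"])
    have card: "card ((of_nat :: nat \<Rightarrow> complex) ` {..degree f}) = Suc (degree f)"
      by (subst card_image) (auto simp: inj_on_def)
    then show "degree f < card ((of_nat :: nat \<Rightarrow> complex) ` {..degree f})" by simp
    have "degree ?g \<le> degree f"
      by (rule degree_sum_le) (auto intro: order_trans[OF degree_smult_le] order_trans[OF degree_binom_poly])
    then show "degree ?g < card ((of_nat :: nat \<Rightarrow> complex) ` {..degree f})" using card by simp
    fix x :: complex assume "x \<in> of_nat ` {..degree f}"
    then obtain n where n: "x = of_nat n" "n \<le> degree f" by auto
    have "poly ?g x = (\<Sum>j\<le>degree f. of_int (q * c j) * of_nat (n choose j))"
      by (simp add: poly_sum n binomial_gbinomial)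
    also have "\<dots> = of_int (q * (\<Sum>j\<le>degree f. c j * int (n choose j)))"
      by (simp add: sum_distrib_left mult.assoc)
    finally show "poly f x = poly ?g x" using v[of n] c n by simp
  qed
  then show ?thesis by blast
qed

definition uea_Z_set :: "uea_sl2 set" where
  "uea_Z_set = subring_gen ({divpow UX m | m. True} \<union> {divpow UY m | m. True})"

lemma is_subring_uea_Z_set: "is_subring uea_Z_set"
  unfolding uea_Z_set_def by (rule is_subring_subring_gen)

lemmas uea_Z_set_closed = is_subring_closed[OF is_subring_uea_Z_set]

lemma divpow_mem: "divpow UX n \<in> uea_Z_set" "divpow UY n \<in> uea_Z_set"
  unfolding uea_Z_set_def by (auto intro!: subsetD[OF subset_subring_gen])

lemma uea_Z_set_sum: "(\<And>i. i \<in> A \<Longrightarrow> f i \<in> uea_Z_set) \<Longrightarrow> sum f A \<in> uea_Z_set"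
  by (induction A rule: infinite_finite_induct) (auto intro: uea_Z_set_closed)

lemma uea_Z_set_of_int: "u \<in> uea_Z_set \<Longrightarrow> uea_const (of_int k) * u \<in> uea_Z_set"
proof (induction k rule: int_induct[of _ 0])
  case (step1 k)
  then show ?case by (simp add: uea_const_add distrib_right uea_Z_set_closed)
next
  case (step2 k)
  then show ?case by (simp add: uea_const_diff left_diff_distrib uea_Z_set_closed)
qed (simp add: uea_Z_set_closed)

definition int_valued :: "complex poly \<Rightarrow> bool" where
  "int_valued f \<longleftrightarrow> (\<forall>n::int. poly f (of_int n) \<in> \<int>)"

lemma int_valued_binom_poly: "int_valued (binom_poly (of_int c) t)"
proof -
  have "poly (binom_poly (of_int c) t) (of_int n) = of_int (ibinom (n + c) t)" for n
    by (simp add: of_int_ibinom)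
  then show ?thesis unfolding int_valued_def by (metis Ints_of_int)
qed

lemma newton_expansion_int_valued:
  assumes "int_valued f"
  shows "\<exists>c. f = (\<Sum>j\<le>degree f. smult (of_int (c j)) (binom_poly 0 j))"
proof -
  have "\<exists>z. poly f (of_nat n) = of_int (1 * z)" for n
    using assms unfolding int_valued_def by (metis Ints_cases mult_1 of_int_of_nat_eq)
  then show ?thesis using newton_expansion[of f 1] by simp
qed

text \<open>In the commutation formula for X^(n) Y^(n) the summand \<open>t = n\<close> is the
  binomial of \<open>H\<close> over \<open>n\<close>, with shift 2n - n - n = 0. All others involve
  shifted binomials over some \<open>t < n\<close>, which are integral combinations of unshifted
  binomials over at most \<open>t\<close>.\<close>

lemma Hpoly_binom_poly_mem: "Hpoly (binom_poly 0 n) \<in> uea_Z_set"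
proof (induction n rule: less_induct)
  case (less n)
  have *: "Hpoly (binom_poly (of_int c) t) \<in> uea_Z_set" if t: "t < n" for c t
  proof -
    obtain k where k: "binom_poly (of_int c) t = (\<Sum>j\<le>degree (binom_poly (of_int c) t). smult (of_int (k j)) (binom_poly 0 j))"
      using newton_expansion_int_valued[OF int_valued_binom_poly] by blast
    show ?thesis
      by (subst k) (auto simp: Hpoly_sum Hpoly_smult intro!: uea_Z_set_sum uea_Z_set_of_int less
          dest: order_trans[OF _ degree_binom_poly] le_less_trans[OF _ t])
  qed
  have "divpow UX n * divpow UY n = (\<Sum>t<n. divpow UY (n - t) * Hbinom (2 * int t - int n - int n) t * divpow UX (n - t))
      + Hbinom 0 n"
    unfolding divpow_UX_UY by (simp add: lessThan_Suc_atMost[symmetric])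
  then have "Hpoly (binom_poly 0 n) = divpow UX n * divpow UY n
      - (\<Sum>t<n. divpow UY (n - t) * Hbinom (2 * int t - int n - int n) t * divpow UX (n - t))"
    by (simp add: Hbinom_eq_Hpoly)
  then show ?case
    by (auto simp only: Hbinom_eq_Hpoly lessThan_iff intro!: uea_Z_set_closed(4,6) uea_Z_set_sum divpow_mem *)
qed

lemma Hpoly_mem:
  assumes "int_valued f"
  shows "Hpoly f \<in> uea_Z_set"
proof -
  obtain c where c: "f = (\<Sum>j\<le>degree f. smult (of_int (c j)) (binom_poly 0 j))"
    using newton_expansion_int_valued[OF assms] by blast
  show ?thesis
    by (subst c) (auto simp: Hpoly_sum Hpoly_smult intro!: uea_Z_set_sum uea_Z_set_of_int Hpoly_binom_poly_mem)
qed

text \<open>With \<open>q = p\<close> this makes a polynomial in \<open>H\<close> whose values are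
  divisible by \<open>p\<close> vanish in the hyperalgebra.\<close>

lemma Hpoly_dvd:
  assumes "\<And>n::nat. \<exists>z. poly f (of_nat n) = of_int (q * z)"
  shows "\<exists>u\<in>uea_Z_set. Hpoly f = uea_const (of_int q) * u"
proof -
  obtain c where c: "f = (\<Sum>j\<le>degree f. smult (of_int (q * c j)) (binom_poly 0 j))"
    using newton_expansion[OF assms] by blast
  have "Hpoly f = uea_const (of_int q) * (\<Sum>j\<le>degree f. uea_const (of_int (c j)) * Hpoly (binom_poly 0 j))"
    by (subst c) (simp add: Hpoly_sum Hpoly_smult uea_const_mult sum_distrib_left mult.assoc)
  moreover have "(\<Sum>j\<le>degree f. uea_const (of_int (c j)) * Hpoly (binom_poly 0 j)) \<in> uea_Z_set"
    by (intro uea_Z_set_sum uea_Z_set_of_int Hpoly_binom_poly_mem)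
  ultimately show ?thesis by blast
qed

section \<open>Abstract divided power relations and nilpotency\<close>

text \<open>\<open>sc\<close> embeds the ground field and \<open>B c t\<close> stands for the binomial coefficient of \<open>H + c\<close> over \<open>t\<close>. The
  last two assumptions say that the elements \<open>B (- a - 1) (p^s - 1)\<close> are the idempotents of the weights
  modulo \<open>p^s\<close>.\<close>

locale divided_sl2 =
  fixes sc :: "'k::field \<Rightarrow> 'a::{ring, monoid_mult}" and X Y :: "nat \<Rightarrow> 'a"
    and B :: "int \<Rightarrow> nat \<Rightarrow> 'a" and p :: nat
  assumes char_p: "CHAR('k) = p" and p_pos: "p > 0"
    and sc_1 [simp]: "sc 1 = 1" and sc_add: "sc (c + d) = sc c + sc d"
    and sc_mult: "sc (c * d) = sc c * sc d"
    and sc_X: "sc c * X n = X n * sc c" and sc_Y: "sc c * Y n = Y n * sc c"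
    and sc_B: "sc c * B b t = B b t * sc c"
    and X_0 [simp]: "X 0 = 1" and Y_0 [simp]: "Y 0 = 1" and B_0 [simp]: "B b 0 = 1"
    and X_mult: "X m * X n = sc (of_nat ((m + n) choose m)) * X (m + n)"
    and Y_mult: "Y m * Y n = sc (of_nat ((m + n) choose m)) * Y (m + n)"
    and X_Y: "X n * Y m = (\<Sum>t\<le>min m n. Y (m - t) * B (2 * int t - int m - int n) t * X (n - t))"
    and B_X: "B b t * X n = X n * B (b + 2 * int n) t"
    and B_Y: "B b t * Y n = Y n * B (b - 2 * int n) t"
    and B_vandermonde: "B b t = (\<Sum>j\<le>t. sc (of_int (ibinom b (t - j))) * B 0 j)"
    and B_idem: "t < p ^ s \<Longrightarrow>
      B b t * B (- a - 1) (p ^ s - 1) = sc (of_int (ibinom (a + b) t)) * B (- a - 1) (p ^ s - 1)"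
    and sum_idem: "(\<Sum>a<p ^ s. B (- int a - 1) (p ^ s - 1)) = 1"
begin

section \<open>Weight idempotents\<close>

definition e :: "nat \<Rightarrow> int \<Rightarrow> 'a" where "e s a = B (- a - 1) (p ^ s - 1)"

lemma prime_p: "prime p"
  using char_p p_pos prime_CHAR_semidom[where 'a = 'k] by simp

lemma p_gt_1: "p > 1" using prime_p prime_gt_1_nat by simp

lemma of_int_k_eq_0_iff: "(of_int z :: 'k) = 0 \<longleftrightarrow> int p dvd z"
  using char_p of_int_eq_0_iff_char_dvd[where 'a = 'k] by simp

lemma of_nat_k_eq_0_iff: "(of_nat n :: 'k) = 0 \<longleftrightarrow> p dvd n"
  using char_p of_nat_eq_0_iff_char_dvd[where 'a = 'k] by simp

lemma of_int_k_cong: "[x = y] (mod int p) \<Longrightarrow> (of_int x :: 'k) = of_int y"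
  using of_int_k_eq_0_iff[of "x - y"] by (simp add: cong_iff_dvd_diff)

lemma sc_0 [simp]: "sc 0 = 0"
  using sc_add[of 0 0] by simp

lemma sc_uminus: "sc (- c) = - sc c"
  using sc_add[of c "- c"] by (simp add: eq_neg_iff_add_eq_0 add.commute)

lemma sc_inverse: "c \<noteq> 0 \<Longrightarrow> sc (1 / c) * (sc c * x) = x"
  by (simp add: mult.assoc[symmetric] sc_mult[symmetric])

lemma sc_left_X: "X n * (sc c * x) = sc c * (X n * x)"
  by (metis mult.assoc sc_X)

lemma sc_left_Y: "Y n * (sc c * x) = sc c * (Y n * x)"
  by (metis mult.assoc sc_Y)

lemma sc_left_B: "B b t * (sc c * x) = sc c * (B b t * x)"
  by (metis mult.assoc sc_B)

lemma sc_left_sc: "sc d * (sc c * x) = sc (d * c) * x"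
  by (simp add: sc_mult mult.assoc)

lemma sc_e: "sc c * e s a = e s a * sc c"
  by (simp add: e_def sc_B)

lemma e_X: "e s a * X n = X n * e s (a - 2 * int n)"
  by (simp add: e_def B_X algebra_simps)

lemma e_Y: "e s a * Y n = Y n * e s (a + 2 * int n)"
  by (simp add: e_def B_Y algebra_simps)

lemma X_e: "X n * e s a = e s (a + 2 * int n) * X n"
  by (simp add: e_X)

lemma Y_e: "Y n * e s a = e s (a - 2 * int n) * Y n"
  by (simp add: e_Y)

lemma B_e: "t < p ^ s \<Longrightarrow> B b t * e s a = sc (of_int (ibinom (a + b) t)) * e s a"
  unfolding e_def by (rule B_idem)

lemma sum_e: "(\<Sum>a<p ^ s. e s (int a)) = 1"
  unfolding e_def by (rule sum_idem)

text \<open>\<open>e s' b\<close> is itself a binomial in \<open>H\<close>, over a number below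
  \<open>p ^ s\<close>, so it acts on \<open>e s a\<close> by a scalar; by
  \<open>ibinom_indicator\<close> this scalar tests whether the weights agree modulo
  \<open>p ^ s'\<close>.\<close>

lemma e_e_le:
  assumes "s' \<le> s"
  shows "e s' b * e s a = (if [a = b] (mod int (p ^ s')) then e s a else 0)"
proof -
  define q where "q = p ^ s'"
  have q0: "q > 0" using p_pos by (simp add: q_def)
  have "q \<le> p ^ s" using assms p_pos by (simp add: q_def power_increasing)
  then have 1: "e s' b * e s a = sc (of_int (ibinom (a + (- b - 1)) (q - 1))) * e s a"
    using B_e[of "q - 1" s "- b - 1" a] q0 unfolding e_def[of s'] q_def by linarith
  have "[ibinom (a + (- b - 1)) (q - 1) = (if int q dvd a - b then 1 else 0)] (mod int p)"
    using ibinom_indicator[OF prime_p q_def, of "a - b"] by (simp add: algebra_simps)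
  from of_int_k_cong[OF this] show ?thesis
    using 1 by (simp add: q_def cong_iff_dvd_diff split: if_splits)
qed

text \<open>Multiplying \<open>e s a\<close> by the partition of unity leaves only the idempotent of
  the residue of \<open>a\<close>.\<close>

lemma e_cong:
  assumes "[a = b] (mod int (p ^ s))"
  shows "e s a = e s b"
proof -
  have *: "e s a = e s (a mod int (p ^ s))" for a
  proof -
    have q: "int (p ^ s) > 0" using p_pos by simp
    define k where "k = nat (a mod int (p ^ s))"
    have k: "int k = a mod int (p ^ s)" "k < p ^ s"
      using q by (simp_all add: k_def nat_less_iff)
    have "e s a = (\<Sum>c<p ^ s. e s a * e s (int c))"
      using sum_e[of s] by (simp add: sum_distrib_left[symmetric])
    also have "\<dots> = (\<Sum>c<p ^ s. if c = k then e s (int c) else 0)"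
    proof (rule sum.cong)
      fix c assume "c \<in> {..<p ^ s}"
      then have "[int c = a] (mod int (p ^ s)) \<longleftrightarrow> c = k"
        unfolding cong_def using k by (auto simp flip: zmod_int)
      then show "e s a * e s (int c) = (if c = k then e s (int c) else 0)"
        by (simp add: e_e_le)
    qed simp
    also have "\<dots> = e s (int k)" using k(2) by simp
    finally show ?thesis by (simp only: k(1))
  qed
  show ?thesis using *[of a] *[of b] assms by (simp add: cong_def)
qed

section \<open>The algebra generated below degree p^r\<close>

definition U :: "nat \<Rightarrow> 'a set" where
  "U r = subring_gen (range sc \<union> {X n | n. n \<le> p ^ r - 1} \<union> {Y n | n. n \<le> p ^ r - 1})"

lemma is_subring_U: "is_subring (U r)"
  unfolding U_def by (rule is_subring_subring_gen)

lemmas U_closed = is_subring_closed[OF is_subring_U]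

lemma sc_U: "sc c \<in> U r"
  unfolding U_def by (rule subsetD[OF subset_subring_gen]) blast

lemma X_U: "n < p ^ r \<Longrightarrow> X n \<in> U r"
  unfolding U_def by (rule subsetD[OF subset_subring_gen]) force

lemma Y_U: "n < p ^ r \<Longrightarrow> Y n \<in> U r"
  unfolding U_def by (rule subsetD[OF subset_subring_gen]) force

lemma U_least:
  assumes "is_subring A" "\<And>c. sc c \<in> A" "\<And>n. n < p ^ r \<Longrightarrow> X n \<in> A" "\<And>n. n < p ^ r \<Longrightarrow> Y n \<in> A"
  shows "U r \<subseteq> A"
proof -
  have "range sc \<union> {X n | n. n \<le> p ^ r - 1} \<union> {Y n | n. n \<le> p ^ r - 1} \<subseteq> A"
    using assms(2-4) p_pos by (auto simp: less_eq_Suc_le)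
      (metis Suc_pred assms(3,4) less_Suc_eq_le p_pos zero_less_power)+
  then show ?thesis using assms(1) unfolding U_def subring_gen_def by blast
qed

lemma U_sum: "(\<And>i. i \<in> A \<Longrightarrow> f i \<in> U r) \<Longrightarrow> sum f A \<in> U r"
  by (induction A rule: infinite_finite_induct) (auto intro: U_closed)

lemma U_power: "x \<in> U r \<Longrightarrow> x ^ n \<in> U r"
  by (induction n) (auto intro: U_closed)

lemma sc_U_commute:
  assumes "u \<in> U r"
  shows "sc c * u = u * sc c"
proof -
  let ?A = "{u. \<forall>c. sc c * u = u * sc c}"
  have "is_subring ?A"
    unfolding is_subring_def
  proof (intro conjI ballI)
    fix x y assume xy: "x \<in> ?A" "y \<in> ?A"
    then show "x - y \<in> ?A" by (simp add: algebra_simps)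
    have "sc c * (x * y) = x * y * sc c" for c
    proof -
      have c: "sc c * x = x * sc c" "sc c * y = y * sc c" using xy by blast+
      have "sc c * (x * y) = x * (sc c * y)" by (simp only: mult.assoc[symmetric] c(1))
      then show ?thesis by (simp only: c(2) mult.assoc)
    qed
    then show "x * y \<in> ?A" by simp
  qed simp
  moreover have "sc d * sc c = sc c * sc d" for c d
    by (simp flip: sc_mult add: mult.commute)
  ultimately have "U r \<subseteq> ?A"
    by (intro U_least) (auto simp: sc_X sc_Y)
  then show ?thesis using assms by blast
qed

lemma sc_left_U: "u \<in> U r \<Longrightarrow> u * (sc c * x) = sc c * (u * x)"
  by (metis mult.assoc sc_U_commute)

text \<open>\<open>B 0 t\<close> is the last summand of \<open>X t * Y t\<close>, and the other
  summands contain only binomials over smaller numbers. Vandermonde supplies the shift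
  \<open>b\<close>.\<close>

lemma B_U: "t < p ^ r \<Longrightarrow> B b t \<in> U r"
proof (induction t arbitrary: b rule: less_induct)
  case (less t)
  have "X t * Y t = (\<Sum>j<t. Y (t - j) * B (2 * int j - int t - int t) j * X (t - j)) + B 0 t"
    unfolding X_Y by (simp add: lessThan_Suc_atMost[symmetric])
  then have B0: "B 0 t = X t * Y t - (\<Sum>j<t. Y (t - j) * B (2 * int j - int t - int t) j * X (t - j))"
    by simp
  have "B 0 t \<in> U r" unfolding B0
    using less by (intro U_closed(4,6) U_sum X_U Y_U) auto
  then have "B 0 j \<in> U r" if "j \<le> t" for j
    using that less by (cases "j = t") auto
  then show ?case unfolding B_vandermonde[of b t]
    by (intro U_sum U_closed(6) sc_U) auto
qed

lemma e_U: "s \<le> r \<Longrightarrow> e s a \<in> U r"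
proof -
  assume "s \<le> r"
  then have "p ^ s \<le> p ^ r" using p_pos by (intro power_increasing) auto
  moreover have "p ^ s > 0" using p_pos by simp
  ultimately have "p ^ s - 1 < p ^ r" by linarith
  then show ?thesis unfolding e_def by (rule B_U)
qed

text \<open>The sum wraps modulo \<open>p ^ s\<close> to a residue below \<open>i\<close>. Hence
  \<open>X i * X j\<close> and \<open>Y i * Y j\<close> vanish as soon as the degree leaves the
  range below \<open>p ^ s\<close>.\<close>

lemma dvd_choose_overflow:
  assumes "i < p ^ s" "j < p ^ s" "p ^ s \<le> i + j"
  shows "p dvd ((i + j) choose i)"
proof -
  have "[ibinom (int (i + j)) i = ibinom (int (i + j) div int (p ^ s)) (i div p ^ s) *
      ibinom (int (i + j) mod int (p ^ s)) (i mod p ^ s)] (mod int p)"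
    by (rule ibinom_lucas[OF prime_p refl])
  moreover have "int (i + j) mod int (p ^ s) = int (i + j) - int (p ^ s)"
    using assms by (intro int_mod_pos_eq[of _ _ 1]) (auto simp: algebra_simps simp del: of_nat_power)
  then have "ibinom (int (i + j) mod int (p ^ s)) (i mod p ^ s) = 0"
    using assms by (intro ibinom_eq_0) (auto simp: algebra_simps simp del: of_nat_power)
  ultimately have "[int ((i + j) choose i) = 0] (mod int p)" by (simp only: ibinom_of_nat mult_zero_right)
  then show ?thesis by (metis cong_0_iff int_dvd_int_iff)
qed

section \<open>The filtration by exponents and carries\<close>

inductive_set F :: "nat \<Rightarrow> nat \<Rightarrow> 'a set" for r w where
  F_0: "0 \<in> F r w"
| F_step: "x \<in> F r w \<Longrightarrow> m < p ^ r \<Longrightarrow> n < p ^ r \<Longrightarrow>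
    w \<le> n * 2 ^ r + carry_rank p r (a - int m) (int m) \<Longrightarrow>
    x + sc c * (Y m * (e r a * X n)) \<in> F r w"

lemma F_add: "y \<in> F r w \<Longrightarrow> x \<in> F r w \<Longrightarrow> x + y \<in> F r w"
  by (induction rule: F.induct) (auto simp: add.assoc[symmetric] intro: F.intros)

lemma F_gen:
  assumes "m < p ^ r" "n < p ^ r" "w \<le> n * 2 ^ r + carry_rank p r (a - int m) (int m)"
  shows "sc c * (Y m * (e r a * X n)) \<in> F r w"
  using F_step[OF F_0 assms] by simp

lemma F_sc: "x \<in> F r w \<Longrightarrow> sc d * x \<in> F r w"
proof (induction rule: F.induct)
  case (F_step x m n a c)
  then show ?case
    using F.F_step[of "sc d * x" r w m n a "d * c"] by (simp add: distrib_left sc_left_sc)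
qed (simp add: F_0)

lemma F_mono: "x \<in> F r w \<Longrightarrow> w' \<le> w \<Longrightarrow> x \<in> F r w'"
  by (induction rule: F.induct) (auto intro: F.intros order_trans)

lemma F_sum: "(\<And>i. i \<in> A \<Longrightarrow> f i \<in> F r w) \<Longrightarrow> sum f A \<in> F r w"
  by (induction A rule: infinite_finite_induct) (auto intro: F_0 F_add)

lemma F_mult:
  assumes "x \<in> F r w" and z: "z \<in> U r"
    and "\<And>m n a. m < p ^ r \<Longrightarrow> n < p ^ r \<Longrightarrow> w \<le> n * 2 ^ r + carry_rank p r (a - int m) (int m) \<Longrightarrow>
      z * (Y m * (e r a * X n)) \<in> F r w'"
  shows "z * x \<in> F r w'"
  using assms(1)
proof (induction rule: F.induct)
  case (F_step x m n a c)
  then show ?case using assms(3)[of m n a] by (simp add: distrib_left sc_left_U[OF z] F_add F_sc)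
qed (simp add: F_0)

text \<open>One number encodes the lexicographic order of exponent and carries, because
  \<open>carry_rank\<close> stays below \<open>2 ^ r\<close>. As exponents stay below
  \<open>p ^ r\<close>, the filtration ends here.\<close>

lemma F_top: "x \<in> F r (p ^ r * 2 ^ r) \<Longrightarrow> x = 0"
proof (induction rule: F.induct)
  case (F_step x m n a c)
  have "n * 2 ^ r + carry_rank p r (a - int m) (int m) < Suc n * 2 ^ r"
    using carry_rank_less[of p r "a - int m" "int m"] by simp
  also have "\<dots> \<le> p ^ r * 2 ^ r" using F_step by (intro mult_right_mono) auto
  finally show ?case using F_step by simp
qed simp

lemma F_next:
  assumes "w \<le> n * 2 ^ r + carry_rank p r (a - int m) (int m)"
  shows "Suc w \<le> Suc n * 2 ^ r"
  using assms carry_rank_less[of p r "a - int m" "int m"] by simp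

text \<open>Of the summands in \<open>X_Y\<close> only \<open>t = n\<close> leaves no
  \<open>X\<close> to be multiplied into \<open>X n'\<close>; every other one reaches an exponent
  above \<open>n'\<close> or vanishes by overflow. Up to larger exponents \<open>X n\<close>
  therefore acts as on a baby Verma module, by a binomial coefficient.\<close>

lemma X_F_gen:
  assumes n: "n < p ^ r" and m: "m < p ^ r" "n' < p ^ r"
  obtains y where "y \<in> F r (Suc n' * 2 ^ r)"
    "X n * (Y m * (e r a * X n')) =
      (if n \<le> m then sc (of_int (ibinom (a - int m + int n) n)) * (Y (m - n) * (e r a * X n')) else 0) + y"
proof -
  define T where "T t = Y (m - t) * (B (2 * int t - int m - int n) t * (X (n - t) * (e r a * X n')))" for t
  have T: "T t = sc (of_nat ((n - t + n') choose (n - t)) *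
      of_int (ibinom (a + 2 * int (n - t) + (2 * int t - int m - int n)) t)) *
      (Y (m - t) * (e r (a + 2 * int (n - t)) * X (n - t + n')))" if "t \<le> n" for t
  proof -
    have "X (n - t) * (e r a * X n') = e r (a + 2 * int (n - t)) * (X (n - t) * X n')"
      by (simp only: mult.assoc[symmetric] X_e)
    also have "\<dots> = sc (of_nat ((n - t + n') choose (n - t))) * (e r (a + 2 * int (n - t)) * X (n - t + n'))"
      by (simp only: X_mult sc_left_U[OF e_U[OF order_refl]])
    finally have "B (2 * int t - int m - int n) t * (X (n - t) * (e r a * X n'))
       = sc (of_nat ((n - t + n') choose (n - t))) *
         ((B (2 * int t - int m - int n) t * e r (a + 2 * int (n - t))) * X (n - t + n'))"
      by (simp only: sc_left_B mult.assoc)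
    then show ?thesis unfolding T_def using that n by (simp add: B_e sc_left_Y sc_mult mult.assoc)
  qed
  have F: "T t \<in> F r (Suc n' * 2 ^ r)" if "t < n" "t \<le> m" for t
  proof (cases "n - t + n' < p ^ r")
    case True
    have "Suc n' * 2 ^ r \<le> (n - t + n') * 2 ^ r"
      using that by (intro mult_right_mono) auto
    then show ?thesis unfolding T[OF less_imp_le[OF that(1)]]
      by (intro F_gen) (use m True in auto)
  next
    case False
    then have "p dvd ((n - t + n') choose (n - t))"
      using n m by (intro dvd_choose_overflow) auto
    then have "(of_nat ((n - t + n') choose (n - t)) :: 'k) = 0"
      by (simp add: of_nat_k_eq_0_iff)
    then show ?thesis unfolding T[OF less_imp_le[OF that(1)]] by (simp add: F_0)
  qed
  have XY: "X n * (Y m * (e r a * X n')) = (\<Sum>t\<le>min m n. T t)"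
    unfolding T_def mult.assoc[symmetric] X_Y by (simp add: sum_distrib_right)
  show ?thesis
  proof (cases "n \<le> m")
    case True
    then have "(\<Sum>t\<le>min m n. T t) = (\<Sum>t<n. T t) + T n"
      by (simp add: lessThan_Suc_atMost[symmetric] min_absorb2)
    moreover have "T n = sc (of_int (ibinom (a - int m + int n) n)) * (Y (m - n) * (e r a * X n'))"
      by (subst T) (simp_all add: algebra_simps)
    moreover have "(\<Sum>t<n. T t) \<in> F r (Suc n' * 2 ^ r)" using F True by (intro F_sum) auto
    ultimately show ?thesis
      by (intro that[of "\<Sum>t<n. T t"]) (simp_all only: XY True if_True add.commute)
  next
    case False
    then have "(\<Sum>t\<le>min m n. T t) \<in> F r (Suc n' * 2 ^ r)" using F by (intro F_sum) auto
    then show ?thesis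
      by (rule that[of "\<Sum>t\<le>min m n. T t"]) (simp only: XY False if_False add_0)
  qed
qed

lemma Y_F_gen:
  "Y n * (Y m * z) = sc (of_nat ((m + n) choose n)) * (Y (m + n) * z)"
  by (simp only: mult.assoc[symmetric] Y_mult add.commute)

text \<open>Where the coefficient is nonzero, \<open>n\<close> passes from \<open>m\<close> to
  \<open>a - m\<close> and is added there without carries, so \<open>carry_rank_shift\<close>
  applies. In \<open>Y_F\<close> it passes the other way, and the symmetry of
  \<open>carry_rank\<close> is used.\<close>

lemma X_F: "n < p ^ r \<Longrightarrow> x \<in> F r w \<Longrightarrow> X n * x \<in> F r w"
proof (erule F_mult[OF _ X_U], assumption)
  fix m n' a
  assume n: "n < p ^ r" and m: "m < p ^ r" "n' < p ^ r"
    and w: "w \<le> n' * 2 ^ r + carry_rank p r (a - int m) (int m)"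
  obtain y where y: "y \<in> F r (Suc n' * 2 ^ r)" "X n * (Y m * (e r a * X n')) =
      (if n \<le> m then sc (of_int (ibinom (a - int m + int n) n)) * (Y (m - n) * (e r a * X n')) else 0) + y"
    using X_F_gen[OF n m] by metis
  have "sc (of_int (ibinom (a - int m + int n) n)) * (Y (m - n) * (e r a * X n')) \<in> F r w" if "n \<le> m"
  proof (cases "int p dvd ibinom (a - int m + int n) n")
    case True
    then have "(of_int (ibinom (a - int m + int n) n) :: 'k) = 0" by (simp add: of_int_k_eq_0_iff)
    then show ?thesis by (simp add: F_0)
  next
    case False
    have "carry_rank p r (a - int m) (int m) \<le> carry_rank p r (a - int (m - n)) (int (m - n))"
      using carry_rank_shift[OF prime_p False, of r "int (m - n)"] that by (simp add: algebra_simps)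
    then show ?thesis using w m by (intro F_gen) auto
  qed
  moreover have "y \<in> F r w" using y(1) F_next[OF w] by (auto intro: F_mono)
  ultimately show "X n * (Y m * (e r a * X n')) \<in> F r w"
    unfolding y(2) by (auto intro: F_add)
qed

lemma Y_F: "n < p ^ r \<Longrightarrow> x \<in> F r w \<Longrightarrow> Y n * x \<in> F r w"
proof (erule F_mult[OF _ Y_U], assumption)
  fix m n' a
  assume n: "n < p ^ r" and m: "m < p ^ r" "n' < p ^ r"
    and w: "w \<le> n' * 2 ^ r + carry_rank p r (a - int m) (int m)"
  show "Y n * (Y m * (e r a * X n')) \<in> F r w"
  proof (cases "p dvd ((m + n) choose n)")
    case True
    then have "(of_nat ((m + n) choose n) :: 'k) = 0" by (simp add: of_nat_k_eq_0_iff)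
    then show ?thesis unfolding Y_F_gen by (simp add: F_0)
  next
    case False
    then have lt: "m + n < p ^ r"
      using dvd_choose_overflow[OF n m(1)] by (metis add.commute not_le)
    have "\<not> int p dvd ibinom (int m + int n) n"
      using False ibinom_of_nat[of "m + n" n] by (simp del: ibinom_of_nat)
    from carry_rank_shift[OF prime_p this, of r "a - int m - int n"]
    have "carry_rank p r (a - int m) (int m) \<le> carry_rank p r (a - int (m + n)) (int (m + n))"
      by (simp add: carry_rank_commute[of _ _ "a - _"] algebra_simps)
    then show ?thesis unfolding Y_F_gen using lt w m by (intro F_gen) auto
  qed
qed

lemma U_F: "u \<in> U r \<Longrightarrow> x \<in> F r w \<Longrightarrow> u * x \<in> F r w"
proof -
  assume u: "u \<in> U r" and x: "x \<in> F r w"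
  let ?A = "{u. \<forall>x\<in>F r w. u * x \<in> F r w}"
  have "is_subring ?A"
    unfolding is_subring_def
  proof (intro conjI ballI)
    fix u v assume uv: "u \<in> ?A" "v \<in> ?A"
    have "(u - v) * x \<in> F r w" if "x \<in> F r w" for x
    proof -
      have "u * x + sc (- 1) * (v * x) \<in> F r w" using uv that by (auto intro: F_add F_sc)
      then show ?thesis by (simp add: sc_uminus algebra_simps)
    qed
    then show "u - v \<in> ?A" by simp
    show "u * v \<in> ?A" using uv by (simp add: mult.assoc)
  qed simp
  then have "U r \<subseteq> ?A" by (intro U_least) (auto intro: F_sc X_F Y_F)
  then show ?thesis using u x by blast
qed

lemma one_F: "1 \<in> F r 0"
proof -
  have "sc 1 * (Y 0 * (e r (int a) * X 0)) \<in> F r 0" for a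
    by (rule F_gen) (use p_pos in auto)
  then have "(\<Sum>a<p ^ r. e r (int a)) \<in> F r 0" by (intro F_sum) simp
  then show ?thesis by (simp add: sum_e)
qed

section \<open>Elements that move the filtration strictly\<close>

definition raising :: "nat \<Rightarrow> 'a \<Rightarrow> bool" where
  "raising r g \<longleftrightarrow> g \<in> U r \<and> (\<forall>w. \<forall>x\<in>F r w. g * x \<in> F r (Suc w))"

text \<open>The raising elements form a two-sided ideal, and a product of
  \<open>p ^ r * 2 ^ r\<close> of them moves \<open>1\<close> from level 0 to the level that is
  zero.\<close>

lemma nilpotent_ideal_gen_raising:
  assumes "\<And>g. g \<in> S \<Longrightarrow> raising r g"
  shows "nilpotent_ideal (ideal_gen (U r) S)"
proof -
  let ?Q = "{g. raising r g}"
  have "two_sided_ideal (U r) ?Q"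
    unfolding two_sided_ideal_def
  proof (intro conjI ballI)
    show "?Q \<subseteq> U r" by (auto simp: raising_def)
    show "0 \<in> ?Q" by (simp add: raising_def F_0 U_closed)
  next
    fix x y assume xy: "x \<in> ?Q" "y \<in> ?Q"
    have "(x - y) * z \<in> F r (Suc w)" if "z \<in> F r w" for w z
    proof -
      have "x * z + sc (- 1) * (y * z) \<in> F r (Suc w)"
        using xy that unfolding raising_def by (auto intro!: F_add F_sc)
      then show ?thesis by (simp add: sc_uminus algebra_simps)
    qed
    then show "x - y \<in> ?Q" using xy by (auto simp: raising_def U_closed)
  next
    fix u x assume ux: "u \<in> U r" "x \<in> ?Q"
    then show "u * x \<in> ?Q" by (auto simp: raising_def mult.assoc intro: U_closed U_F)
    show "x * u \<in> ?Q" using ux by (auto simp: raising_def mult.assoc intro: U_closed U_F)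
  qed
  then have Q: "ideal_gen (U r) S \<subseteq> ?Q" using assms unfolding ideal_gen_def by blast
  have "prod_list xs \<in> F r (length xs)" if "set xs \<subseteq> ?Q" for xs
    using that by (induction xs) (auto simp: one_F raising_def)
  then have "prod_list xs = 0" if "length xs = p ^ r * 2 ^ r" "set xs \<subseteq> ideal_gen (U r) S" for xs
    using that Q by (metis F_top order_trans)
  then show ?thesis unfolding nilpotent_ideal_def by blast
qed

text \<open>Without a carry the residue of \<open>m\<close> is at most \<open>q - 1 - n\<close>, so
  \<open>l mod q + n - m mod q\<close> exceeds \<open>2 * n - q\<close>, and it is already reduced
  modulo \<open>q\<close>. Read backwards, a weight with residue at most \<open>2 * n - q\<close>
  forces a carry.\<close>

lemma no_carry_weight:
  fixes l m :: int
  assumes "0 < q" "n < q" "l mod int q + int n mod int q < int q" "m mod int q + int n mod int q < int q" "q \<le> 2 * n"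
  shows "(l + int n - m) mod int q > 2 * int n - int q"
proof -
  have n: "int n mod int q = int n" using assms(2) by simp
  have "l + int n - m = int q * (l div int q - m div int q) + (l mod int q + int n - m mod int q)"
    by (simp add: algebra_simps)
  moreover have "0 \<le> l mod int q" "0 \<le> m mod int q" using assms(1) by auto
  then have "0 \<le> l mod int q + int n - m mod int q" "l mod int q + int n - m mod int q < int q"
    "2 * int n - int q < l mod int q + int n - m mod int q"
    using assms(2-5) n by linarith+
  ultimately show ?thesis using int_mod_pos_eq by metis
qed

text \<open>The two alternatives for the weight serve the two kinds of generators:
  \<open>l + n - m\<close> is the weight reached after applying \<open>X n\<close>, and
  \<open>m + n - l\<close> is the weight before applying \<open>Y n\<close>.\<close>

lemma carry_rank_strict:
  assumes i: "i < r" and n: "n < p ^ Suc i" "p ^ Suc i \<le> 2 * n"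
    and w: "(l + int n - m) mod int (p ^ Suc i) \<le> 2 * int n - int (p ^ Suc i) \<or>
            (m + int n - l) mod int (p ^ Suc i) \<le> 2 * int n - int (p ^ Suc i)"
    and nd: "\<not> int p dvd ibinom (l + int n) n"
  shows "carry_rank p r l (m + int n) < carry_rank p r (l + int n) m"
proof -
  define q where "q = p ^ Suc i"
  have q0: "q > 0" using p_pos by (simp add: q_def)
  have l: "l mod int q + int n mod int q < int q"
    using not_dvd_ibinom_step(1)[OF prime_p q_def nd] by (simp add: zmod_int)
  have "\<not> m mod int q + int n mod int q < int q"
  proof
    assume m: "m mod int q + int n mod int q < int q"
    have nq: "n < q" "q \<le> 2 * n" using n by (simp_all add: q_def)
    show False
      using no_carry_weight[OF q0 nq(1) l m nq(2)] no_carry_weight[OF q0 nq(1) m l nq(2)] w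
      unfolding q_def[symmetric] by linarith
  qed
  then show ?thesis
    using carry_rank_shift[OF prime_p nd, of r m] i by (auto simp: q_def)
qed

text \<open>The factor \<open>f\<close> removes every summand for which the weight does not
  guarantee a strict increase of \<open>carry_rank\<close>; on the remaining ones
  \<open>carry_rank_strict\<close> applies.\<close>

lemma raising_X:
  assumes f: "f \<in> U r" "\<And>a. f * e r a = sc (\<phi> a) * e r a"
    and i: "i < r" "n < p ^ Suc i" "p ^ Suc i \<le> 2 * n"
    and \<phi>: "\<And>a. \<phi> a \<noteq> 0 \<Longrightarrow> a mod int (p ^ Suc i) \<le> 2 * int n - int (p ^ Suc i)"
  shows "raising r (f * X n)"
proof -
  have "p ^ Suc i \<le> p ^ r" using i p_pos by (intro power_increasing) auto
  then have n: "n < p ^ r" using i by linarith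
  have "f * X n * x \<in> F r (Suc w)" if "x \<in> F r w" for x w
    using that
  proof (rule F_mult)
    show "f * X n \<in> U r" using f n by (intro U_closed X_U)
  next
    fix m n' a
    assume m: "m < p ^ r" "n' < p ^ r" and w: "w \<le> n' * 2 ^ r + carry_rank p r (a - int m) (int m)"
    obtain y where y: "y \<in> F r (Suc n' * 2 ^ r)" "X n * (Y m * (e r a * X n')) =
        (if n \<le> m then sc (of_int (ibinom (a - int m + int n) n)) * (Y (m - n) * (e r a * X n')) else 0) + y"
      using X_F_gen[OF n m] by metis
    have "f * y \<in> F r (Suc w)"
      using y(1) F_next[OF w] f(1) by (auto intro: F_mono U_F)
    moreover have "f * (sc (of_int (ibinom (a - int m + int n) n)) * (Y (m - n) * (e r a * X n'))) \<in> F r (Suc w)"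
      if nm: "n \<le> m"
    proof -
      have "f * (Y (m - n) * (e r a * X n')) = f * e r (a - 2 * int (m - n)) * Y (m - n) * X n'"
        by (simp only: mult.assoc[symmetric] Y_e)
      also have "\<dots> = sc (\<phi> (a - 2 * int (m - n))) * (Y (m - n) * (e r a * X n'))"
        unfolding f(2) by (simp only: mult.assoc) (simp only: mult.assoc[symmetric] Y_e)
      finally have eq: "f * (sc (of_int (ibinom (a - int m + int n) n)) * (Y (m - n) * (e r a * X n')))
          = sc (of_int (ibinom (a - int m + int n) n) * \<phi> (a - 2 * int (m - n))) * (Y (m - n) * (e r a * X n'))"
        by (simp add: sc_left_U[OF f(1)] sc_left_sc)
      show ?thesis
      proof (cases "int p dvd ibinom (a - int m + int n) n \<or> \<phi> (a - 2 * int (m - n)) = 0")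
        case True
        then have z: "of_int (ibinom (a - int m + int n) n) * \<phi> (a - 2 * int (m - n)) = 0"
          by (auto simp: of_int_k_eq_0_iff)
        show ?thesis unfolding eq z by (simp add: F_0)
      next
        case False
        have "carry_rank p r (a - int m) (int (m - n) + int n) < carry_rank p r (a - int m + int n) (int (m - n))"
          using False \<phi>[of "a - 2 * int (m - n)"] nm
          by (intro carry_rank_strict[OF i]) (auto simp: algebra_simps)
        then have "carry_rank p r (a - int m) (int m) < carry_rank p r (a - int (m - n)) (int (m - n))"
          using nm by (simp add: algebra_simps)
        then show ?thesis unfolding eq using m w by (intro F_gen) auto
      qed
    qed
    ultimately have "f * (X n * (Y m * (e r a * X n'))) \<in> F r (Suc w)"
      unfolding y(2) by (auto simp: distrib_left intro: F_add)
    then show "f * X n * (Y m * (e r a * X n')) \<in> F r (Suc w)" by (simp add: mult.assoc)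
  qed
  then show ?thesis unfolding raising_def using f n by (auto intro: U_closed X_U)
qed

lemma raising_Y:
  assumes f: "f \<in> U r" "\<And>a. f * e r a = sc (\<phi> a) * e r a"
    and i: "i < r" "n < p ^ Suc i" "p ^ Suc i \<le> 2 * n"
    and \<phi>: "\<And>a. \<phi> a \<noteq> 0 \<Longrightarrow> a mod int (p ^ Suc i) \<le> 2 * int n - int (p ^ Suc i)"
  shows "raising r (Y n * f)"
proof -
  have "p ^ Suc i \<le> p ^ r" using i p_pos by (intro power_increasing) auto
  then have n: "n < p ^ r" using i by linarith
  have "Y n * f * x \<in> F r (Suc w)" if "x \<in> F r w" for x w
    using that
  proof (rule F_mult)
    show "Y n * f \<in> U r" using f n by (intro U_closed Y_U)
  next
    fix m n' a
    assume m: "m < p ^ r" "n' < p ^ r" and w: "w \<le> n' * 2 ^ r + carry_rank p r (a - int m) (int m)"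
    have "f * (Y m * (e r a * X n')) = f * e r (a - 2 * int m) * Y m * X n'"
      by (simp only: mult.assoc[symmetric] Y_e)
    also have "\<dots> = sc (\<phi> (a - 2 * int m)) * (Y m * (e r a * X n'))"
      unfolding f(2) by (simp only: mult.assoc) (simp only: mult.assoc[symmetric] Y_e)
    finally have eq: "Y n * f * (Y m * (e r a * X n'))
        = sc (\<phi> (a - 2 * int m) * of_nat ((m + n) choose n)) * (Y (m + n) * (e r a * X n'))"
      by (simp add: mult.assoc sc_left_Y Y_F_gen sc_left_sc)
    show "Y n * f * (Y m * (e r a * X n')) \<in> F r (Suc w)"
    proof (cases "p dvd ((m + n) choose n) \<or> \<phi> (a - 2 * int m) = 0")
      case True
      then have z: "\<phi> (a - 2 * int m) * of_nat ((m + n) choose n) = 0"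
        by (auto simp: of_nat_k_eq_0_iff)
      show ?thesis unfolding eq z by (simp add: F_0)
    next
      case False
      have lt: "m + n < p ^ r"
        using dvd_choose_overflow[OF n m(1)] False by (metis add.commute not_le)
      have "\<not> int p dvd ibinom (int m + int n) n"
        using False ibinom_of_nat[of "m + n" n] by (simp del: ibinom_of_nat)
      then have "carry_rank p r (int m) (a - int m - int n + int n) < carry_rank p r (int m + int n) (a - int m - int n)"
        using False \<phi>[of "a - 2 * int m"]
        by (intro carry_rank_strict[OF i]) (auto simp: algebra_simps)
      then have "carry_rank p r (a - int m) (int m) < carry_rank p r (a - int (m + n)) (int (m + n))"
        by (simp add: carry_rank_commute[of _ _ "a - _"] algebra_simps)
      then show ?thesis unfolding eq using lt m w by (intro F_gen) auto
    qed
  qed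
  then show ?thesis unfolding raising_def using f n by (auto intro: U_closed Y_U)
qed

end

lemma two_sided_ideal_ideal_gen:
  assumes "is_subring A" "S \<subseteq> A"
  shows "two_sided_ideal A (ideal_gen A S)"
proof -
  have "two_sided_ideal A A"
    unfolding two_sided_ideal_def
    by (intro conjI ballI subset_refl is_subring_closed[OF assms(1)])
  then have "ideal_gen A S \<subseteq> A" unfolding ideal_gen_def using assms(2) by blast
  then show ?thesis unfolding two_sided_ideal_def ideal_gen_def by auto
qed

section \<open>One layer as a module over restricted sl2\<close>

lemma mod_eq_shift:
  fixes q :: int
  assumes "a mod q = l" "c = l + d + q * k" "0 \<le> c" "c < q"
  shows "(a + d) mod q = c"
proof (rule int_mod_pos_eq)
  have "a = q * (a div q) + l" using assms(1) mult_div_mod_eq by metis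
  then show "a + d = q * (a div q - k) + c" using assms(2) by (simp add: algebra_simps)
qed (use assms in auto)

text \<open>In the application \<open>x\<close> and \<open>y\<close> are \<open>X (p^s)\<close> and \<open>Y (p^s)\<close>, and \<open>W a\<close> consists of vectors of weight
  \<open>l + p^s a\<close> for a fixed \<open>l\<close>. The case \<open>p = 2\<close>, \<open>\<nu> = 1\<close> serves for part (ii).\<close>

locale sl2_layer = divided_sl2 sc X Y B p
  for sc :: "'k::field \<Rightarrow> 'a::{ring, monoid_mult}" and X Y :: "nat \<Rightarrow> 'a"
    and B :: "int \<Rightarrow> nat \<Rightarrow> 'a" and p :: nat +
  fixes J :: "'a set" and W :: "int \<Rightarrow> 'a set" and x y :: 'a and \<nu> :: nat
  assumes J_0: "0 \<in> J" and J_diff: "u \<in> J \<Longrightarrow> v \<in> J \<Longrightarrow> u - v \<in> J"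
    and J_sc: "v \<in> J \<Longrightarrow> sc c * v \<in> J" and J_x: "v \<in> J \<Longrightarrow> x * v \<in> J" and J_y: "v \<in> J \<Longrightarrow> y * v \<in> J"
    and W_diff: "u \<in> W a \<Longrightarrow> v \<in> W a \<Longrightarrow> u - v \<in> W a" and W_J: "J \<subseteq> W a"
    and W_sc: "v \<in> W a \<Longrightarrow> sc c * v \<in> W a"
    and W_x: "v \<in> W a \<Longrightarrow> x * v \<in> W (a + 2)" and W_y: "v \<in> W a \<Longrightarrow> y * v \<in> W (a - 2)"
    and W_cong: "[a = b] (mod int p) \<Longrightarrow> W a = W b"
    and x_sc: "x * (sc c * v) = sc c * (x * v)" and y_sc: "y * (sc c * v) = sc c * (y * v)"
    and commutator: "v \<in> W a \<Longrightarrow> x * (y * v) - (y * (x * v) + sc (of_int a) * v) \<in> J"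
    and x_power_p: "v \<in> W a \<Longrightarrow> x ^ p * v \<in> J"
    and x_relation: "v \<in> W a \<Longrightarrow> (a + 2 * (int p - int \<nu>)) mod int p \<le> int p - 2 * int \<nu> \<Longrightarrow>
      x ^ (p - \<nu>) * v \<in> J"
    and y_relation: "v \<in> W a \<Longrightarrow> a mod int p \<le> int p - 2 * int \<nu> \<Longrightarrow> y ^ (p - \<nu>) * v \<in> J"
    and nu: "1 \<le> \<nu>" "2 * \<nu> < p \<or> p = 2 \<and> \<nu> = 1"
begin

lemma prime_int_p: "prime (int p)" using prime_p by simp

section \<open>Computing modulo J\<close>

definition eqJ :: "'a \<Rightarrow> 'a \<Rightarrow> bool" (infix "\<approx>" 50) where "u \<approx> v \<longleftrightarrow> u - v \<in> J"

lemma J_uminus: "v \<in> J \<Longrightarrow> - v \<in> J" using J_diff[OF J_0] by simp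

lemma J_add: "u \<in> J \<Longrightarrow> v \<in> J \<Longrightarrow> u + v \<in> J" using J_diff[OF _ J_uminus, of u v] by simp

lemma eqJ_refl: "u \<approx> u" by (simp add: eqJ_def J_0)

lemma eqJ_sym: "u \<approx> v \<Longrightarrow> v \<approx> u" using J_uminus by (fastforce simp: eqJ_def)

lemma eqJ_trans [trans]: "u \<approx> v \<Longrightarrow> v \<approx> w \<Longrightarrow> u \<approx> w"
  using J_add[of "u - v" "v - w"] by (simp add: eqJ_def)

lemma eqJ_add: "u \<approx> v \<Longrightarrow> u' \<approx> v' \<Longrightarrow> u + u' \<approx> v + v'"
  using J_add[of "u - v" "u' - v'"] by (simp add: eqJ_def algebra_simps)

lemma eqJ_diff: "u \<approx> v \<Longrightarrow> u' \<approx> v' \<Longrightarrow> u - u' \<approx> v - v'"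
  using J_diff[of "u - v" "u' - v'"] by (simp add: eqJ_def algebra_simps)

lemma eqJ_sc: "u \<approx> v \<Longrightarrow> sc c * u \<approx> sc c * v"
  using J_sc[of "u - v" c] by (simp add: eqJ_def algebra_simps)

lemma eqJ_x: "u \<approx> v \<Longrightarrow> x * u \<approx> x * v"
  using J_x[of "u - v"] by (simp add: eqJ_def algebra_simps)

lemma eqJ_y: "u \<approx> v \<Longrightarrow> y * u \<approx> y * v"
  using J_y[of "u - v"] by (simp add: eqJ_def algebra_simps)

lemma eqJ_x_power: "u \<approx> v \<Longrightarrow> x ^ n * u \<approx> x ^ n * v"
  by (induction n) (simp_all add: mult.assoc eqJ_x)

lemma eqJ_J: "u \<approx> v \<Longrightarrow> v \<in> J \<Longrightarrow> u \<in> J"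
  using J_add[of "u - v" v] by (simp add: eqJ_def)

lemma eqJ_0: "u \<approx> 0 \<longleftrightarrow> u \<in> J" by (simp add: eqJ_def)

lemma eqJ_sum: "(\<And>i. i \<in> A \<Longrightarrow> f i \<approx> g i) \<Longrightarrow> sum f A \<approx> sum g A"
  by (induction A rule: infinite_finite_induct) (auto intro: eqJ_refl eqJ_add)

lemma J_x_power: "v \<in> J \<Longrightarrow> x ^ n * v \<in> J"
  by (induction n) (simp_all add: mult.assoc J_x)

lemma J_y_power: "v \<in> J \<Longrightarrow> y ^ n * v \<in> J"
  by (induction n) (simp_all add: mult.assoc J_y)

lemma J_sc_cancel: "sc c * v \<in> J \<Longrightarrow> c \<noteq> 0 \<Longrightarrow> v \<in> J"
  using J_sc[of "sc c * v" "1 / c"] by (simp add: sc_inverse)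

lemma W_uminus: "v \<in> W a \<Longrightarrow> - v \<in> W a"
  using W_diff[of 0 a v] W_J[of a] J_0 by auto

lemma W_add: "u \<in> W a \<Longrightarrow> v \<in> W a \<Longrightarrow> u + v \<in> W a"
  using W_diff[OF _ W_uminus, of u a v] by simp

lemma W_x_power: "v \<in> W a \<Longrightarrow> x ^ n * v \<in> W (a + 2 * int n)"
proof (induction n)
  case (Suc n)
  then show ?case using W_x[of "x ^ n * v" "a + 2 * int n"] by (simp add: mult.assoc algebra_simps)
qed simp

lemma W_y_power: "v \<in> W a \<Longrightarrow> y ^ n * v \<in> W (a - 2 * int n)"
proof (induction n)
  case (Suc n)
  then show ?case using W_y[of "y ^ n * v" "a - 2 * int n"] by (simp add: mult.assoc algebra_simps)
qed simp

lemma x_power_sc: "x ^ n * (sc c * v) = sc c * (x ^ n * v)"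
  by (induction n) (simp_all add: mult.assoc x_sc)

lemma y_power_sc: "y ^ n * (sc c * v) = sc c * (y ^ n * v)"
  by (induction n) (simp_all add: mult.assoc y_sc)

section \<open>Strings of weight vectors\<close>

lemma x_y_power:
  assumes v: "v \<in> W a"
  shows "x * (y ^ Suc i * v) \<approx> y ^ Suc i * (x * v) + sc (of_int ((int i + 1) * (a - int i))) * (y ^ i * v)"
proof (induction i)
  case 0
  show ?case using commutator[OF v] by (simp add: eqJ_def)
next
  case (Suc i)
  have "x * (y ^ Suc (Suc i) * v) \<approx> y * (x * (y ^ Suc i * v)) + sc (of_int (a - 2 * int (Suc i))) * (y ^ Suc i * v)"
    using commutator[OF W_y_power[OF v, of "Suc i"]] by (simp add: eqJ_def mult.assoc)
  also have "\<dots> \<approx> y * (y ^ Suc i * (x * v) + sc (of_int ((int i + 1) * (a - int i))) * (y ^ i * v))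
      + sc (of_int (a - 2 * int (Suc i))) * (y ^ Suc i * v)"
    by (intro eqJ_add eqJ_y Suc eqJ_refl)
  also have "\<dots> = y ^ Suc (Suc i) * (x * v) + (sc (of_int ((int i + 1) * (a - int i))) + sc (of_int (a - 2 * int (Suc i)))) * (y ^ Suc i * v)"
    by (simp only: distrib_left distrib_right y_sc power_Suc mult.assoc add.assoc)
  also have "sc (of_int ((int i + 1) * (a - int i))) + sc (of_int (a - 2 * int (Suc i)))
     = sc (of_int ((int (Suc i) + 1) * (a - int (Suc i))))"
    by (simp only: sc_add[symmetric] of_int_add[symmetric]) (simp add: algebra_simps)
  finally show ?case .
qed

text \<open>The hypothesis is on \<open>y * (x * v)\<close> rather than on \<open>x * v\<close>,
  because \<open>lowest_vector_in_J\<close> works with a vector \<open>u\<close> whose image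
  \<open>x * u\<close> is not yet known to lie in \<open>J\<close>.\<close>

lemma x_y_power_primitive:
  assumes "v \<in> W a" "y * (x * v) \<in> J"
  shows "x * (y ^ Suc i * v) \<approx> sc (of_int ((int i + 1) * (a - int i))) * (y ^ i * v)"
proof -
  have "y ^ Suc i * (x * v) \<approx> 0"
    using J_y_power[OF assms(2), of i] by (simp only: eqJ_0 power_Suc2 mult.assoc)
  from eqJ_add[OF this eqJ_refl] show ?thesis
    using eqJ_trans[OF x_y_power[OF assms(1)]] by fastforce
qed

lemma weight_coeff_nonzero:
  assumes "int i < a mod int p"
  shows "(of_int ((int i + 1) * (a - int i)) :: 'k) \<noteq> 0"
proof -
  have l: "a mod int p < int p" using p_pos by simp
  have "\<not> int p dvd int i + 1" using assms l by (intro zdvd_not_zless) auto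
  moreover have "\<not> int p dvd a - int i"
  proof -
    have "(a - int i) mod int p = a mod int p - int i"
      using assms l mod_eq_shift[of a "int p" "a mod int p" "a mod int p - int i" "- int i" 0] by simp
    then show ?thesis using assms by (auto simp: dvd_eq_mod_eq_0)
  qed
  ultimately show ?thesis
    by (simp only: of_int_k_eq_0_iff prime_dvd_mult_iff[OF prime_int_p]) simp
qed

text \<open>A string can be climbed back up to its top: each step multiplies by some (i + 1)(a - i),
  which is invertible while \<open>i\<close> is below the residue of \<open>a\<close>.\<close>

lemma x_power_y_power_primitive:
  assumes v: "v \<in> W a" "y * (x * v) \<in> J" and j: "int j \<le> a mod int p"
  shows "\<exists>c. c \<noteq> 0 \<and> x ^ j * (y ^ j * v) \<approx> sc c * v"
  using j
proof (induction j)
  case 0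
  show ?case by (rule exI[of _ 1]) (simp add: eqJ_refl)
next
  case (Suc j)
  then obtain c where c: "c \<noteq> 0" "x ^ j * (y ^ j * v) \<approx> sc c * v" by auto
  let ?d = "of_int ((int j + 1) * (a - int j)) :: 'k"
  have d: "?d \<noteq> 0" using Suc.prems by (intro weight_coeff_nonzero) simp
  have "x ^ Suc j * (y ^ Suc j * v) = x ^ j * (x * (y ^ Suc j * v))"
    by (simp only: power_Suc2 mult.assoc)
  also have "\<dots> \<approx> x ^ j * (sc ?d * (y ^ j * v))"
    by (intro eqJ_x_power x_y_power_primitive v)
  also have "\<dots> = sc ?d * (x ^ j * (y ^ j * v))" by (rule x_power_sc)
  also have "\<dots> \<approx> sc ?d * (sc c * v)" by (intro eqJ_sc c)
  also have "\<dots> = sc (?d * c) * v" by (rule sc_left_sc)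
  finally show ?case using c d by (intro exI[of _ "?d * c"]) simp
qed

definition HW :: "int \<Rightarrow> 'a set" where "HW a = {v \<in> W a. x * v \<in> J}"

lemma HW_y: "v \<in> HW a \<Longrightarrow> v \<in> W a \<and> y * (x * v) \<in> J"
  by (simp add: HW_def J_y)

text \<open>Let \<open>l\<close> be the residue of \<open>a\<close>. The relation kills
  \<open>y ^ t * v\<close> for one exponent \<open>t\<close> with \<open>l < t < p\<close>. From
  there \<open>x\<close> leads down to all exponents above \<open>l\<close>, since (i + 1)(a - i) is
  invertible for l < i < p - 1, and \<open>y\<close> leads up.\<close>

lemma y_power_HW:
  assumes v: "v \<in> HW a" and j: "a mod int p < int j" "j < p"
  shows "y ^ j * v \<in> J"
proof -
  define l where "l = nat (a mod int p)"
  have l: "a mod int p = int l" using p_pos by (simp add: l_def)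
  \<comment> \<open>The least \<open>t0\<close> for which the weight \<open>l - 2 * t0\<close> of
    \<open>y ^ t0 * v\<close> is at most \<open>p - 2 * \<nu>\<close>, so that
    \<open>y_relation\<close> applies to it. Truncated subtraction gives 0 if \<open>l\<close> is
    already in the range.\<close>
  define t0 where "t0 = (l + 2 * \<nu> + 1 - p) div 2"
  have lp: "l < j" "j < p" using j l by auto
  have t0: "2 * t0 \<le> l" "l + 2 * \<nu> \<le> p + 2 * t0" "t0 < \<nu>" "l < p - \<nu> + t0" "p - \<nu> + t0 < p"
    using nu lp unfolding t0_def by auto
  define t where "t = p - \<nu> + t0"
  have "(a - 2 * int t0) mod int p = int l - 2 * int t0"
    using t0 lp mod_eq_shift[OF l, of "int l - 2 * int t0" "- 2 * int t0" 0] by simp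
  then have "y ^ (p - \<nu>) * (y ^ t0 * v) \<in> J"
    using v t0 by (intro y_relation[of _ "a - 2 * int t0"]) (auto simp: HW_def intro: W_y_power)
  then have t: "y ^ t * v \<in> J" by (simp add: t_def power_add mult.assoc)
  have down: "y ^ i * v \<in> J" if "y ^ Suc i * v \<in> J" "l < i" "Suc i < p" for i
  proof -
    have "sc (of_int ((int i + 1) * (a - int i))) * (y ^ i * v) \<approx> x * (y ^ Suc i * v)"
      using HW_y[OF v] by (intro eqJ_sym[OF x_y_power_primitive]) auto
    then have 1: "sc (of_int ((int i + 1) * (a - int i))) * (y ^ i * v) \<in> J"
      using J_x[OF that(1)] eqJ_J by blast
    have "\<not> int p dvd int i + 1" using that by (intro zdvd_not_zless) auto
    moreover have "\<not> int p dvd a - int i"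
    proof -
      have "(a - int i) mod int p = int l - int i + int p"
        using that mod_eq_shift[OF l, of "int l - int i + int p" "- int i" 1] by simp
      then show ?thesis using that by (auto simp: dvd_eq_mod_eq_0)
    qed
    ultimately have "(of_int ((int i + 1) * (a - int i)) :: 'k) \<noteq> 0"
      by (simp only: of_int_k_eq_0_iff prime_dvd_mult_iff[OF prime_int_p]) simp
    with 1 show ?thesis by (rule J_sc_cancel)
  qed
  have "y ^ i * v \<in> J" if "l < i" "i \<le> t" for i
    using that(2,1)
  proof (induction rule: inc_induct)
    case base show ?case by (rule t)
  next
    case (step n)
    have "l < Suc n" using step.prems by simp
    then have 1: "y ^ Suc n * v \<in> J" by (rule step.IH)
    have "Suc n < p" using step.hyps t0(5) unfolding t_def by linarith
    then show ?case using down[OF 1 step.prems] by blast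
  qed
  moreover have "y ^ j * v \<in> J" if "t \<le> j"
  proof -
    have "y ^ j * v = y ^ (j - t) * (y ^ t * v)"
      using that by (simp add: mult.assoc[symmetric] power_add[symmetric])
    then show ?thesis using J_y_power[OF t] by simp
  qed
  ultimately show ?thesis using lp(1) le_cases[of j t] by blast
qed

section \<open>Generation by primitive vectors\<close>

definition V :: "int \<Rightarrow> 'a set" where
  "V a = {v \<in> W a. \<exists>w. (\<forall>j<p. w j \<in> HW (a + 2 * int j)) \<and> v \<approx> (\<Sum>j<p. y ^ j * w j)}"

lemma HW_closed: "J \<subseteq> HW a" "u \<in> HW a \<Longrightarrow> v \<in> HW a \<Longrightarrow> u + v \<in> HW a" "v \<in> HW a \<Longrightarrow> sc c * v \<in> HW a"
  using W_J J_x by (auto simp: HW_def distrib_left x_sc intro: J_add J_sc W_add W_sc)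

lemma V_add: "u \<in> V a \<Longrightarrow> v \<in> V a \<Longrightarrow> u + v \<in> V a"
proof -
  assume "u \<in> V a" "v \<in> V a"
  then obtain w w' where w: "u \<in> W a" "\<forall>j<p. w j \<in> HW (a + 2 * int j)" "u \<approx> (\<Sum>j<p. y ^ j * w j)"
    and w': "v \<in> W a" "\<forall>j<p. w' j \<in> HW (a + 2 * int j)" "v \<approx> (\<Sum>j<p. y ^ j * w' j)"
    by (auto simp: V_def)
  have "u + v \<approx> (\<Sum>j<p. y ^ j * (w j + w' j))"
    using eqJ_add[OF w(3) w'(3)] by (simp add: distrib_left sum.distrib)
  moreover have "\<forall>j<p. w j + w' j \<in> HW (a + 2 * int j)" using w(2) w'(2) HW_closed(2) by blast
  moreover have "u + v \<in> W a" using w(1) w'(1) by (rule W_add)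
  ultimately show ?thesis unfolding V_def
    by (intro CollectI conjI exI[of _ "\<lambda>j. w j + w' j"])
qed

lemma V_gen:
  assumes "v \<in> HW (a + 2 * int j)" "j < p"
  shows "y ^ j * v \<in> V a"
proof -
  define w where "w i = (if i = j then v else 0)" for i
  have "(\<Sum>i<p. y ^ i * w i) = y ^ j * v"
    using assms(2) by (simp add: w_def if_distrib cong: if_cong)
  moreover have "w i \<in> HW (a + 2 * int i)" for i
    using assms HW_closed(1) J_0 by (auto simp: w_def)
  moreover have "y ^ j * v \<in> W a" using assms(1) W_y_power[of v "a + 2 * int j" j] by (simp add: HW_def)
  ultimately show ?thesis unfolding V_def
    by (intro CollectI conjI exI[of _ w] allI impI) (simp_all only: eqJ_refl)
qed

lemma J_V: "J \<subseteq> V a"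
proof
  fix v assume v: "v \<in> J"
  then have "v \<in> HW (a + 2 * int 0)" using HW_closed(1) by auto
  then show "v \<in> V a" using V_gen[of v a 0] p_pos by simp
qed

lemma V_sum: "(\<And>i. i \<in> A \<Longrightarrow> f i \<in> V a) \<Longrightarrow> sum f A \<in> V a"
  using J_V J_0 by (induction A rule: infinite_finite_induct) (auto intro: V_add)

text \<open>If \<open>x u\<close> is generated by primitive vectors, then up to such vectors \<open>x u\<close> is the lowest vector
  \<open>y\<^sup>m w\<close> of a simple module of highest weight \<open>m \<equiv> - a - 2\<close>, and the relations rule that out.\<close>

lemma lowest_vector_in_J:
  assumes u: "u \<in> W a" and w: "w \<in> HW (a + 2 + 2 * int m)" and m: "m < p" "[int m = - a - 2] (mod int p)"
    and xu: "x * u \<approx> y ^ m * w"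
  shows "w \<in> J"
proof -
  have wm: "(a + 2 + 2 * int m) mod int p = int m"
  proof -
    have "[a + 2 + 2 * int m = a + 2 + ((- a - 2) + int m)] (mod int p)"
      using m(2) by (intro cong_add cong_refl) (metis cong_add_rcancel mult_2)
    then show ?thesis using m(1) by (simp add: cong_def)
  qed
  obtain c where c: "c \<noteq> 0" "x ^ m * (y ^ m * w) \<approx> sc c * w"
    using x_power_y_power_primitive[of w "a + 2 + 2 * int m" m] HW_y[OF w] wm by auto
  \<comment> \<open>\<open>x ^ m\<close> takes \<open>x * u\<close>, the bottom of the string of
    \<open>w\<close>, back to a nonzero multiple of \<open>w\<close>.\<close>
  have key: "w \<in> J" if "x ^ Suc m * u \<in> J"
  proof -
    have "sc c * w \<approx> x ^ m * (x * u)"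
      using eqJ_trans[OF eqJ_x_power[OF xu] c(2)] by (rule eqJ_sym)
    then have "sc c * w \<in> J" using that by (simp add: eqJ_J power_Suc2 mult.assoc del: power_Suc)
    then show ?thesis using c(1) by (rule J_sc_cancel)
  qed
  show ?thesis
  proof (cases "Suc m = p")
    case True
    then show ?thesis using key x_power_p[OF u] by simp
  next
    case False
    then have mp: "Suc m < p" using m by simp
    define l where "l = p - 2 - m"
    have l: "a mod int p = int l"
    proof -
      obtain k where "int m - (- a - 2) = int p * k" using m(2) by (auto simp: cong_iff_dvd_diff)
      then show ?thesis using mp by (intro int_mod_pos_eq[of _ _ "k - 1"]) (auto simp: l_def algebra_simps of_nat_diff)
    qed
    \<comment> \<open>One step below the bottom of the string of \<open>w\<close> lies in
      \<open>J\<close>, so the string below \<open>u\<close> can be climbed as if \<open>u\<close>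
      were primitive.\<close>
    have "y * (x * u) \<approx> y ^ Suc m * w"
      using eqJ_y[OF xu] by (simp add: mult.assoc)
    moreover have "y ^ Suc m * w \<in> J"
      using mp wm by (intro y_power_HW[OF w]) auto
    ultimately have yx: "y * (x * u) \<in> J" by (rule eqJ_J)
    \<comment> \<open>The first bound brings \<open>x ^ (p - \<nu>) * (y ^ j * u)\<close> to a
      weight \<open>l - 2 * j + p - 2 * \<nu>\<close> in the range of \<open>x_relation\<close>. The
      second ensures that the resulting power \<open>x ^ (p - \<nu> - j)\<close> of \<open>x\<close>
      on \<open>u\<close> does not exceed \<open>x ^ Suc m\<close>.\<close>
    define j where "j = max ((l + 1) div 2) (l + 1 - \<nu>)"
    have j: "j \<le> l" "j \<le> p - \<nu>" "p - \<nu> - j \<le> Suc m" "l \<le> 2 * j" "2 * j + 2 * \<nu> \<le> l + p"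
      using nu mp unfolding j_def l_def by (auto simp: max_def)
    obtain d where d: "d \<noteq> 0" "x ^ j * (y ^ j * u) \<approx> sc d * u"
      using x_power_y_power_primitive[OF u yx, of j] j(1) l by auto
    have "(a - 2 * int j + 2 * (int p - int \<nu>)) mod int p = int l - 2 * int j + int p - 2 * int \<nu>"
      proof -
      have "a - 2 * int j + 2 * (int p - int \<nu>) = a + (- 2 * int j + 2 * (int p - int \<nu>))" by simp
      also have "\<dots> mod int p = int l - 2 * int j + int p - 2 * int \<nu>"
        using j nu by (intro mod_eq_shift[OF l, of _ _ "- 1"]) auto
      finally show ?thesis .
    qed
    then have "x ^ (p - \<nu>) * (y ^ j * u) \<in> J"
      using j by (intro x_relation[OF W_y_power[OF u]]) auto
    moreover have "x ^ (p - \<nu>) * (y ^ j * u) = x ^ (p - \<nu> - j) * (x ^ j * (y ^ j * u))"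
      using j(2) by (simp only: mult.assoc[symmetric] power_add[symmetric] le_add_diff_inverse2)
    moreover have "sc d * (x ^ (p - \<nu> - j) * u) \<approx> x ^ (p - \<nu> - j) * (x ^ j * (y ^ j * u))"
      using eqJ_sym[OF eqJ_x_power[OF d(2)]] by (simp add: x_power_sc)
    ultimately have "x ^ (p - \<nu> - j) * u \<in> J"
      using eqJ_J J_sc_cancel[OF _ d(1)] by metis
    then have "x ^ (Suc m - (p - \<nu> - j)) * (x ^ (p - \<nu> - j) * u) \<in> J" by (rule J_x_power)
    then have "x ^ Suc m * u \<in> J"
      using j(3) by (simp only: mult.assoc[symmetric] power_add[symmetric] le_add_diff_inverse2)
    then show ?thesis by (rule key)
  qed
qed

text \<open>Subtract from \<open>u\<close> a vector \<open>z\<close> that accounts for as much of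
  \<open>x * u\<close> as possible: a vector \<open>y ^ j * w j\<close> strictly above the bottom of
  its string is \<open>x\<close> applied to a multiple of \<open>y ^ Suc j * w j\<close>. Past the
  bottom it lies in \<open>J\<close>, and at the bottom only one index is possible, where
  \<open>lowest_vector_in_J\<close> shows that \<open>w j\<close> lies in \<open>J\<close>. Then
  \<open>u - z\<close> is a highest weight vector.\<close>

lemma V_step:
  assumes u: "u \<in> W a" and xu: "x * u \<in> V (a + 2)"
  shows "u \<in> V a"
proof -
  obtain w where w: "\<And>j. j < p \<Longrightarrow> w j \<in> HW (a + 2 + 2 * int j)" "x * u \<approx> (\<Sum>j<p. y ^ j * w j)"
    using xu unfolding V_def by blast
  define c :: "nat \<Rightarrow> 'k" where "c j = of_int ((int j + 1) * (a + 2 + 2 * int j - int j))" for j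
  define A where "A = {j. j < p \<and> int j < (a + 2 + 2 * int j) mod int p}"
  define z where "z = (\<Sum>j\<in>A. sc (1 / c j) * (y ^ Suc j * w j))"
  \<comment> \<open>The solution \<open>j\<close> of a + 2 + 2j \<equiv> j, the only index at which
    \<open>y ^ j * w j\<close> is the bottom of its string.\<close>
  define m where "m = nat ((- a - 2) mod int p)"
  have m: "m < p" "int m = (- a - 2) mod int p" using p_pos by (auto simp: m_def nat_less_iff)
  have "A \<subseteq> {..<p}" by (auto simp: A_def)
  have cA: "c j \<noteq> 0" "Suc j < p" if "j \<in> A" for j
  proof -
    show "c j \<noteq> 0" unfolding c_def using that by (intro weight_coeff_nonzero) (simp add: A_def)
    have "(a + 2 + 2 * int j) mod int p < int p" using p_pos by simp
    then show "Suc j < p" using that unfolding A_def mem_Collect_eq by linarith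
  qed
  have zV: "z \<in> V a" unfolding z_def
  proof (rule V_sum)
    fix j assume j: "j \<in> A"
    then have "sc (1 / c j) * w j \<in> HW (a + 2 * int (Suc j))"
      using w(1)[of j] HW_closed(3) by (auto simp: A_def algebra_simps)
    then show "sc (1 / c j) * (y ^ Suc j * w j) \<in> V a"
      using V_gen[of "sc (1 / c j) * w j" a "Suc j"] cA(2)[OF j] by (simp only: y_power_sc)
  qed
  have xz: "x * z \<approx> (\<Sum>j\<in>A. y ^ j * w j)"
    unfolding z_def sum_distrib_left
  proof (rule eqJ_sum)
    fix j assume j: "j \<in> A"
    have "x * (y ^ Suc j * w j) \<approx> sc (c j) * (y ^ j * w j)"
      unfolding c_def using j w(1)[of j] HW_y by (intro x_y_power_primitive) (auto simp: A_def)
    then have "sc (1 / c j) * (x * (y ^ Suc j * w j)) \<approx> sc (1 / c j) * (sc (c j) * (y ^ j * w j))"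
      by (rule eqJ_sc)
    then show "x * (sc (1 / c j) * (y ^ Suc j * w j)) \<approx> y ^ j * w j"
      by (simp only: x_sc sc_inverse[OF cA(1)[OF j]])
  qed
  have rest: "(\<Sum>j\<in>{..<p} - A. y ^ j * w j) \<approx> (\<Sum>j\<in>{..<p} - A. if j = m then y ^ m * w m else 0)"
  proof (rule eqJ_sum)
    fix j assume j: "j \<in> {..<p} - A"
    show "y ^ j * w j \<approx> (if j = m then y ^ m * w m else 0)"
    proof (cases "j = m")
      case True then show ?thesis by (simp add: eqJ_refl)
    next
      case False
      have "(a + 2 + 2 * int j) mod int p \<noteq> int j"
      proof
        assume "(a + 2 + 2 * int j) mod int p = int j"
        then have "[a + 2 + 2 * int j = int j] (mod int p)" using j by (simp add: cong_def)
        then have "[a + 2 + 2 * int j - (a + 2 + int j) = int j - (a + 2 + int j)] (mod int p)"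
          by (intro cong_diff cong_refl)
        then have "int j mod int p = (- a - 2) mod int p" by (simp add: cong_def algebra_simps)
        then show False using j m False by simp
      qed
      then have "(a + 2 + 2 * int j) mod int p < int j" using j by (auto simp: A_def)
      then have "y ^ j * w j \<in> J" using j w(1) by (intro y_power_HW) auto
      then show ?thesis using False by (simp add: eqJ_0)
    qed
  qed
  have mA: "m \<notin> A"
  proof
    assume "m \<in> A"
    moreover have "(a + 2 + 2 * int m) mod int p = int m"
    proof -
      have "[int m = - a - 2] (mod int p)" using m by (simp add: cong_def)
      from cong_add[OF this cong_refl[of "a + 2 + int m"]]
      have "[a + 2 + 2 * int m = int m] (mod int p)" by (simp add: algebra_simps)
      then show ?thesis using m(1) by (simp add: cong_def)
    qed
    ultimately show False by (simp add: A_def)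
  qed
  have "x * (u - z) = x * u - x * z" by (simp add: algebra_simps)
  also have "\<dots> \<approx> (\<Sum>j<p. y ^ j * w j) - (\<Sum>j\<in>A. y ^ j * w j)"
    by (intro eqJ_diff w xz)
  also have "\<dots> = (\<Sum>j\<in>{..<p} - A. y ^ j * w j)"
    using \<open>A \<subseteq> {..<p}\<close> by (simp add: sum_diff)
  also have "\<dots> \<approx> (\<Sum>j\<in>{..<p} - A. if j = m then y ^ m * w m else 0)" by (rule rest)
  also have "\<dots> = y ^ m * w m" using m(1) mA by (simp add: sum.delta)
  finally have xuz: "x * (u - z) \<approx> y ^ m * w m" .
  have uz: "u - z \<in> W a" using u zV by (intro W_diff) (auto simp: V_def)
  have "w m \<in> J"
  proof (rule lowest_vector_in_J[OF uz w(1)[OF m(1)] m(1) _ xuz])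
    show "[int m = - a - 2] (mod int p)" using m(2) by (simp add: cong_def)
  qed
  then have "x * (u - z) \<in> J" using xuz J_y_power eqJ_J by blast
  then have "u - z \<in> HW (a + 2 * int 0)" using uz by (simp add: HW_def)
  then have "u - z \<in> V a" using V_gen[of "u - z" a 0] p_pos by simp
  then show ?thesis using V_add[OF _ zV, of "u - z"] by simp
qed

text \<open>\<open>x ^ p * u\<close> lies in \<open>J\<close>, and \<open>V_step\<close> descends
  from there through the powers of \<open>x\<close>.\<close>

lemma generated_by_primitive:
  assumes u: "u \<in> W a"
  shows "\<exists>w. (\<forall>j<p. w j \<in> HW (a + 2 * int j)) \<and> u \<approx> (\<Sum>j<p. y ^ j * w j)"
proof -
  have "x ^ n * u \<in> V (a + 2 * int n)" if "n \<le> p" for n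
    using that
  proof (induction rule: inc_induct)
    case base
    show ?case using x_power_p[OF u] J_V by blast
  next
    case (step n)
    then show ?case
      by (intro V_step[OF W_x_power[OF u]]) (simp add: algebra_simps)
  qed
  from this[of 0] show ?thesis by (simp add: V_def)
qed

end

section \<open>Induction over the layers\<close>

context divided_sl2
begin

section \<open>Splitting exponents into digits\<close>

lemma choose_lucas_k:
  assumes "i < p ^ s" "i' < p ^ s"
  shows "(of_nat ((i + p ^ s * j) choose (i' + p ^ s * j')) :: 'k) = of_nat (i choose i') * of_nat (j choose j')"
proof -
  have q: "p ^ s > 0" using p_pos by simp
  have d: "int (i + p ^ s * j) div int (p ^ s) = int j" "int (i + p ^ s * j) mod int (p ^ s) = int i"
    using assms q by (simp_all add: zdiv_int[symmetric] zmod_int[symmetric] del: of_nat_add of_nat_mult of_nat_power)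
  have "[ibinom (int (i + p ^ s * j)) (i' + p ^ s * j') = ibinom (int j) j' * ibinom (int i) i'] (mod int p)"
    using ibinom_lucas[OF prime_p refl, of "int (i + p ^ s * j)" "i' + p ^ s * j'" s] assms q
    by (simp only: d) simp
  from of_int_k_cong[OF this] show ?thesis by (simp add: mult.commute del: of_nat_add of_nat_mult of_nat_power)
qed

lemma choose_p_power_k: "(of_nat ((p ^ s + p ^ s * j) choose (p ^ s)) :: 'k) = of_nat (Suc j)"
  using choose_lucas_k[of 0 s 0 "Suc j" 1] p_pos by simp

text \<open>For \<open>j < p\<close> the factorial is invertible, so powers of
  \<open>X (p ^ s)\<close> and the divided powers \<open>X (p ^ s * j)\<close> determine each other;
  for \<open>j = p\<close> it vanishes, which gives the restricted relation.\<close>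

lemma X_power: "X (p ^ s) ^ j = sc (of_nat (fact j)) * X (p ^ s * j)"
proof (induction j)
  case (Suc j)
  have "X (p ^ s) ^ Suc j = sc (of_nat (fact j) * of_nat (Suc j)) * X (p ^ s + p ^ s * j)"
    by (simp only: power_Suc Suc sc_left_X X_mult sc_left_sc choose_p_power_k)
  then show ?case by (simp add: algebra_simps)
qed simp

lemma Y_power: "Y (p ^ s) ^ j = sc (of_nat (fact j)) * Y (p ^ s * j)"
proof (induction j)
  case (Suc j)
  have "Y (p ^ s) ^ Suc j = sc (of_nat (fact j) * of_nat (Suc j)) * Y (p ^ s + p ^ s * j)"
    by (simp only: power_Suc Suc sc_left_Y Y_mult sc_left_sc choose_p_power_k)
  then show ?case by (simp add: algebra_simps)
qed simp

lemma fact_k_nonzero: "j < p \<Longrightarrow> (of_nat (fact j) :: 'k) \<noteq> 0"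
  using prime_p by (simp only: of_nat_k_eq_0_iff) (simp add: prime_dvd_fact_iff)

lemma X_split: "i < p ^ s \<Longrightarrow> X (i + p ^ s * j) = X i * X (p ^ s * j)"
  using choose_lucas_k[of i s i j 0] by (simp add: X_mult)

lemma Y_split: "i < p ^ s \<Longrightarrow> Y (i + p ^ s * j) = Y i * Y (p ^ s * j)"
  using choose_lucas_k[of i s i j 0] by (simp add: Y_mult)

lemma X_commute: "X m * X n = X n * X m"
  by (simp only: X_mult add.commute[of n]) (metis binomial_symmetric le_add1 add_diff_cancel_left')

lemma Y_commute: "Y m * Y n = Y n * Y m"
  by (simp only: Y_mult add.commute[of n]) (metis binomial_symmetric le_add1 add_diff_cancel_left')

end

locale divided_sl2_ideal = divided_sl2 sc X Y B p
  for sc :: "'k::field \<Rightarrow> 'a::{ring, monoid_mult}" and X Y :: "nat \<Rightarrow> 'a"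
    and B :: "int \<Rightarrow> nat \<Rightarrow> 'a" and p :: nat +
  fixes r :: nat and J :: "'a set"
  assumes ideal: "two_sided_ideal (U r) J"
begin

section \<open>Primitive vectors and weights modulo J\<close>

lemma J_0: "0 \<in> J" and J_diff: "u \<in> J \<Longrightarrow> v \<in> J \<Longrightarrow> u - v \<in> J"
  and J_left: "u \<in> U r \<Longrightarrow> v \<in> J \<Longrightarrow> u * v \<in> J" and J_right: "u \<in> U r \<Longrightarrow> v \<in> J \<Longrightarrow> v * u \<in> J"
  and J_U: "v \<in> J \<Longrightarrow> v \<in> U r"
  using ideal unfolding two_sided_ideal_def by blast+

lemma J_uminus: "v \<in> J \<Longrightarrow> - v \<in> J" using J_diff[OF J_0] by simp

lemma J_add: "u \<in> J \<Longrightarrow> v \<in> J \<Longrightarrow> u + v \<in> J" using J_diff[OF _ J_uminus, of u v] by simp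

lemma J_sum: "(\<And>i. i \<in> A \<Longrightarrow> f i \<in> J) \<Longrightarrow> sum f A \<in> J"
  by (induction A rule: infinite_finite_induct) (auto intro: J_0 J_add)

lemma J_diff_iff: "u - v \<in> J \<Longrightarrow> u \<in> J \<longleftrightarrow> v \<in> J"
  using J_add[of "u - v" v] J_diff[of u "u - v"] by auto

lemma J_diff_trans: "u - v \<in> J \<Longrightarrow> v - w \<in> J \<Longrightarrow> u - w \<in> J"
  using J_add[of "u - v" "v - w"] by simp

lemma J_diff_left: "z \<in> U r \<Longrightarrow> u - v \<in> J \<Longrightarrow> z * u - z * v \<in> J"
  using J_left[of z "u - v"] by (simp add: right_diff_distrib)

lemma J_sc_cancel: "sc c * v \<in> J \<Longrightarrow> c \<noteq> 0 \<Longrightarrow> v \<in> J"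
  using J_left[OF sc_U, of "sc c * v" "1 / c"] by (simp add: sc_inverse)

definition T :: "nat \<Rightarrow> 'a set" where
  "T s = {v \<in> U r. \<forall>n. 0 < n \<and> n < p ^ s \<longrightarrow> X n * v \<in> J}"

definition wt :: "nat \<Rightarrow> int \<Rightarrow> 'a \<Rightarrow> bool" where "wt s a v \<longleftrightarrow> e s a * v - v \<in> J"

lemma p_power_le: "s \<le> r \<Longrightarrow> n < p ^ s \<Longrightarrow> n < p ^ r"
  using power_increasing[of s r p] p_pos by simp

lemma T_U: "v \<in> T s \<Longrightarrow> v \<in> U r" by (simp add: T_def)

lemma T_X: "v \<in> T s \<Longrightarrow> 0 < n \<Longrightarrow> n < p ^ s \<Longrightarrow> X n * v \<in> J" by (simp add: T_def)

lemma T_diff: "u \<in> T s \<Longrightarrow> v \<in> T s \<Longrightarrow> u - v \<in> T s"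
  by (auto simp: T_def right_diff_distrib intro: U_closed J_diff)

lemma J_T: "s \<le> r \<Longrightarrow> J \<subseteq> T s"
  by (auto simp: T_def intro: J_U J_left X_U p_power_le)

lemma T_sc: "v \<in> T s \<Longrightarrow> sc c * v \<in> T s"
  by (auto simp: T_def sc_left_X intro: U_closed sc_U J_left)

lemma T_e: "s \<le> r \<Longrightarrow> s' \<le> r \<Longrightarrow> v \<in> T s \<Longrightarrow> e s' a * v \<in> T s"
  unfolding T_def
proof (intro CollectI conjI allI impI)
  fix n assume "s \<le> r" "s' \<le> r" and v: "v \<in> {v \<in> U r. \<forall>n. 0 < n \<and> n < p ^ s \<longrightarrow> X n * v \<in> J}"
    and n: "0 < n \<and> n < p ^ s"
  then show "X n * (e s' a * v) \<in> J"
    by (simp only: mult.assoc[symmetric] X_e) (auto simp: mult.assoc intro: J_left e_U)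
qed (auto intro: U_closed e_U)

lemma T_mono: "s' \<le> s \<Longrightarrow> v \<in> T s \<Longrightarrow> v \<in> T s'"
  using power_increasing[of s' s p] p_pos by (auto simp: T_def)

lemma wt_diff: "wt s a u \<Longrightarrow> wt s a v \<Longrightarrow> wt s a (u - v)"
  unfolding wt_def using J_diff[of "e s a * u - u" "e s a * v - v"] by (simp add: algebra_simps)

lemma wt_J: "s \<le> r \<Longrightarrow> v \<in> J \<Longrightarrow> wt s a v"
  unfolding wt_def by (intro J_diff J_left e_U)

lemma wt_sc: "wt s a v \<Longrightarrow> wt s a (sc c * v)"
  unfolding wt_def using J_left[OF sc_U, of "e s a * v - v" c]
  by (simp only: right_diff_distrib mult.assoc[symmetric] sc_e)

lemma wt_X: "wt s a v \<Longrightarrow> n < p ^ r \<Longrightarrow> wt s (a + 2 * int n) (X n * v)"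
  unfolding wt_def using J_left[OF X_U, of n "e s a * v - v"]
  by (simp only: right_diff_distrib mult.assoc[symmetric] X_e)

lemma wt_Y: "wt s a v \<Longrightarrow> n < p ^ r \<Longrightarrow> wt s (a - 2 * int n) (Y n * v)"
  unfolding wt_def using J_left[OF Y_U, of n "e s a * v - v"]
  by (simp only: right_diff_distrib mult.assoc[symmetric] Y_e)

lemma wt_cong: "[a = b] (mod int (p ^ s)) \<Longrightarrow> wt s a v \<longleftrightarrow> wt s b v"
  unfolding wt_def using e_cong by metis

lemma wt_eigen:
  assumes f: "f \<in> U r" "f * e s a = sc c * e s a" and s: "s \<le> r" and v: "wt s a v"
  shows "f * v - sc c * v \<in> J"
proof -
  have 1: "f * (e s a * v) - f * v \<in> J" "sc c * (e s a * v) - sc c * v \<in> J"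
    using v unfolding wt_def by (auto intro: J_diff_left f sc_U)
  have "f * (e s a * v) = sc c * (e s a * v)" by (simp only: mult.assoc[symmetric] f(2))
  then show ?thesis using J_diff[OF 1(2,1)] by simp
qed

lemma wt_B:
  assumes "t < p ^ s" "s \<le> r" "wt s a v"
  shows "B b t * v - sc (of_int (ibinom (a + b) t)) * v \<in> J"
  using assms by (intro wt_eigen[OF B_U B_e]) (auto intro: p_power_le)

lemma wt_le:
  assumes s: "s' \<le> s" "s \<le> r" and v: "wt s a v"
  shows "wt s' a v"
proof -
  have "e s' a * e s a = sc 1 * e s a" using s by (simp add: e_e_le)
  from wt_eigen[OF e_U this s(2) v] s show ?thesis by (simp add: wt_def)
qed

lemma wt_e: "wt s a (e s a * v)"
proof -
  have "e s a * e s a = e s a" by (simp add: e_e_le)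
  then show ?thesis unfolding wt_def by (simp add: mult.assoc[symmetric] J_0)
qed

lemma sum_e_mult: "(\<Sum>a<p ^ s. e s (int a) * v) = v"
  by (simp add: sum_distrib_right[symmetric] sum_e)

text \<open>The summands of \<open>X_Y\<close> with \<open>t < n\<close> contain
  \<open>X (n - t)\<close>, which sends a vector of \<open>T s\<close> into
  \<open>J\<close>.\<close>

lemma X_Y_T:
  assumes v: "v \<in> T s" and s: "s \<le> r" and n: "n < p ^ s" and m: "m < p ^ r"
  shows "X n * (Y m * v) - (if n \<le> m then Y (m - n) * (B (int n - int m) n * v) else 0) \<in> J"
proof -
  define h where "h t = Y (m - t) * (B (2 * int t - int m - int n) t * (X (n - t) * v))" for t
  have XY: "X n * (Y m * v) = (\<Sum>t\<le>min m n. h t)"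
    unfolding h_def mult.assoc[symmetric] X_Y by (simp add: sum_distrib_right)
  have h: "h t \<in> J" if "t < n" "t \<le> m" for t
    unfolding h_def using that n m s
    by (intro J_left Y_U B_U T_X[OF v]) (auto intro: p_power_le)
  show ?thesis
  proof (cases "n \<le> m")
    case True
    then have "(\<Sum>t\<le>min m n. h t) = (\<Sum>t<n. h t) + h n"
      by (simp add: lessThan_Suc_atMost[symmetric] min_absorb2)
    moreover have "h n = Y (m - n) * (B (int n - int m) n * v)" by (simp add: h_def)
    moreover have "(\<Sum>t<n. h t) \<in> J" using h True by (intro J_sum) auto
    ultimately show ?thesis using True XY by simp
  next
    case False
    then have "(\<Sum>t\<le>min m n. h t) \<in> J" using h by (intro J_sum) auto
    then show ?thesis using False XY by simp
  qed
qed

lemma X_Y_T_wt: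
  assumes v: "v \<in> T s" and s: "s \<le> r" and n: "n < p ^ s" and m: "m < p ^ r" and wt: "wt s a v"
  shows "X n * (Y m * v) - (if n \<le> m then sc (of_int (ibinom (a - int m + int n) n)) * (Y (m - n) * v) else 0) \<in> J"
proof (cases "n \<le> m")
  case True
  have "Y (m - n) * (B (int n - int m) n * v) - Y (m - n) * (sc (of_int (ibinom (a + (int n - int m)) n)) * v) \<in> J"
    using m by (intro J_diff_left Y_U wt_B[OF n s wt]) auto
  from J_diff_trans[OF _ this] X_Y_T[OF v s n m] True show ?thesis
    by (simp add: sc_left_Y algebra_simps)
next
  case False
  then show ?thesis using X_Y_T[OF v s n m] by simp
qed

text \<open>This is how the highest weight vector of a simple module of level \<open>s\<close>
  behaves: there \<open>Y m\<close> kills it exactly if \<open>p\<close> divides the binomial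
  coefficient.\<close>

definition strong_primitive :: "nat \<Rightarrow> bool" where
  "strong_primitive s \<longleftrightarrow> (\<forall>v\<in>T s. \<forall>a m. wt s a v \<and> 0 \<le> a \<and> a < int (p ^ s) \<and> m < p ^ s \<and>
      int p dvd ibinom a m \<longrightarrow> Y m * v \<in> J)"

text \<open>Modulo \<open>J\<close>, \<open>X n * (Y (p ^ s) * v)\<close> is a multiple of
  \<open>Y (p ^ s - n) * v\<close>. If \<open>a < p ^ s - n\<close>, the latter lies in
  \<open>J\<close> by \<open>strong_primitive\<close>; otherwise the upper entry of the binomial
  coefficient lies in 0, ..., n - 1 and the coefficient is zero.\<close>

lemma Y_T:
  assumes s: "s < r" and L: "strong_primitive s" and v: "v \<in> T s" and a: "wt s a v" "0 \<le> a" "a < int (p ^ s)"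
  shows "Y (p ^ s) * v \<in> T s"
  unfolding T_def
proof (intro CollectI conjI allI impI)
  have q: "p ^ s < p ^ r" using s p_gt_1 by simp
  then show "Y (p ^ s) * v \<in> U r" using v by (intro U_closed Y_U T_U)
  fix n assume n: "0 < n \<and> n < p ^ s"
  have "X n * (Y (p ^ s) * v) - sc (of_int (ibinom (a - int (p ^ s) + int n) n)) * (Y (p ^ s - n) * v) \<in> J"
    using X_Y_T_wt[OF v _ _ q a(1), of n] n s by simp
  moreover have "sc (of_int (ibinom (a - int (p ^ s) + int n) n)) * (Y (p ^ s - n) * v) \<in> J"
  proof (cases "a < int (p ^ s - n)")
    case True
    then have "ibinom a (p ^ s - n) = 0" using a by (intro ibinom_eq_0)
    then have "Y (p ^ s - n) * v \<in> J"
      using L[unfolded strong_primitive_def, rule_format, OF v, of a "p ^ s - n"] a n by auto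
    then show ?thesis by (rule J_left[OF sc_U])
  next
    case False
    then have "ibinom (a - int (p ^ s) + int n) n = 0"
      using a n by (intro ibinom_eq_0) (auto simp: of_nat_diff simp del: of_nat_power)
    then show ?thesis by (simp add: J_0)
  qed
  ultimately show "X n * (Y (p ^ s) * v) \<in> J" using J_diff_iff by blast
qed

lemma X_T:
  assumes s: "s < r" and v: "v \<in> T s"
  shows "X (p ^ s) * v \<in> T s"
  unfolding T_def
proof (intro CollectI conjI allI impI)
  have q: "p ^ s < p ^ r" using s p_gt_1 by simp
  then show "X (p ^ s) * v \<in> U r" using v by (intro U_closed X_U T_U)
  fix n assume n: "0 < n \<and> n < p ^ s"
  have "X n * (X (p ^ s) * v) = X (p ^ s) * (X n * v)"
    by (simp only: mult.assoc[symmetric] X_commute)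
  then show "X n * (X (p ^ s) * v) \<in> J" using n q v by (auto intro: J_left X_U T_X)
qed

definition W :: "nat \<Rightarrow> int \<Rightarrow> int \<Rightarrow> 'a set" where
  "W s l a = {v \<in> T s. wt (Suc s) (l + int (p ^ s) * a) v}"

lemma W_wt: "s < r \<Longrightarrow> v \<in> W s l a \<Longrightarrow> wt s l v"
  using wt_le[of s "Suc s" "l + int (p ^ s) * a" v] wt_cong[of "l + int (p ^ s) * a" l s v]
  by (auto simp: W_def cong_def)

lemma W_X:
  assumes s: "s < r" and v: "v \<in> W s l a"
  shows "X (p ^ s) * v \<in> W s l (a + 2)"
proof -
  have q: "p ^ s < p ^ r" using s p_gt_1 by simp
  show ?thesis
    using v wt_X[OF _ q, of "Suc s" "l + int (p ^ s) * a" v] X_T[OF s]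
    by (simp add: W_def algebra_simps)
qed

lemma W_Y:
  assumes s: "s < r" and L: "strong_primitive s" and l: "0 \<le> l" "l < int (p ^ s)" and v: "v \<in> W s l a"
  shows "Y (p ^ s) * v \<in> W s l (a - 2)"
proof -
  have q: "p ^ s < p ^ r" using s p_gt_1 by simp
  have "Y (p ^ s) * v \<in> T s" using v l W_wt[OF s v] by (intro Y_T[OF s L]) (auto simp: W_def)
  then show ?thesis using v wt_Y[OF _ q, of "Suc s" "l + int (p ^ s) * a" v]
    by (simp add: W_def algebra_simps)
qed

lemma W_X_power:
  assumes "s < r" "v \<in> W s l a"
  shows "X (p ^ s) ^ k * v \<in> W s l (a + 2 * int k)"
proof (induction k)
  case (Suc k)
  have "a + 2 * int (Suc k) = a + 2 * int k + 2" by simp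
  then show ?case using W_X[OF assms(1) Suc] by (simp only: power_Suc mult.assoc)
qed (simp add: assms)

lemma W_Y_power:
  assumes "s < r" "strong_primitive s" "0 \<le> l" "l < int (p ^ s)" "v \<in> W s l a"
  shows "Y (p ^ s) ^ k * v \<in> W s l (a - 2 * int k)"
proof (induction k)
  case (Suc k)
  have "a - 2 * int (Suc k) = a - 2 * int k - 2" by simp
  then show ?case using W_Y[OF assms(1-4) Suc] by (simp only: power_Suc mult.assoc)
qed (simp add: assms)

inductive_set G :: "nat \<Rightarrow> 'a set" for s where
  G_J: "v \<in> J \<Longrightarrow> v \<in> G s"
| G_step: "u \<in> G s \<Longrightarrow> m < p ^ s \<Longrightarrow> w \<in> T s \<Longrightarrow> u + Y m * w \<in> G s"

lemma G_add: "v \<in> G s \<Longrightarrow> u \<in> G s \<Longrightarrow> u + v \<in> G s"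
proof (induction rule: G.induct)
  case (G_J v)
  from G_J(2,1) show ?case
  proof (induction rule: G.induct)
    case (G_J u) then show ?case by (intro G.G_J J_add)
  next
    case (G_step u m w)
    then show ?case using G.G_step[of "u + v" s m w] by (simp add: algebra_simps)
  qed
qed (auto simp: add.assoc[symmetric] intro: G.G_step)

lemma G_gen: "m < p ^ s \<Longrightarrow> w \<in> T s \<Longrightarrow> Y m * w \<in> G s"
  using G_step[OF G_J[OF J_0]] by fastforce

lemma G_sum: "(\<And>i. i \<in> A \<Longrightarrow> f i \<in> G s) \<Longrightarrow> sum f A \<in> G s"
  by (induction A rule: infinite_finite_induct) (auto intro: G_J J_0 G_add)

end

text \<open>What the generators have to provide at each level; the induction is thereby shared by
  odd \<open>p\<close> and \<open>p = 2\<close>. \<open>layer_y\<close> may assume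
  \<open>strong_primitive\<close> because the proof that \<open>Y (p ^ s)\<close> preserves
  \<open>T s\<close> relies on it.\<close>

locale layered_ideal = divided_sl2_ideal sc X Y B p r J
  for sc :: "'k::field \<Rightarrow> 'a::{ring, monoid_mult}" and X Y :: "nat \<Rightarrow> 'a"
    and B :: "int \<Rightarrow> nat \<Rightarrow> 'a" and p r :: nat and J :: "'a set" +
  fixes \<nu> :: "nat \<Rightarrow> nat"
  assumes nu: "s < r \<Longrightarrow> 1 \<le> \<nu> s" "s < r \<Longrightarrow> 2 * \<nu> s < p \<or> p = 2 \<and> \<nu> s = 1"
    and layer_x: "s < r \<Longrightarrow> 0 \<le> l \<Longrightarrow> l < int (p ^ s) \<Longrightarrow> v \<in> W s l a \<Longrightarrow>
      (a + 2 * (int p - int (\<nu> s))) mod int p \<le> int p - 2 * int (\<nu> s) \<Longrightarrow> X (p ^ s) ^ (p - \<nu> s) * v \<in> J"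
    and layer_y: "s < r \<Longrightarrow> 0 \<le> l \<Longrightarrow> l < int (p ^ s) \<Longrightarrow> v \<in> W s l a \<Longrightarrow> strong_primitive s \<Longrightarrow>
      a mod int p \<le> int p - 2 * int (\<nu> s) \<Longrightarrow> Y (p ^ s) ^ (p - \<nu> s) * v \<in> J"
begin

text \<open>Of the summands of \<open>X (p ^ s) * Y (p ^ s)\<close> those with 0 < t < p^s die on
  \<open>T s\<close>. What remains besides \<open>Y (p ^ s) * X (p ^ s)\<close> is the binomial of
  \<open>H\<close> over \<open>p ^ s\<close>, which by Lucas reads off the digit \<open>a\<close> of
  the weight.\<close>

lemma layer:
  assumes s: "s < r" and l: "0 \<le> l" "l < int (p ^ s)" and L: "strong_primitive s"
  shows "sl2_layer sc X Y B p J (W s l) (X (p ^ s)) (Y (p ^ s)) (\<nu> s)"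
proof
  have q: "p ^ s < p ^ r" using s p_gt_1 by simp
  have q0: "p ^ s > 0" using p_pos by simp
  show "sc c * v \<in> J" if "v \<in> J" for c v using that by (intro J_left sc_U)
  show "X (p ^ s) * v \<in> J" "Y (p ^ s) * v \<in> J" if "v \<in> J" for v using that q by (auto intro: J_left X_U Y_U)
  show "u - v \<in> W s l a" if "u \<in> W s l a" "v \<in> W s l a" for u v a
    using that by (auto simp: W_def intro: T_diff wt_diff)
  show "J \<subseteq> W s l a" for a using s J_T[of s] by (auto simp: W_def intro: wt_J)
  show "sc c * v \<in> W s l a" if "v \<in> W s l a" for c v a
    using that by (auto simp: W_def intro: T_sc wt_sc)
  show "X (p ^ s) * v \<in> W s l (a + 2)" if "v \<in> W s l a" for v a using that by (rule W_X[OF s])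
  show "Y (p ^ s) * v \<in> W s l (a - 2)" if "v \<in> W s l a" for v a using that by (rule W_Y[OF s L l])
  show "W s l a = W s l b" if "[a = b] (mod int p)" for a b
  proof -
    have "[l + int (p ^ s) * a = l + int (p ^ s) * b] (mod int (p ^ Suc s))"
      using that by (simp add: cong_iff_dvd_diff right_diff_distrib[symmetric] mult.commute[of "int p"] mult_dvd_mono)
    then show ?thesis unfolding W_def using wt_cong by blast
  qed
  show "X (p ^ s) * (sc c * v) = sc c * (X (p ^ s) * v)" for c v by (rule sc_left_X)
  show "Y (p ^ s) * (sc c * v) = sc c * (Y (p ^ s) * v)" for c v by (rule sc_left_Y)
  show "X (p ^ s) * (Y (p ^ s) * v) - (Y (p ^ s) * (X (p ^ s) * v) + sc (of_int a) * v) \<in> J"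
    if v: "v \<in> W s l a" for v a
  proof -
    define h where "h t = Y (p ^ s - t) * (B (2 * int t - int (p ^ s) - int (p ^ s)) t * (X (p ^ s - t) * v))" for t
    have "X (p ^ s) * (Y (p ^ s) * v) = (\<Sum>t\<le>p ^ s. h t)"
      unfolding h_def mult.assoc[symmetric] X_Y by (simp add: sum_distrib_right)
    also have "\<dots> = h 0 + h (p ^ s) + (\<Sum>t\<in>{0<..<p ^ s}. h t)"
    proof -
      have "{..p ^ s} = insert 0 (insert (p ^ s) {0<..<p ^ s})" using q0 by auto
      then show ?thesis using q0 by (simp add: add.assoc)
    qed
    finally have 1: "X (p ^ s) * (Y (p ^ s) * v) = h 0 + h (p ^ s) + (\<Sum>t\<in>{0<..<p ^ s}. h t)" .
    have 2: "(\<Sum>t\<in>{0<..<p ^ s}. h t) \<in> J"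
      unfolding h_def using v q by (intro J_sum J_left Y_U B_U T_X[of v s]) (auto simp: W_def)
    have h0: "h 0 = Y (p ^ s) * (X (p ^ s) * v)" by (simp add: h_def)
    have "h (p ^ s) - sc (of_int (ibinom (l + int (p ^ s) * a + 0) (p ^ s))) * v \<in> J"
      using wt_B[of "p ^ s" "Suc s" "l + int (p ^ s) * a" v 0] v s p_gt_1 by (simp add: h_def W_def)
    moreover have "(of_int (ibinom (l + int (p ^ s) * a + 0) (p ^ s)) :: 'k) = of_int a"
    proof (rule of_int_k_cong)
      have "(l + int (p ^ s) * a) div int (p ^ s) = a"
        by (rule int_div_pos_eq[OF _ l]) (rule add.commute)
      then show "[ibinom (l + int (p ^ s) * a + 0) (p ^ s) = a] (mod int p)"
        using ibinom_lucas[OF prime_p refl, of "l + int (p ^ s) * a" "p ^ s" s] q0 by simp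
    qed
    ultimately have "h (p ^ s) - sc (of_int a) * v \<in> J" by simp
    from J_add[OF this 2] show ?thesis unfolding 1 h0 by (simp add: algebra_simps)
  qed
  show "X (p ^ s) ^ p * v \<in> J" if "v \<in> W s l a" for v a
  proof -
    have "(of_nat (fact p) :: 'k) = 0"
      using p_pos by (simp only: of_nat_k_eq_0_iff) (rule dvd_fact, auto)
    then show ?thesis unfolding X_power by (simp add: J_0)
  qed
  show "1 \<le> \<nu> s" "2 * \<nu> s < p \<or> p = 2 \<and> \<nu> s = 1" using nu s by auto
qed (use s l L in \<open>auto intro: J_0 J_diff layer_x layer_y\<close>)

text \<open>Weight and exponent are split at the digit of p^s, and by Lucas \<open>p\<close> divides
  one of two factors. If it is the upper one, \<open>y_power_HW\<close> disposes of
  \<open>Y (q * j) * v\<close>; if it is the lower one, the hypothesis at level \<open>s\<close>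
  disposes of \<open>Y i * v\<close>, and the two factors of \<open>Y m\<close> commute.\<close>

lemma strong_primitive_Suc:
  assumes s: "s < r" and L: "strong_primitive s"
  shows "strong_primitive (Suc s)"
  unfolding strong_primitive_def
proof (intro ballI allI impI)
  fix v a' m
  assume v: "v \<in> T (Suc s)" and h: "wt (Suc s) a' v \<and> 0 \<le> a' \<and> a' < int (p ^ Suc s) \<and> m < p ^ Suc s \<and> int p dvd ibinom a' m"
  define q where "q = p ^ s"
  have q0: "q > 0" using p_pos by (simp add: q_def)
  have qr: "q < p ^ r" using s p_gt_1 by (simp add: q_def)
  define l a where "l = a' mod int q" and "a = a' div int q"
  define i j where "i = m mod q" and "j = m div q"
  have a': "a' = l + int q * a" and m: "m = i + q * j" by (simp_all add: l_def a_def i_def j_def)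
  have l: "0 \<le> l" "l < int q" and i: "i < q" using q0 by (simp_all add: l_def i_def)
  have a: "0 \<le> a" "a < int p"
  proof -
    show "0 \<le> a" using h q0 by (simp add: a_def pos_imp_zdiv_nonneg_iff)
    have "int q * a < int q * int p" using h a' l by (simp add: q_def mult.commute)
    then show "a < int p" using q0 by simp
  qed
  have j: "j < p" using h q0 by (simp add: j_def q_def less_mult_imp_div_less mult.commute)
  have vs: "v \<in> T s" using v T_mono[of s "Suc s"] by simp
  interpret sl2_layer sc X Y B p J "W s l" "X (p ^ s)" "Y (p ^ s)" "\<nu> s"
    using l by (intro layer s L) (simp_all add: q_def)
  have Ym: "Y m = Y i * Y (q * j)" using Y_split[of i s j] i by (simp add: m q_def)
  have qj: "q * j < p ^ r"
  proof -
    have "q * j \<le> m" by (simp add: m)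
    then show ?thesis using h s p_power_le[of "Suc s" m] by (auto intro: le_less_trans)
  qed
  have ir: "i < p ^ r" using i qr by simp
  have "[ibinom a' m = ibinom a j * ibinom l i] (mod int p)"
    using ibinom_lucas[OF prime_p q_def, of a' m] by (simp only: l_def a_def i_def j_def)
  then have "int p dvd ibinom a j * ibinom l i" using h cong_dvd_iff by blast
  then consider "int p dvd ibinom a j" | "int p dvd ibinom l i"
    using prime_dvd_mult_iff[OF prime_int_p] by blast
  then show "Y m * v \<in> J"
  proof cases
    case 1
    have "a < int j"
    proof (rule ccontr)
      assume "\<not> a < int j"
      moreover obtain k where k: "a = int k" using a nonneg_int_cases by blast
      ultimately have "j \<le> k" "k < p" "p dvd (k choose j)" using 1 a by auto
      then have "p dvd fact k" using binomial_fact_lemma[of j k] by (metis dvd_mult)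
      then show False using \<open>k < p\<close> prime_p by (simp add: prime_dvd_fact_iff)
    qed
    moreover have "v \<in> HW a"
      using h vs v s p_gt_1 unfolding HW_def W_def by (auto simp: a' q_def intro: T_X)
    ultimately have "Y (p ^ s) ^ j * v \<in> J" using a j by (intro y_power_HW) auto
    then have "sc (of_nat (fact j)) * (Y (q * j) * v) \<in> J" unfolding Y_power by (simp add: q_def mult.assoc)
    then have "Y (q * j) * v \<in> J" using fact_k_nonzero[OF j] by (rule J_sc_cancel)
    then show ?thesis unfolding Ym mult.assoc by (rule J_left[OF Y_U[OF ir]])
  next
    case 2
    have "wt s a' v" using h s wt_le[of s "Suc s"] by auto
    then have "wt s l v" using wt_cong[of a' l s v] by (simp add: cong_def l_def q_def)
    then have "Y i * v \<in> J" using L vs l i 2 unfolding strong_primitive_def q_def by blast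
    then have "Y (q * j) * (Y i * v) \<in> J" by (rule J_left[OF Y_U[OF qj]])
    then show ?thesis unfolding Ym by (simp only: mult.assoc[symmetric] Y_commute)
  qed
qed

text \<open>A vector of \<open>T s\<close> is cut into its weights modulo p^(s+1), and each piece is
  a sum of \<open>Y (p ^ s) ^ j * w' j\<close> with \<open>w' j\<close> killed by
  \<open>X (p ^ s)\<close> as well. Up to a factorial, \<open>Y m * Y (p ^ s) ^ j\<close> is
  \<open>Y (m + p ^ s * j)\<close>.\<close>

lemma G_Suc:
  assumes s: "s < r" and L: "strong_primitive s" and u: "u \<in> G s"
  shows "u \<in> G (Suc s)"
  using u
proof (induction rule: G.induct)
  case (G_J v) then show ?case by (rule G.G_J)
next
  case (G_step u m w)
  define q where "q = p ^ s"
  have q0: "q > 0" using p_pos by (simp add: q_def)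
  have qr: "q < p ^ r" using s p_gt_1 by (simp add: q_def)
  have mr: "m < p ^ r" using G_step qr by (simp add: q_def)
  have "Y m * (e (Suc s) b * w) \<in> G (Suc s)" for b
  proof -
    define l a where "l = b mod int q" and "a = b div int q"
    have l: "0 \<le> l" "l < int q" and b: "b = l + int q * a" using q0 by (simp_all add: l_def a_def)
    interpret sl2_layer sc X Y B p J "W s l" "X (p ^ s)" "Y (p ^ s)" "\<nu> s"
      using l by (intro layer s L) (simp_all add: q_def)
    have bq: "l + int (p ^ s) * a = b" using b by (simp add: q_def)
    have "e (Suc s) b * w \<in> W s l a"
      unfolding W_def bq using G_step s by (auto intro: T_e wt_e)
    then obtain w' where w': "\<And>j. j < p \<Longrightarrow> w' j \<in> HW (a + 2 * int j)"
      "e (Suc s) b * w \<approx> (\<Sum>j<p. Y (p ^ s) ^ j * w' j)"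
      using generated_by_primitive by blast
    \<comment> \<open>If \<open>n\<close> has a nonzero upper digit \<open>k\<close>, then
      \<open>X n\<close> has the factor \<open>X (p ^ s) ^ k\<close> up to an invertible scalar;
      otherwise \<open>n < p ^ s\<close>.\<close>
    have T: "w' j \<in> T (Suc s)" if j: "j < p" for j
      unfolding T_def
    proof (intro CollectI conjI allI impI)
      have ws: "w' j \<in> T s" "X (p ^ s) * w' j \<in> J" using w'(1)[OF j] by (auto simp: HW_def W_def)
      then show "w' j \<in> U r" by (simp add: T_U)
      fix n assume n: "0 < n \<and> n < p ^ Suc s"
      define i k where "i = n mod q" and "k = n div q"
      have nik: "n = i + q * k" "i < q" using q0 by (simp_all add: i_def k_def)
      have k: "k < p" using n q0 by (simp add: k_def q_def less_mult_imp_div_less mult.commute)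
      show "X n * w' j \<in> J"
      proof (cases "k = 0")
        case True
        then show ?thesis using n nik ws(1) T_X by (simp add: q_def)
      next
        case False
        then obtain k' where k': "k = Suc k'" using not0_implies_Suc by blast
        have "X q ^ k' * (X q * w' j) \<in> J"
          using J_left[OF U_power[OF X_U[OF qr]] ws(2)[folded q_def]] .
        then have "X (p ^ s) ^ k * w' j \<in> J" by (simp add: k' q_def power_Suc2 mult.assoc del: power_Suc)
        then have "sc (of_nat (fact k)) * (X (q * k) * w' j) \<in> J" unfolding X_power by (simp add: q_def mult.assoc)
        then have "X (q * k) * w' j \<in> J" using fact_k_nonzero[OF k] by (rule J_sc_cancel)
        then have "X i * (X (q * k) * w' j) \<in> J" using nik qr J_left[OF X_U[of i]] by auto
        then show ?thesis using X_split[of i s k] nik by (simp add: q_def mult.assoc)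
      qed
    qed
    have "Y m * (\<Sum>j<p. Y (p ^ s) ^ j * w' j) \<in> G (Suc s)"
      unfolding sum_distrib_left
    proof (rule G_sum)
      fix j assume "j \<in> {..<p}"
      then have j: "j < p" by simp
      have "Y m * (Y (p ^ s) ^ j * w' j) = Y (m + q * j) * (sc (of_nat (fact j)) * w' j)"
        using Y_split[of m s j] G_step(2) by (simp add: Y_power q_def mult.assoc sc_left_Y)
      moreover have "m + q * j < p ^ Suc s"
      proof -
        have "m + q * j < q * Suc j" using G_step(2) by (simp add: q_def)
        also have "\<dots> \<le> q * p" using j by (intro mult_left_mono) auto
        finally show ?thesis by (simp add: q_def mult.commute)
      qed
      ultimately show "Y m * (Y (p ^ s) ^ j * w' j) \<in> G (Suc s)"
        using T[OF j] by (auto intro: G_gen T_sc)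
    qed
    moreover have "Y m * (e (Suc s) b * w) - Y m * (\<Sum>j<p. Y (p ^ s) ^ j * w' j) \<in> J"
      using w'(2) mr by (intro J_diff_left Y_U) (auto simp: eqJ_def)
    ultimately show ?thesis using G_add[OF _ G.G_J] by fastforce
  qed
  then have "(\<Sum>b<p ^ Suc s. Y m * (e (Suc s) (int b) * w)) \<in> G (Suc s)" by (intro G_sum) simp
  then have "Y m * w \<in> G (Suc s)" by (simp only: sum_distrib_left[symmetric] sum_e_mult)
  then show ?case using G_step by (intro G_add)
qed

text \<open>At level 0 nothing is demanded: \<open>T 0\<close> is all of \<open>U r\<close>, and
  only \<open>m = 0\<close> occurs, where the binomial coefficient is 1.\<close>

lemma layers: "s \<le> r \<Longrightarrow> strong_primitive s \<and> U r \<subseteq> G s"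
proof (induction s)
  case 0
  have "strong_primitive 0"
    unfolding strong_primitive_def using p_gt_1 by (auto simp: ibinom_0_left)
  moreover have "U r \<subseteq> G 0"
  proof
    fix u assume "u \<in> U r"
    then have "u \<in> T 0" by (simp add: T_def)
    then show "u \<in> G 0" using G_gen[of 0 0 u] by simp
  qed
  ultimately show ?case by blast
next
  case (Suc s)
  then show ?case using strong_primitive_Suc[of s] G_Suc[of s] by auto
qed

section \<open>Simple modules and the maximality of J\<close>

definition D :: "'a \<Rightarrow> 'a set" where
  "D v = {d. \<exists>c. d - (\<Sum>m<p ^ r. sc (c m) * (Y m * v)) \<in> J}"

lemma D_add: "d \<in> D v \<Longrightarrow> d' \<in> D v \<Longrightarrow> d + d' \<in> D v"
proof -
  assume "d \<in> D v" "d' \<in> D v"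
  then obtain c c' where c: "d - (\<Sum>m<p ^ r. sc (c m) * (Y m * v)) \<in> J" "d' - (\<Sum>m<p ^ r. sc (c' m) * (Y m * v)) \<in> J"
    by (auto simp: D_def)
  have "d + d' - (\<Sum>m<p ^ r. sc (c m + c' m) * (Y m * v)) \<in> J"
    using J_add[OF c] by (simp add: sc_add distrib_right sum.distrib algebra_simps)
  then show ?thesis unfolding D_def by (intro CollectI exI[of _ "\<lambda>m. c m + c' m"])
qed

lemma D_sc: "d \<in> D v \<Longrightarrow> sc k * d \<in> D v"
proof -
  assume "d \<in> D v"
  then obtain c where c: "d - (\<Sum>m<p ^ r. sc (c m) * (Y m * v)) \<in> J" by (auto simp: D_def)
  have "sc k * d - (\<Sum>m<p ^ r. sc (k * c m) * (Y m * v)) \<in> J"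
    using J_left[OF sc_U c, of k] by (simp add: right_diff_distrib sum_distrib_left sc_left_sc)
  then show ?thesis unfolding D_def by (intro CollectI exI[of _ "\<lambda>m. k * c m"])
qed

lemma D_J: "d \<in> J \<Longrightarrow> d \<in> D v"
  unfolding D_def by (intro CollectI exI[of _ "\<lambda>m. 0"]) simp

lemma D_gen: "m < p ^ r \<Longrightarrow> Y m * v \<in> D v"
proof -
  assume m: "m < p ^ r"
  have "(\<Sum>i<p ^ r. sc (if i = m then 1 else 0) * (Y i * v)) = (\<Sum>i<p ^ r. if i = m then Y m * v else 0)"
    by (rule sum.cong) auto
  then have "Y m * v - (\<Sum>i<p ^ r. sc (if i = m then 1 else 0) * (Y i * v)) = 0" using m by simp
  then show ?thesis unfolding D_def using J_0 by (intro CollectI exI[of _ "\<lambda>i. if i = m then 1 else 0"]) simp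
qed

lemma D_sum: "(\<And>i. i \<in> A \<Longrightarrow> f i \<in> D v) \<Longrightarrow> sum f A \<in> D v"
  by (induction A rule: infinite_finite_induct) (auto intro: D_J J_0 D_add)

lemma D_mult:
  assumes z: "z \<in> U r" and g: "\<And>m. m < p ^ r \<Longrightarrow> z * (Y m * v) \<in> D v" and d: "d \<in> D v"
  shows "z * d \<in> D v"
proof -
  obtain c where c: "d - (\<Sum>m<p ^ r. sc (c m) * (Y m * v)) \<in> J" using d by (auto simp: D_def)
  have "z * (\<Sum>m<p ^ r. sc (c m) * (Y m * v)) \<in> D v"
    unfolding sum_distrib_left sc_left_U[OF z] by (intro D_sum D_sc g) simp
  moreover have "z * d - z * (\<Sum>m<p ^ r. sc (c m) * (Y m * v)) \<in> D v"
    by (intro D_J J_diff_left z c)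
  ultimately show ?thesis using D_add by fastforce
qed

text \<open>For such \<open>v\<close> the span of the \<open>Y m * v\<close> is already a submodule
  modulo \<open>J\<close>: \<open>X n\<close> turns \<open>Y m * v\<close> into a multiple of
  \<open>Y (m - n) * v\<close> or into zero, and exponents beyond the range vanish by
  overflow.\<close>

lemma U_D:
  assumes v: "v \<in> T r" "wt r a v" and u: "u \<in> U r" and d: "d \<in> D v"
  shows "u * d \<in> D v"
proof -
  let ?A = "{u \<in> U r. \<forall>d\<in>D v. u * d \<in> D v}"
  have "is_subring ?A"
    unfolding is_subring_def
  proof (intro conjI ballI)
    fix x y assume xy: "x \<in> ?A" "y \<in> ?A"
    have "(x - y) * d \<in> D v" if "d \<in> D v" for d
    proof -
      have "x * d + sc (- 1) * (y * d) \<in> D v" using xy that by (auto intro: D_add D_sc)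
      then show ?thesis by (simp add: sc_uminus algebra_simps)
    qed
    then show "x - y \<in> ?A" using xy by (auto intro: U_closed)
    show "x * y \<in> ?A" using xy by (auto simp: mult.assoc intro: U_closed)
  qed (simp add: U_closed)
  moreover have "sc c \<in> ?A" for c by (auto intro: D_sc sc_U)
  moreover have "X n \<in> ?A" if n: "n < p ^ r" for n
  proof -
    have "X n * (Y m * v) \<in> D v" if m: "m < p ^ r" for m
    proof -
      have "(if n \<le> m then sc (of_int (ibinom (a - int m + int n) n)) * (Y (m - n) * v) else 0) \<in> D v"
        using m D_sc[OF D_gen[of "m - n" v]] D_J[OF J_0] by auto
      from D_add[OF D_J[OF X_Y_T_wt[OF v(1) order_refl n m v(2)]] this] show ?thesis by simp
    qed
    then show ?thesis using n by (auto intro: D_mult X_U)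
  qed
  moreover have "Y n \<in> ?A" if n: "n < p ^ r" for n
  proof -
    have "Y n * (Y m * v) \<in> D v" if m: "m < p ^ r" for m
    proof (cases "n + m < p ^ r")
      case True
      then show ?thesis by (simp only: mult.assoc[symmetric] Y_mult) (simp only: mult.assoc, intro D_sc D_gen)
    next
      case False
      then have "(of_nat ((n + m) choose n) :: 'k) = 0"
        using dvd_choose_overflow[OF n m] by (simp only: of_nat_k_eq_0_iff not_less)
      then show ?thesis by (simp add: mult.assoc[symmetric] Y_mult D_J J_0)
    qed
    then show ?thesis using n by (auto intro: D_mult Y_U)
  qed
  ultimately have "U r \<subseteq> ?A" by (intro U_least)
  then show ?thesis using u d by blast
qed

text \<open>A vector of \<open>T r\<close> of weight \<open>a\<close> generates a simple module modulo \<open>J\<close>: if \<open>z v\<close> does not vanish,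
  raising its lowest component recovers \<open>v\<close>.\<close>

lemma nilpotent_annihilates_primitive:
  assumes N: "two_sided_ideal (U r) N" "nilpotent_ideal N" and z: "z \<in> N"
    and v: "v \<in> T r" "wt r a v" and a: "0 \<le> a" "a < int (p ^ r)"
  shows "z * v \<in> J"
proof (rule ccontr)
  assume zv: "z * v \<notin> J"
  have L: "strong_primitive r" using layers by blast
  have zU: "z \<in> U r" using N z by (auto simp: two_sided_ideal_def)
  have q0: "p ^ r > 0" using p_pos by simp
  have "v \<in> D v" using D_gen[of 0 v] q0 by simp
  then have "z * v \<in> D v" by (intro U_D[OF v zU])
  then obtain c where c: "z * v - (\<Sum>m<p ^ r. sc (c m) * (Y m * v)) \<in> J" by (auto simp: D_def)
  define A where "A = {m. m < p ^ r \<and> sc (c m) * (Y m * v) \<notin> J}"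
  have fin: "finite A" by (simp add: A_def)
  have "A \<noteq> {}"
  proof
    assume "A = {}"
    then have "(\<Sum>m<p ^ r. sc (c m) * (Y m * v)) \<in> J" by (intro J_sum) (auto simp: A_def)
    then show False using c zv J_diff_iff by blast
  qed
  \<comment> \<open>The largest exponent belongs to the lowest component: \<open>X m\<close> kills
    the components with smaller exponents and takes this one to a multiple of
    \<open>v\<close>.\<close>
  define m where "m = Max A"
  have mA: "m \<in> A" using fin \<open>A \<noteq> {}\<close> by (simp add: m_def)
  then have m: "m < p ^ r" "sc (c m) * (Y m * v) \<notin> J" by (auto simp: A_def)
  have mmax: "sc (c i) * (Y i * v) \<in> J" if "m < i" "i < p ^ r" for i
    using that fin by (metis (mono_tags, lifting) A_def Max_ge m_def mem_Collect_eq not_le)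
  define k where "k = c m * of_int (ibinom a m)"
  have Ymv: "Y m * v \<notin> J" using m(2) J_left[OF sc_U] by blast
  \<comment> \<open>If \<open>p\<close> divided the binomial coefficient,
    \<open>strong_primitive\<close> would put the chosen component into \<open>J\<close>.\<close>
  have k0: "k \<noteq> 0"
  proof -
    have "c m \<noteq> 0" using m(2) J_0 by auto
    moreover have "\<not> int p dvd ibinom a m"
      using L Ymv v a m(1) unfolding strong_primitive_def by blast
    ultimately show ?thesis by (simp add: k_def of_int_k_eq_0_iff)
  qed
  have "X m * (sc (c i) * (Y i * v)) - (if i = m then sc k * v else 0) \<in> J" if i: "i < p ^ r" for i
  proof -
    have *: "X m * (sc (c i) * (Y i * v)) - sc (c i) * (if m \<le> i then sc (of_int (ibinom (a - int i + int m) m)) * (Y (i - m) * v) else 0) \<in> J"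
      unfolding sc_left_X by (intro J_diff_left sc_U X_Y_T_wt[OF v(1) order_refl m(1) i v(2)])
    consider "i < m" | "i = m" | "i > m" by linarith
    then show ?thesis
    proof cases
      case 1 then show ?thesis using * by simp
    next
      case 2 then show ?thesis using * by (simp add: k_def sc_left_sc)
    next
      case 3
      then have "X m * (sc (c i) * (Y i * v)) \<in> J" using J_left[OF X_U[OF m(1)] mmax[OF _ i]] by blast
      then show ?thesis using 3 by simp
    qed
  qed
  then have "(\<Sum>i<p ^ r. X m * (sc (c i) * (Y i * v)) - (if i = m then sc k * v else 0)) \<in> J"
    by (intro J_sum) simp
  then have "X m * (\<Sum>i<p ^ r. sc (c i) * (Y i * v)) - sc k * v \<in> J"
    using m(1) by (simp add: sum_subtractf sum_distrib_left)
  moreover have "X m * (z * v) - X m * (\<Sum>i<p ^ r. sc (c i) * (Y i * v)) \<in> J"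
    by (intro J_diff_left X_U m c)
  ultimately have "X m * (z * v) - sc k * v \<in> J" using J_diff_trans by blast
  then have "sc (1 / k) * (X m * (z * v)) - sc (1 / k) * (sc k * v) \<in> J" by (intro J_diff_left sc_U)
  moreover define y where "y = sc (1 / k) * (X m * z)"
  ultimately have yv: "y * v - v \<in> J" by (simp add: sc_inverse[OF k0] mult.assoc)
  have yN: "y \<in> N" using N(1) z m(1) unfolding y_def two_sided_ideal_def by (meson X_U sc_U)
  have yU: "y \<in> U r" using N(1) yN by (auto simp: two_sided_ideal_def)
  \<comment> \<open>\<open>y\<close> fixes \<open>v\<close> modulo \<open>J\<close>, hence so do its
    powers; as \<open>y\<close> lies in a nilpotent ideal, one of them is zero.\<close>
  have "y ^ n * v - v \<in> J" for n
  proof (induction n)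
    case (Suc n)
    have "y * (y ^ n * v) - y * v \<in> J" by (intro J_diff_left yU Suc)
    then show ?case using J_diff_trans[OF _ yv] by (simp add: mult.assoc)
  qed (simp add: J_0)
  moreover obtain n where "\<forall>xs. length xs = n \<and> set xs \<subseteq> N \<longrightarrow> prod_list xs = 0"
    using N(2) unfolding nilpotent_ideal_def by blast
  then have "y ^ n = 0"
    using yN by (metis (no_types, lifting) empty_subsetI insert_subset length_replicate order_trans prod_list_replicate set_replicate_conv_if subsetI)
  ultimately have "v \<in> J" using J_uminus[of "0 - v"] by (metis diff_0 minus_minus mult_zero_left)
  then show False using zv J_left[OF zU] by blast
qed

text \<open>Since \<open>1\<close> lies in \<open>G r\<close>, it is a sum of terms
  \<open>Y m * w\<close> with \<open>w\<close> in \<open>T r\<close>, modulo \<open>J\<close>. For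
  \<open>y\<close> in \<open>N\<close> the product \<open>y * Y m\<close> is again in
  \<open>N\<close> and annihilates each weight component of \<open>w\<close>.\<close>

theorem nilpotent_ideal_subset:
  assumes N: "two_sided_ideal (U r) N" "nilpotent_ideal N"
  shows "N \<subseteq> J"
proof
  fix z assume z: "z \<in> N"
  have "y * u \<in> J" if "u \<in> G r" "y \<in> N" for y u
    using that
  proof (induction rule: G.induct)
    case (G_J v)
    then show ?case using N by (auto simp: two_sided_ideal_def intro: J_left)
  next
    case (G_step u m w)
    have yY: "y * Y m \<in> N" using N(1) G_step by (auto simp: two_sided_ideal_def intro: Y_U)
    have "(\<Sum>a<p ^ r. y * Y m * (e r (int a) * w)) \<in> J"
      using G_step(3) by (intro J_sum nilpotent_annihilates_primitive[OF N yY]) (auto intro: T_e wt_e simp flip: of_nat_power)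
    then have "y * Y m * w \<in> J" by (simp only: sum_distrib_left[symmetric] sum_e_mult)
    then show ?case using G_step by (simp add: distrib_left mult.assoc J_add)
  qed
  moreover have "1 \<in> G r" using layers[of r] U_closed(1) by blast
  ultimately show "z \<in> J" using z by fastforce
qed

end

section \<open>The generators\<close>

context divided_sl2_ideal
begin

text \<open>At weight \<open>l\<close> the coefficient is the binomial of \<open>l\<close> over
  \<open>l\<close>. So nothing is lost on passing from a vector of \<open>T s\<close> to the lowest
  vector \<open>Y l * u\<close> of its string, which \<open>Y_cancel\<close> exploits.\<close>

lemma X_Y_cancel:
  assumes s: "s < r" and u: "u \<in> T s" "wt s (int l) u" and l: "l < p ^ s"
  shows "X l * (Y l * u) - u \<in> J"
  using X_Y_T_wt[OF u(1) _ l _ u(2), of l] p_power_le[of s l] s l by simp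

lemma Y_cancel:
  assumes s: "s < r" and u: "u \<in> T s" "wt s (int l) u" and l: "l < p ^ s" and Y: "Y l * u \<in> J"
  shows "u \<in> J"
proof -
  have "X l * (Y l * u) \<in> J" using J_left[OF X_U Y] p_power_le[of s l] s l by simp
  then show ?thesis using J_diff_iff[OF X_Y_cancel[OF s u l]] by blast
qed

text \<open>Every correction term contains some \<open>X (p ^ s - t)\<close> with 0 < t \<le> l <
  p^s and so lies in \<open>J\<close>.\<close>

lemma X_Y_low:
  assumes s: "s < r" and u: "u \<in> T s" and l: "l < p ^ s"
  shows "X (p ^ s) * (Y l * u) - Y l * (X (p ^ s) * u) \<in> J"
proof -
  define h where "h t = Y (l - t) * (B (2 * int t - int l - int (p ^ s)) t * (X (p ^ s - t) * u))" for t
  have "X (p ^ s) * (Y l * u) = (\<Sum>t\<le>l. h t)"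
    unfolding h_def mult.assoc[symmetric] X_Y using l by (simp add: sum_distrib_right min_absorb1)
  also have "\<dots> = h 0 + (\<Sum>t<l. h (Suc t))"
    unfolding lessThan_Suc_atMost[symmetric] by (rule sum.lessThan_Suc_shift)
  finally have 1: "X (p ^ s) * (Y l * u) = Y l * (X (p ^ s) * u) + (\<Sum>t<l. h (Suc t))" by (simp add: h_def)
  have "h (Suc t) \<in> J" if "t < l" for t
    unfolding h_def using that l s
    by (intro J_left[OF Y_U] J_left[OF B_U] T_X[OF u]) (auto intro!: p_power_le[of s])
  then have "(\<Sum>t<l. h (Suc t)) \<in> J" by (intro J_sum) auto
  then show ?thesis unfolding 1 by simp
qed

lemma X_power_Y_low:
  assumes s: "s < r" and u: "u \<in> T s" and l: "l < p ^ s"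
  shows "X (p ^ s) ^ k * (Y l * u) - Y l * (X (p ^ s) ^ k * u) \<in> J"
proof (induction k)
  case (Suc k)
  have q: "p ^ s < p ^ r" using s p_gt_1 by simp
  have T: "X (p ^ s) ^ k * u \<in> T s"
    by (induction k) (auto simp: mult.assoc u intro: X_T[OF s])
  have "X (p ^ s) * (X (p ^ s) ^ k * (Y l * u)) - X (p ^ s) * (Y l * (X (p ^ s) ^ k * u)) \<in> J"
    by (intro J_diff_left X_U q Suc)
  from J_diff_trans[OF this X_Y_low[OF s T l]] show ?case by (simp add: mult.assoc)
qed (simp add: J_0)

lemma Y_power_commute: "Y n ^ k * (Y m * u) = Y m * (Y n ^ k * u)"
proof (induction k)
  case (Suc k)
  have "Y n * (Y m * (Y n ^ k * u)) = Y m * (Y n * (Y n ^ k * u))"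
    by (simp only: mult.assoc[symmetric] Y_commute)
  then show ?case using Suc by (simp add: mult.assoc)
qed simp

end

context divided_sl2
begin

lemma jacobson_radical_eq:
  assumes S: "\<And>g. g \<in> S \<Longrightarrow> raising r g"
    and layered: "layered_ideal sc X Y B p r (ideal_gen (U r) S) \<nu>"
  shows "ideal_gen (U r) S = jacobson_radical (U r)"
proof -
  interpret layered_ideal sc X Y B p r "ideal_gen (U r) S" \<nu> by (rule layered)
  show ?thesis unfolding jacobson_radical_def
    using ideal nilpotent_ideal_gen_raising[of S r] S nilpotent_ideal_subset
    by (intro Greatest_equality[symmetric]) auto
qed

text \<open>For 1 \<le> \<nu> and 2\<nu> < p the first binomial is nonzero at the weight residues 0,
  ..., p^i (p - 2\<nu>) - 1, and the second, its shift by one, at 1, ..., p^i (p - 2\<nu>); the sum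
  reaches both ends.\<close>

definition h :: "nat \<Rightarrow> nat \<Rightarrow> 'a" where
  "h \<nu> i = B (int (2 * p ^ i * \<nu>)) (2 * p ^ i * \<nu>) + B (int (2 * p ^ i * \<nu>) - 1) (2 * p ^ i * \<nu>)"

definition h_value :: "nat \<Rightarrow> nat \<Rightarrow> int \<Rightarrow> 'k" where
  "h_value \<nu> i a = of_int (ibinom (a + int (2 * p ^ i * \<nu>)) (2 * p ^ i * \<nu>)
     + ibinom (a + int (2 * p ^ i * \<nu>) - 1) (2 * p ^ i * \<nu>))"

lemma h_bound:
  assumes "2 * \<nu> < p"
  shows "2 * p ^ i * \<nu> < p ^ Suc i"
  using assms p_pos by simp

lemma h_e:
  assumes "2 * \<nu> < p" "Suc i \<le> s"
  shows "h \<nu> i * e s a = sc (h_value \<nu> i a) * e s a"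
proof -
  have "p ^ Suc i \<le> p ^ s" using assms(2) p_pos by (intro power_increasing) auto
  then have "2 * p ^ i * \<nu> < p ^ s" using h_bound[OF assms(1), of i] by linarith
  then show ?thesis
    by (simp add: h_def h_value_def distrib_right B_e sc_add algebra_simps)
qed

lemma h_U: "2 * \<nu> < p \<Longrightarrow> i < r \<Longrightarrow> h \<nu> i \<in> U r"
proof -
  assume a: "2 * \<nu> < p" "i < r"
  have "p ^ Suc i \<le> p ^ r" using a(2) p_pos by (intro power_increasing) auto
  then have "2 * p ^ i * \<nu> < p ^ r" using h_bound[OF a(1), of i] by linarith
  then show ?thesis unfolding h_def by (intro U_closed B_U)
qed

text \<open>The function \<open>h(\<nu>,i)\<close> is supported on the weights congruent to \<open>0, \<dots>, p^i (p - 2\<nu>)\<close> modulo \<open>p^(i+1)\<close>: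
  by Lucas only the residue modulo \<open>p^i\<close> (zero or not) and the \<open>i\<close>-th digit \<open>c\<close> matter.\<close>

lemma h_value_eq_0_iff:
  assumes nu: "1 \<le> \<nu>" "2 * \<nu> < p"
  shows "h_value \<nu> i a \<noteq> 0 \<longleftrightarrow> a mod int (p ^ Suc i) \<le> int (p ^ i) * (int p - 2 * int \<nu>)"
proof -
  define q where "q = p ^ i"
  have q0: "int q > 0" using p_pos by (simp add: q_def)
  define l b c where "l = a mod int q" and "b = a div int q" and "c = b mod int p"
  have l: "0 \<le> l" "l < int q" and c: "0 \<le> c" "c < int p" using q0 p_pos by (simp_all add: l_def c_def)
  have a: "a = l + int q * b" by (simp add: l_def b_def)
  have amod: "a mod int (p ^ Suc i) = int q * c + l"
    using zmod_zmult2_eq[of "int p" a "int q"] by (simp add: q_def c_def b_def l_def mult.commute)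
  have luc: "(of_int (ibinom x (2 * q * \<nu>)) :: 'k) = of_int (ibinom ((x div int q) mod int p) (2 * \<nu>))" for x
  proof -
    have "[ibinom x (2 * q * \<nu>) = ibinom (x div int q) (2 * \<nu>)] (mod int p)"
      using ibinom_lucas[OF prime_p q_def, of x "2 * q * \<nu>"] q0 by (simp add: mult.assoc mult.left_commute[of 2])
    moreover have "[ibinom (x div int q) (2 * \<nu>) = ibinom ((x div int q) mod int p) (2 * \<nu>)] (mod int p)"
      using nu by (intro ibinom_cong_mod[OF prime_p, of _ 1]) auto
    ultimately show ?thesis by (intro of_int_k_cong) (rule cong_trans)
  qed
  have c_val: "(of_int (ibinom ((x + 2 * int \<nu>) mod int p) (2 * \<nu>)) :: 'k) =
      (if d + 2 * int \<nu> < int p then of_nat (nat d + 2 * \<nu> choose (2 * \<nu>)) else 0)" if d: "x mod int p = d" for x d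
  proof -
    have d0: "0 \<le> d" "d < int p" using d p_pos by auto
    show ?thesis
    proof (cases "d + 2 * int \<nu> < int p")
      case True
      have "(x + 2 * int \<nu>) mod int p = int (nat d + 2 * \<nu>)"
        using True d0 by (intro mod_eq_shift[OF d, of _ _ 0]) auto
      then show ?thesis using True by (simp only: ibinom_of_nat) simp
    next
      case False
      have "(x + 2 * int \<nu>) mod int p = d + 2 * int \<nu> - int p"
        using False d0 nu by (intro mod_eq_shift[OF d, of _ _ "- 1"]) auto
      moreover have "ibinom (d + 2 * int \<nu> - int p) (2 * \<nu>) = 0"
        using False d0 by (intro ibinom_eq_0) auto
      ultimately show ?thesis using False by simp
    qed
  qed
  have nz: "(of_nat (n choose k) :: 'k) \<noteq> 0" if "n < p" "k \<le> n" for n k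
  proof
    assume "(of_nat (n choose k) :: 'k) = 0"
    then have "p dvd fact n" using binomial_fact_lemma[OF that(2)] of_nat_k_eq_0_iff by (metis dvd_mult)
    then show False using that prime_p by (simp add: prime_dvd_fact_iff)
  qed
  have d1: "(a + int (2 * q * \<nu>)) div int q = b + 2 * int \<nu>"
    using l by (intro int_div_pos_eq[of _ _ _ l]) (simp_all add: a algebra_simps)
  show ?thesis
  proof (cases "l = 0")
    case True
    have d2: "(a + int (2 * q * \<nu>) - 1) div int q = (b - 1) + 2 * int \<nu>"
      using True q0 by (intro int_div_pos_eq[of _ _ _ "int q - 1"]) (simp_all add: a algebra_simps)
    have H: "h_value \<nu> i a = of_int (ibinom ((b + 2 * int \<nu>) mod int p) (2 * \<nu>))
      + of_int (ibinom ((b - 1 + 2 * int \<nu>) mod int p) (2 * \<nu>))"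
      unfolding h_value_def q_def[symmetric] of_int_add luc d1 d2 ..
    have rhs: "a mod int (p ^ Suc i) \<le> int (p ^ i) * (int p - 2 * int \<nu>) \<longleftrightarrow> c \<le> int p - 2 * int \<nu>"
      unfolding amod q_def[symmetric] using True q0 by simp
    show ?thesis
    proof (cases "c = 0")
      case c0: True
      have m1: "(b - 1) mod int p = int p - 1"
        using mod_eq_shift[of b "int p" 0 "int p - 1" "- 1" 1] c0 p_gt_1 by (simp add: c_def)
      have "h_value \<nu> i a = of_nat (2 * \<nu> choose (2 * \<nu>))"
        unfolding H c_val[OF c_def[symmetric]] c_val[OF m1] using c0 nu by simp
      then show ?thesis unfolding rhs using c0 nu by simp
    next
      case False
      have m1: "(b - 1) mod int p = c - 1"
        using mod_eq_shift[of b "int p" c "c - 1" "- 1" 0] False c by (simp add: c_def)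
      define n where "n = nat c + 2 * \<nu>"
      have n: "n = Suc (nat (c - 1) + 2 * \<nu>)" using False c by (simp add: n_def)
      consider "c + 2 * int \<nu> < int p" | "c + 2 * int \<nu> = int p" | "c + 2 * int \<nu> > int p" by linarith
      then show ?thesis
      proof cases
        case 1
        have H1: "h_value \<nu> i a = of_nat ((n choose (2 * \<nu>)) + ((n - 1) choose (2 * \<nu>)))"
          unfolding H c_val[OF c_def[symmetric]] c_val[OF m1] using 1 n by (simp add: n_def)
        \<comment> \<open>Multiplication by \<open>c\<close> merges the two binomials into a
          multiple of one: the factor is n + c = 2(c + \<nu>), which is prime to
          \<open>p\<close>.\<close>
        have "nat c * (n choose (2 * \<nu>)) = n * ((n - 1) choose (2 * \<nu>))"
          using binomial_absorb_comp[of n "2 * \<nu>"] by (simp add: n_def)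
        then have "nat c * ((n choose (2 * \<nu>)) + ((n - 1) choose (2 * \<nu>)))
            = 2 * (nat c + \<nu>) * ((n - 1) choose (2 * \<nu>))"
          by (simp add: n_def algebra_simps)
        moreover have "\<not> p dvd 2 * (nat c + \<nu>) * ((n - 1) choose (2 * \<nu>))"
        proof -
          have "\<not> p dvd 2" using nu by (auto dest: dvd_imp_le)
          moreover have "\<not> p dvd nat c + \<nu>" using 1 c nu by (auto dest!: dvd_imp_le)
          moreover have "\<not> p dvd ((n - 1) choose (2 * \<nu>))"
            using nz[of "n - 1" "2 * \<nu>"] 1 n c by (auto simp: of_nat_k_eq_0_iff n_def)
          ultimately show ?thesis by (simp only: prime_dvd_mult_iff[OF prime_p] simp_thms)
        qed
        ultimately have "\<not> p dvd (n choose (2 * \<nu>)) + ((n - 1) choose (2 * \<nu>))" by (metis dvd_mult)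
        then have "h_value \<nu> i a \<noteq> 0" unfolding H1 of_nat_k_eq_0_iff .
        then show ?thesis unfolding rhs using 1 by simp
      next
        case 2
        have "h_value \<nu> i a = of_nat (nat (c - 1) + 2 * \<nu> choose (2 * \<nu>))"
          unfolding H c_val[OF c_def[symmetric]] c_val[OF m1] using 2 by simp
        then have "h_value \<nu> i a \<noteq> 0" using nz[of "nat (c - 1) + 2 * \<nu>" "2 * \<nu>"] 2 False c by simp
        then show ?thesis unfolding rhs using 2 by simp
      next
        case 3
        then have "h_value \<nu> i a = 0"
          unfolding H c_val[OF c_def[symmetric]] c_val[OF m1] by simp
        then show ?thesis unfolding rhs using 3 by simp
      qed
    qed
  next
    case False
    have d2: "(a + int (2 * q * \<nu>) - 1) div int q = b + 2 * int \<nu>"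
      using False l by (intro int_div_pos_eq[of _ _ _ "l - 1"]) (simp_all add: a algebra_simps)
    have H: "h_value \<nu> i a = 2 * of_int (ibinom ((b + 2 * int \<nu>) mod int p) (2 * \<nu>))"
      unfolding h_value_def q_def[symmetric] of_int_add luc d1 d2 by simp
    have "\<not> p dvd 2" using nu by (auto dest: dvd_imp_le)
    then have 2: "(2 :: 'k) \<noteq> 0" using of_nat_k_eq_0_iff[of 2] by simp
    have "h_value \<nu> i a \<noteq> 0 \<longleftrightarrow> c + 2 * int \<nu> < int p"
      unfolding H c_val[OF c_def[symmetric]] using 2 nz[of "nat c + 2 * \<nu>" "2 * \<nu>"] c by auto
    moreover have "a mod int (p ^ Suc i) \<le> int (p ^ i) * (int p - 2 * int \<nu>) \<longleftrightarrow> c + 2 * int \<nu> < int p"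
    proof
      assume "a mod int (p ^ Suc i) \<le> int (p ^ i) * (int p - 2 * int \<nu>)"
      then have "int q * c < int q * (int p - 2 * int \<nu>)"
        unfolding amod q_def[symmetric] using False l by linarith
      then show "c + 2 * int \<nu> < int p" using q0 by simp
    next
      assume "c + 2 * int \<nu> < int p"
      then have "int q * (c + 1) \<le> int q * (int p - 2 * int \<nu>)" using q0 by (intro mult_left_mono) auto
      then show "a mod int (p ^ Suc i) \<le> int (p ^ i) * (int p - 2 * int \<nu>)"
        unfolding amod q_def[symmetric] using l by (simp add: algebra_simps)
    qed
    ultimately show ?thesis by simp
  qed
qed

section \<open>Odd p\<close>

definition odd_generators :: "nat \<Rightarrow> (nat \<Rightarrow> nat) \<Rightarrow> 'a set" where
  "odd_generators r \<nu> = {h (\<nu> i) i * X (p ^ i) ^ (p - \<nu> i) | i. i < r} \<union> {Y (p ^ i) ^ (p - \<nu> i) * h (\<nu> i) i | i. i < r}"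

lemma raising_odd_generators:
  assumes nu: "\<And>i. i < r \<Longrightarrow> 1 \<le> \<nu> i \<and> 2 * \<nu> i < p" and g: "g \<in> odd_generators r \<nu>"
  shows "raising r g"
proof -
  obtain i where i: "i < r" and gi: "g = h (\<nu> i) i * X (p ^ i) ^ (p - \<nu> i) \<or> g = Y (p ^ i) ^ (p - \<nu> i) * h (\<nu> i) i"
    using g by (auto simp: odd_generators_def)
  \<comment> \<open>The power of \<open>X (p ^ i)\<close> in the generator is \<open>X n\<close> up
    to the scalar \<open>k\<close>, which is moved into the weight factor. With this
    \<open>n\<close>, the bound \<open>2 * n - p ^ Suc i\<close> is the upper end of the support of
    \<open>h\<close>.\<close>
  define k n where "k = (of_nat (fact (p - \<nu> i)) :: 'k)" and "n = p ^ i * (p - \<nu> i)"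
  have nu_i: "1 \<le> \<nu> i" "2 * \<nu> i < p" using nu[OF i] by auto
  have f: "sc k * h (\<nu> i) i \<in> U r" using h_U[OF nu_i(2) i] by (intro U_closed sc_U)
  have fe: "sc k * h (\<nu> i) i * e r a = sc (k * h_value (\<nu> i) i a) * e r a" for a
    using h_e[OF nu_i(2), of i r a] i by (simp add: mult.assoc sc_mult)
  have n: "n < p ^ Suc i" "p ^ Suc i \<le> 2 * n"
    using nu_i p_pos by (simp_all add: n_def mult.commute[of _ "p ^ i"] mult.left_commute[of _ "p ^ i"])
  have n2: "2 * int n - int (p ^ Suc i) = int (p ^ i) * (int p - 2 * int (\<nu> i))"
    using nu_i by (simp add: n_def algebra_simps of_nat_diff)
  have supp: "a mod int (p ^ Suc i) \<le> 2 * int n - int (p ^ Suc i)" if "k * h_value (\<nu> i) i a \<noteq> 0" for a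
    using h_value_eq_0_iff[OF nu_i, of i a] that unfolding n2 by simp
  have hX: "h (\<nu> i) i * X (p ^ i) ^ (p - \<nu> i) = sc k * h (\<nu> i) i * X n"
    unfolding X_power k_def n_def by (simp only: sc_left_U[OF h_U[OF nu_i(2) i]] mult.assoc)
  have hY: "Y (p ^ i) ^ (p - \<nu> i) * h (\<nu> i) i = Y n * (sc k * h (\<nu> i) i)"
    unfolding Y_power k_def n_def by (simp only: sc_left_Y mult.assoc)
  show ?thesis
    using gi raising_X[OF f fe i n supp] raising_Y[OF f fe i n supp] unfolding hX hY by auto
qed

text \<open>Over level \<open>s\<close>, a vector of \<open>W s l b\<close> generates a string from
  the weight \<open>l + p ^ s * b\<close> down to the weight that is \<open>2 * l\<close> smaller.
  The residue of the top is small if the digit of \<open>b\<close> is 0; otherwise, by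
  \<open>low_weight_mod\<close>, the residue of the bottom does not exceed \<open>p ^ s\<close>
  times that digit.\<close>

lemma high_weight_mod:
  assumes l: "0 \<le> l" "l < int (p ^ s)" and b: "b mod int p = 0"
  shows "(l + int (p ^ s) * b) mod int (p ^ Suc s) = l"
proof -
  obtain j where "b = int p * j" using b by (auto simp: dvd_eq_mod_eq_0[symmetric])
  then show ?thesis using l p_gt_1
    by (intro int_mod_pos_eq[of _ _ j]) (auto simp: algebra_simps intro: less_le_trans)
qed

lemma low_weight_mod:
  assumes m: "m < p ^ s" and b: "b mod int p \<noteq> 0"
  shows "(int m + int (p ^ s) * b - 2 * int m) mod int (p ^ Suc s) = int (p ^ s) * (b mod int p) - int m"
proof (rule int_mod_pos_eq)
  have "int (p ^ s) * b = int (p ^ s) * (int p * (b div int p) + b mod int p)" by simp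
  also have "\<dots> = int (p ^ Suc s) * (b div int p) + int (p ^ s) * (b mod int p)"
    by (simp only: power_Suc of_nat_mult distrib_left mult_ac)
  finally show "int m + int (p ^ s) * b - 2 * int m = int (p ^ Suc s) * (b div int p) + (int (p ^ s) * (b mod int p) - int m)"
    by linarith
  have c: "1 \<le> b mod int p" "b mod int p + 1 \<le> int p"
    using b p_pos pos_mod_sign[of "int p" b] pos_mod_bound[of "int p" b] by linarith+
  have "int (p ^ s) * 1 \<le> int (p ^ s) * (b mod int p)" "int (p ^ s) * (b mod int p + 1) \<le> int (p ^ s) * int p"
    using c by (intro mult_left_mono; simp)+
  moreover have "int m < int (p ^ s)" "int (p ^ Suc s) = int (p ^ s) * int p" using m by simp_all
  moreover have "int (p ^ s) * (b mod int p + 1) = int (p ^ s) * (b mod int p) + int (p ^ s)"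
    by (simp add: algebra_simps)
  ultimately show "0 \<le> int (p ^ s) * (b mod int p) - int m" "int (p ^ s) * (b mod int p) - int m < int (p ^ Suc s)"
    by linarith+
qed

text \<open>The support of \<open>h\<close> is a condition on the residue of the whole weight,
  whereas the layer relation bounds only a digit. If the digit is p - 2\<nu> and l > 0, the top of
  the string lies outside the support. The bottom lies inside unless the digit is 0, where it may
  wrap around; then the top serves.\<close>

lemma layered_odd:
  assumes nu: "\<And>i. i < r \<Longrightarrow> 1 \<le> \<nu> i \<and> 2 * \<nu> i < p"
  shows "layered_ideal sc X Y B p r (ideal_gen (U r) (odd_generators r \<nu>)) \<nu>"
proof -
  let ?J = "ideal_gen (U r) (odd_generators r \<nu>)"
  have S: "odd_generators r \<nu> \<subseteq> U r"
    using raising_odd_generators[of r \<nu>] nu by (auto simp: raising_def)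
  interpret divided_sl2_ideal sc X Y B p r ?J
    by unfold_locales (rule two_sided_ideal_ideal_gen[OF is_subring_U S])
  show ?thesis
  proof
    fix s show "1 \<le> \<nu> s" "2 * \<nu> s < p \<or> p = 2 \<and> \<nu> s = 1" if "s < r" using nu that by auto
  next
    fix s l v a
    assume s: "s < r" and l0: "0 \<le> l" "l < int (p ^ s)" and v: "v \<in> W s l a"
      and a: "(a + 2 * (int p - int (\<nu> s))) mod int p \<le> int p - 2 * int (\<nu> s)"
    define k where "k = p - \<nu> s"
    have nu_s: "1 \<le> \<nu> s" "2 * \<nu> s < p" using nu[OF s] by auto
    define b where "b = a + 2 * int k"
    have b: "b mod int p \<le> int p - 2 * int (\<nu> s)" using a nu_s by (simp add: b_def k_def of_nat_diff)
    obtain m where m: "l = int m" "m < p ^ s" using l0 by (metis nonneg_int_cases of_nat_less_iff)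
    have mr: "m < p ^ r" using p_power_le[of s m] s m by simp
    define u where "u = X (p ^ s) ^ k * v"
    have u: "u \<in> W s l b" unfolding u_def b_def by (rule W_X_power[OF s v])
    then have uT: "u \<in> T s" and uw: "wt (Suc s) (l + int (p ^ s) * b) u" by (auto simp: W_def)
    have vT: "v \<in> T s" using v by (simp add: W_def)
    have g: "h (\<nu> s) s * X (p ^ s) ^ k \<in> ?J"
      using s unfolding k_def by (intro subsetD[OF subset_ideal_gen]) (auto simp: odd_generators_def)
    have hU: "h (\<nu> s) s \<in> U r" by (rule h_U[OF nu_s(2) s])
    have eig: "w \<in> ?J" if "h (\<nu> s) s * w \<in> ?J" "wt (Suc s) d w" "d mod int (p ^ Suc s) \<le> int (p ^ s) * (int p - 2 * int (\<nu> s))" for w d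
    proof -
      have "h (\<nu> s) s * w - sc (h_value (\<nu> s) s d) * w \<in> ?J"
        using s by (intro wt_eigen[OF hU h_e[OF nu_s(2) order_refl] _ that(2)]) simp
      then have "sc (h_value (\<nu> s) s d) * w \<in> ?J" using that(1) J_diff_iff by blast
      then show ?thesis using J_sc_cancel h_value_eq_0_iff[OF nu_s, of s d] that(3) by blast
    qed
    have "u \<in> ?J"
    proof (cases "b mod int p = 0")
      case True
      have "(l + int (p ^ s) * b) mod int (p ^ Suc s) = l" by (rule high_weight_mod[OF l0 True])
      moreover have "l \<le> int (p ^ s) * (int p - 2 * int (\<nu> s))"
      proof -
        have "int (p ^ s) * 1 \<le> int (p ^ s) * (int p - 2 * int (\<nu> s))"
          using nu_s by (intro mult_left_mono) auto
        then show ?thesis using l0 by linarith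
      qed
      moreover have "h (\<nu> s) s * u \<in> ?J"
        using J_right[OF T_U[OF vT] g] by (simp add: u_def mult.assoc)
      ultimately show ?thesis using eig[OF _ uw] by simp
    next
      case False
      have w: "wt (Suc s) (l + int (p ^ s) * b - 2 * int m) (Y m * u)" by (rule wt_Y[OF uw mr])
      have range: "(l + int (p ^ s) * b - 2 * int m) mod int (p ^ Suc s) = int (p ^ s) * (b mod int p) - int m"
        using low_weight_mod[OF m(2) False] by (simp only: m(1))
      have "int (p ^ s) * (b mod int p) \<le> int (p ^ s) * (int p - 2 * int (\<nu> s))"
        using b by (intro mult_left_mono) auto
      then have le: "int (p ^ s) * (b mod int p) - int m \<le> int (p ^ s) * (int p - 2 * int (\<nu> s))" by linarith
      \<comment> \<open>The generator is applied to \<open>Y m * v\<close> in place of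
        \<open>v\<close>, and \<open>X_power_Y_low\<close> then moves \<open>Y m\<close> to the left
        of the powers of \<open>X (p ^ s)\<close>.\<close>
      have "h (\<nu> s) s * (X (p ^ s) ^ k * (Y m * v)) \<in> ?J"
        using J_right[OF U_closed(6)[OF Y_U[OF mr] T_U[OF vT]] g] by (simp add: mult.assoc)
      moreover have "h (\<nu> s) s * (X (p ^ s) ^ k * (Y m * v)) - h (\<nu> s) s * (Y m * u) \<in> ?J"
        unfolding u_def by (intro J_diff_left hU X_power_Y_low[OF s vT m(2)])
      ultimately have "h (\<nu> s) s * (Y m * u) \<in> ?J" using J_diff_iff by blast
      then have "Y m * u \<in> ?J" using eig[OF _ w] range le by simp
      then show ?thesis using W_wt[OF s u] m by (intro Y_cancel[OF s uT]) auto
    qed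
    then show "X (p ^ s) ^ (p - \<nu> s) * v \<in> ?J" by (simp add: u_def k_def)
  next
    fix s l v a
    assume s: "s < r" and l0: "0 \<le> l" "l < int (p ^ s)" and v: "v \<in> W s l a" and L: "strong_primitive s"
      and a: "a mod int p \<le> int p - 2 * int (\<nu> s)"
    define k where "k = p - \<nu> s"
    have nu_s: "1 \<le> \<nu> s" "2 * \<nu> s < p" using nu[OF s] by auto
    obtain m where m: "l = int m" "m < p ^ s" using l0 by (metis nonneg_int_cases of_nat_less_iff)
    have mr: "m < p ^ r" using p_power_le[of s m] s m by simp
    have q: "p ^ s < p ^ r" using s p_gt_1 by simp
    define u where "u = Y (p ^ s) ^ k * v"
    have u: "u \<in> W s l (a - 2 * int k)" unfolding u_def by (rule W_Y_power[OF s L l0 v])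
    then have uT: "u \<in> T s" by (simp add: W_def)
    have vT: "v \<in> T s" and vw: "wt (Suc s) (l + int (p ^ s) * a) v" using v by (auto simp: W_def)
    have g: "Y (p ^ s) ^ k * h (\<nu> s) s \<in> ?J"
      using s unfolding k_def by (intro subsetD[OF subset_ideal_gen]) (auto simp: odd_generators_def)
    have hU: "h (\<nu> s) s \<in> U r" by (rule h_U[OF nu_s(2) s])
    have YU: "Y (p ^ s) ^ k \<in> U r" by (intro U_power Y_U q)
    have eig: "Y (p ^ s) ^ k * w \<in> ?J" if "w \<in> U r" "wt (Suc s) d w" "d mod int (p ^ Suc s) \<le> int (p ^ s) * (int p - 2 * int (\<nu> s))" for w d
    proof -
      have "h (\<nu> s) s * w - sc (h_value (\<nu> s) s d) * w \<in> ?J"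
        using s by (intro wt_eigen[OF hU h_e[OF nu_s(2) order_refl] _ that(2)]) simp
      from J_diff_left[OF YU this]
      have "Y (p ^ s) ^ k * (h (\<nu> s) s * w) - sc (h_value (\<nu> s) s d) * (Y (p ^ s) ^ k * w) \<in> ?J"
        by (simp only: sc_left_U[OF YU])
      moreover have "Y (p ^ s) ^ k * (h (\<nu> s) s * w) \<in> ?J"
        using J_right[OF that(1) g] by (simp add: mult.assoc)
      ultimately have "sc (h_value (\<nu> s) s d) * (Y (p ^ s) ^ k * w) \<in> ?J" using J_diff_iff by blast
      then show ?thesis using J_sc_cancel h_value_eq_0_iff[OF nu_s, of s d] that(3) by blast
    qed
    have "u \<in> ?J"
    proof (cases "a mod int p = 0")
      case True
      have "(l + int (p ^ s) * a) mod int (p ^ Suc s) = l" by (rule high_weight_mod[OF l0 True])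
      moreover have "l \<le> int (p ^ s) * (int p - 2 * int (\<nu> s))"
      proof -
        have "int (p ^ s) * 1 \<le> int (p ^ s) * (int p - 2 * int (\<nu> s))"
          using nu_s by (intro mult_left_mono) auto
        then show ?thesis using l0 by linarith
      qed
      ultimately show ?thesis unfolding u_def using eig[OF T_U[OF vT] vw] by simp
    next
      case False
      have w: "wt (Suc s) (l + int (p ^ s) * a - 2 * int m) (Y m * v)" by (rule wt_Y[OF vw mr])
      have range: "(l + int (p ^ s) * a - 2 * int m) mod int (p ^ Suc s) = int (p ^ s) * (a mod int p) - int m"
        using low_weight_mod[OF m(2) False] by (simp only: m(1))
      have "int (p ^ s) * (a mod int p) \<le> int (p ^ s) * (int p - 2 * int (\<nu> s))"
        using a by (intro mult_left_mono) auto
      then have le: "int (p ^ s) * (a mod int p) - int m \<le> int (p ^ s) * (int p - 2 * int (\<nu> s))" by linarith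
      have "Y (p ^ s) ^ k * (Y m * v) \<in> ?J"
        using eig[OF U_closed(6)[OF Y_U[OF mr] T_U[OF vT]] w] range le by simp
      then have "Y m * u \<in> ?J" by (simp only: u_def Y_power_commute)
      then show ?thesis using W_wt[OF s u] m by (intro Y_cancel[OF s uT]) auto
    qed
    then show "Y (p ^ s) ^ (p - \<nu> s) * v \<in> ?J" by (simp add: u_def k_def)
  qed
qed

theorem jacobson_radical_odd:
  assumes "\<And>i. i < r \<Longrightarrow> 1 \<le> \<nu> i \<and> 2 * \<nu> i < p"
  shows "ideal_gen (U r) (odd_generators r \<nu>) = jacobson_radical (U r)"
  using jacobson_radical_eq[OF raising_odd_generators[OF assms] layered_odd[OF assms]] by simp

section \<open>The case p = 2\<close>

definition even_generators :: "nat \<Rightarrow> 'a set" where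
  "even_generators r = {e (Suc i) (int m) * X m * X (p ^ i) | i m. i < r \<and> m < p ^ i}
     \<union> {Y (p ^ i) * Y m * e (Suc i) (int m) | i m. i < r \<and> m < p ^ i}"

lemma raising_even_generators:
  assumes p: "p = 2" and g: "g \<in> even_generators r"
  shows "raising r g"
proof -
  obtain i m where i: "i < r" and m: "m < p ^ i"
    and gi: "g = e (Suc i) (int m) * X m * X (p ^ i) \<or> g = Y (p ^ i) * Y m * e (Suc i) (int m)"
    using g by (auto simp: even_generators_def)
  \<comment> \<open>\<open>X m * X (p ^ i)\<close> is \<open>X n\<close>. The idempotent lives on
    the single residue \<open>m\<close>, which is within the bound 2n - 2^(i+1) = 2m.\<close>
  define n where "n = m + p ^ i"
  define \<phi> :: "int \<Rightarrow> 'k" where "\<phi> a = (if [a = int m] (mod int (p ^ Suc i)) then 1 else 0)" for a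
  have f: "e (Suc i) (int m) \<in> U r" using i by (intro e_U) simp
  have fe: "e (Suc i) (int m) * e r a = sc (\<phi> a) * e r a" for a
    using i by (simp add: e_e_le \<phi>_def)
  have n: "n < p ^ Suc i" "p ^ Suc i \<le> 2 * n" using m p by (simp_all add: n_def)
  have supp: "a mod int (p ^ Suc i) \<le> 2 * int n - int (p ^ Suc i)" if "\<phi> a \<noteq> 0" for a
  proof -
    have "a mod int (p ^ Suc i) = int m mod int (p ^ Suc i)"
      using that by (auto simp: \<phi>_def cong_def split: if_splits)
    also have "\<dots> \<le> int m" by (rule zmod_le_nonneg_dividend) simp
    finally show ?thesis by (simp add: n_def p)
  qed
  have X: "X m * X (p ^ i) = X n" using X_split[of m i 1] m by (simp add: n_def)
  have Y: "Y (p ^ i) * Y m = Y n" using Y_split[of m i 1] m by (simp add: n_def Y_commute)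
  show ?thesis
    using gi raising_X[OF f fe i n supp] raising_Y[OF f fe i n supp] X Y by (auto simp: mult.assoc)
qed

text \<open>The range of digits shrinks to the digit 0, so the weight is \<open>l\<close> modulo
  2^(s+1), the one selected by the generator with \<open>m = l\<close>. In the first generator,
  applied to \<open>Y m * v\<close>, the factor \<open>X m\<close> undoes \<open>Y m\<close>; in the
  second the factor \<open>Y m\<close> is removed by \<open>Y_cancel\<close>.\<close>

lemma layered_even:
  assumes p: "p = 2"
  shows "layered_ideal sc X Y B p r (ideal_gen (U r) (even_generators r)) (\<lambda>_. 1)"
proof -
  let ?J = "ideal_gen (U r) (even_generators r)"
  have S: "even_generators r \<subseteq> U r"
    using raising_even_generators[OF p] unfolding raising_def by blast
  interpret divided_sl2_ideal sc X Y B p r ?J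
    by unfold_locales (rule two_sided_ideal_ideal_gen[OF is_subring_U S])
  have even_wt: "wt (Suc s) l w" if "wt (Suc s) (l + int (p ^ s) * a) w" "a mod 2 = 0" for s l a w
  proof -
    have "[l + int (p ^ s) * a = l] (mod int (p ^ Suc s))"
      using that(2) p by (auto simp: cong_iff_dvd_diff dvd_eq_mod_eq_0[symmetric] mult.commute[of 2] intro: mult_dvd_mono)
    then show ?thesis using that(1) wt_cong by blast
  qed
  show ?thesis
  proof
    fix s l v a
    assume s: "s < r" and l0: "0 \<le> l" "l < int (p ^ s)" and v: "v \<in> W s l a"
      and a: "(a + 2 * (int p - int 1)) mod int p \<le> int p - 2 * int 1"
    obtain m where m: "l = int m" "m < p ^ s" using l0 by (metis nonneg_int_cases of_nat_less_iff)
    have mr: "m < p ^ r" using p_power_le[of s m] s m by simp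
    define u where "u = X (p ^ s) * v"
    have u: "u \<in> W s l (a + 2)" unfolding u_def by (rule W_X[OF s v])
    then have uT: "u \<in> T s" by (simp add: W_def)
    have vT: "v \<in> T s" using v by (simp add: W_def)
    have "(a + 2) mod 2 = 0" using a p pos_mod_sign[of 2 "a + 2"] by simp
    then have ue: "e (Suc s) l * u - u \<in> ?J"
      using u even_wt[of s l "a + 2" u] by (simp add: W_def wt_def)
    have g: "e (Suc s) l * X m * X (p ^ s) \<in> ?J"
      using s m by (intro subsetD[OF subset_ideal_gen]) (auto simp: even_generators_def)
    have eX: "e (Suc s) l * X m \<in> U r" using s by (intro U_closed e_U X_U mr) simp
    have "e (Suc s) l * X m * (X (p ^ s) * (Y m * v)) \<in> ?J"
      using J_right[OF U_closed(6)[OF Y_U[OF mr] T_U[OF vT]] g] by (simp add: mult.assoc)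
    moreover have "e (Suc s) l * X m * (X (p ^ s) * (Y m * v)) - e (Suc s) l * X m * (Y m * u) \<in> ?J"
      unfolding u_def by (intro J_diff_left eX X_Y_low[OF s vT m(2)])
    ultimately have 1: "e (Suc s) l * (X m * (Y m * u)) \<in> ?J"
      using J_diff_iff by (simp add: mult.assoc)
    have "e (Suc s) l * (X m * (Y m * u)) - e (Suc s) l * u \<in> ?J"
      using s W_wt[OF s u] m by (intro J_diff_left e_U X_Y_cancel[OF s uT]) auto
    then have "e (Suc s) l * u \<in> ?J" using 1 J_diff_iff by blast
    then have "u \<in> ?J" using ue J_diff_iff by blast
    then show "X (p ^ s) ^ (p - 1) * v \<in> ?J" by (simp add: u_def p)
  next
    fix s l v a
    assume s: "s < r" and l0: "0 \<le> l" "l < int (p ^ s)" and v: "v \<in> W s l a" and L: "strong_primitive s"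
      and a: "a mod int p \<le> int p - 2 * int 1"
    obtain m where m: "l = int m" "m < p ^ s" using l0 by (metis nonneg_int_cases of_nat_less_iff)
    have mr: "m < p ^ r" using p_power_le[of s m] s m by simp
    have q: "p ^ s < p ^ r" using s p_gt_1 by simp
    define u where "u = Y (p ^ s) * v"
    have u: "u \<in> W s l (a - 2)" unfolding u_def by (rule W_Y[OF s L l0 v])
    then have uT: "u \<in> T s" by (simp add: W_def)
    have vT: "v \<in> T s" using v by (simp add: W_def)
    have "a mod 2 = 0" using a p pos_mod_sign[of 2 a] by simp
    then have ve: "e (Suc s) l * v - v \<in> ?J"
      using v even_wt[of s l a v] by (simp add: W_def wt_def)
    have g: "Y (p ^ s) * Y m * e (Suc s) l \<in> ?J"
      using s m by (intro subsetD[OF subset_ideal_gen]) (auto simp: even_generators_def)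
    have "Y (p ^ s) * Y m * (e (Suc s) l * v) \<in> ?J"
      using J_right[OF T_U[OF vT] g] by (simp add: mult.assoc)
    moreover have "Y (p ^ s) * Y m * (e (Suc s) l * v) - Y (p ^ s) * Y m * v \<in> ?J"
      by (intro J_diff_left U_closed Y_U mr q ve)
    ultimately have "Y (p ^ s) * Y m * v \<in> ?J" using J_diff_iff by blast
    then have "Y m * u \<in> ?J" by (simp only: u_def mult.assoc[symmetric] Y_commute)
    then have "u \<in> ?J" using W_wt[OF s u] m by (intro Y_cancel[OF s uT]) auto
    then show "Y (p ^ s) ^ (p - 1) * v \<in> ?J" by (simp add: u_def p)
  qed (use p in auto)
qed

theorem jacobson_radical_even:
  assumes "p = 2"
  shows "ideal_gen (U r) (even_generators r) = jacobson_radical (U r)"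
  using jacobson_radical_eq[OF raising_even_generators[OF assms] layered_even[OF assms]] by simp

end

section \<open>The hyperalgebra\<close>

lemma uea_Z_type: "type_definition Rep_uea_Z Abs_uea_Z uea_Z_set"
  unfolding uea_Z_set_def by (rule type_definition_uea_Z)

lemma Rep_Abs_uea_Z: "u \<in> uea_Z_set \<Longrightarrow> Rep_uea_Z (Abs_uea_Z u) = u"
  using uea_Z_type by (rule type_definition.Abs_inverse)

lemma Abs_uea_Z_add:
  "u \<in> uea_Z_set \<Longrightarrow> v \<in> uea_Z_set \<Longrightarrow> Abs_uea_Z (u + v) = Abs_uea_Z u + Abs_uea_Z v"
  by (simp add: Rep_uea_Z_inject[symmetric] Rep_Abs_uea_Z uea_Z_set_closed plus_uea_Z.rep_eq)

lemma Abs_uea_Z_mult: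
  "u \<in> uea_Z_set \<Longrightarrow> v \<in> uea_Z_set \<Longrightarrow> Abs_uea_Z (u * v) = Abs_uea_Z u * Abs_uea_Z v"
  by (simp add: Rep_uea_Z_inject[symmetric] Rep_Abs_uea_Z uea_Z_set_closed times_uea_Z.rep_eq)

lemma Abs_uea_Z_1: "Abs_uea_Z 1 = 1"
  by (simp add: Rep_uea_Z_inject[symmetric] Rep_Abs_uea_Z uea_Z_set_closed one_uea_Z.rep_eq)

lemma cong_tensor_refl: "x = y \<Longrightarrow> cong_mod tensor_relations x y"
  using equivp_reflp[OF equivp_cong_mod] by auto

lemma tensor_of_add_left: "tensor_of (a + a') b = tensor_of a b + tensor_of a' b"
  by transfer (auto simp: cong_mod_def tensor_relations_def intro!: subsetD[OF subset_ideal_gen])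

lemma tensor_of_add_right: "tensor_of a (b + b') = tensor_of a b + tensor_of a b'"
  by transfer (unfold cong_mod_def tensor_relations_def, rule subsetD[OF subset_ideal_gen], blast)

lemma tensor_of_mult: "tensor_of a b * tensor_of a' b' = tensor_of (a * a') (b * b')"
  by transfer (rule cong_tensor_refl, simp add: pure_elem_def Poly_Mapping.mult_single)

lemma tensor_of_1: "tensor_of 1 1 = 1"
  by transfer (rule cong_tensor_refl, simp add: pure_elem_def zero_pure_tensor_def[symmetric])

lemma hyp_scalar_1: "hyp_scalar 1 = 1"
  by (simp add: hyp_scalar_def tensor_of_1)

lemma hyp_scalar_add: "hyp_scalar (c + d) = hyp_scalar c + hyp_scalar d"
  by (simp add: hyp_scalar_def tensor_of_add_right)

lemma hyp_scalar_mult: "hyp_scalar (c * d) = hyp_scalar c * hyp_scalar d"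
  by (simp add: hyp_scalar_def tensor_of_mult)

lemma hyp_scalar_0: "hyp_scalar 0 = 0"
  using hyp_scalar_add[of 0 0] by simp

lemma hyp_scalar_commute: "hyp_scalar c * hyp u = hyp u * hyp_scalar c"
  by (simp add: hyp_scalar_def hyp_def tensor_of_mult)

lemma hyp_1: "hyp 1 = 1"
  by (simp add: hyp_def Abs_uea_Z_1 tensor_of_1)

lemma hyp_add: "u \<in> uea_Z_set \<Longrightarrow> v \<in> uea_Z_set \<Longrightarrow> hyp (u + v) = hyp u + hyp v"
  by (simp add: hyp_def Abs_uea_Z_add tensor_of_add_left)

lemma hyp_mult: "u \<in> uea_Z_set \<Longrightarrow> v \<in> uea_Z_set \<Longrightarrow> hyp (u * v) = hyp u * hyp v"
  by (simp add: hyp_def Abs_uea_Z_mult tensor_of_mult)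

lemma hyp_0: "hyp 0 = 0"
  using hyp_add[of 0 0] uea_Z_set_closed(2) by simp

lemma hyp_sum:
  "(\<And>i. i \<in> A \<Longrightarrow> f i \<in> uea_Z_set) \<Longrightarrow> hyp (sum f A) = (\<Sum>i\<in>A. hyp (f i))"
  by (induction A rule: infinite_finite_induct) (simp_all add: hyp_0 hyp_add uea_Z_set_sum)

text \<open>Biadditivity moves an integer across the tensor sign one unit at a time.\<close>

lemma hyp_of_int:
  assumes "u \<in> uea_Z_set"
  shows "(hyp (uea_const (of_int z) * u) :: 'k::field hyperalg) = hyp_scalar (of_int z) * hyp u"
proof (induction z rule: int_induct[of _ 0])
  case base show ?case by (simp add: hyp_0 hyp_scalar_0)
next
  case (step1 z)
  have "uea_const (of_int (z + 1)) * u = uea_const (of_int z) * u + u"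
    by (simp add: uea_const_add distrib_right)
  moreover have "(hyp_scalar (of_int (z + 1)) :: 'k hyperalg) = hyp_scalar (of_int z) + 1"
    by (simp add: hyp_scalar_add hyp_scalar_1)
  ultimately show ?case using step1 assms by (simp only: hyp_add uea_Z_set_of_int distrib_right mult_1)
next
  case (step2 z)
  have "uea_const (of_int z) * u = uea_const (of_int (z - 1)) * u + u"
    by (simp add: uea_const_diff left_diff_distrib)
  then have "(hyp_scalar (of_int z) * hyp u :: 'k hyperalg) = hyp (uea_const (of_int (z - 1)) * u) + hyp u"
    using step2 assms by (simp only: hyp_add uea_Z_set_of_int flip: step2.IH)
  moreover have "(hyp_scalar (of_int z) :: 'k hyperalg) = hyp_scalar (of_int (z - 1)) + 1"
    using hyp_scalar_add[of "of_int (z - 1) :: 'k" 1] by (simp add: hyp_scalar_1)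
  ultimately show ?case by (simp add: distrib_right)
qed

lemma Hbinom_mem: "Hbinom c t \<in> uea_Z_set"
  unfolding Hbinom_eq_Hpoly by (intro Hpoly_mem int_valued_binom_poly)

lemma int_valued_mult: "int_valued f \<Longrightarrow> int_valued g \<Longrightarrow> int_valued (f * g)"
  by (simp add: int_valued_def)

lemma int_valued_sum: "(\<And>i. i \<in> A \<Longrightarrow> int_valued (f i)) \<Longrightarrow> int_valued (sum f A)"
  by (auto simp: int_valued_def poly_sum intro: Ints_sum)

lemma int_valued_smult_of_int: "int_valued f \<Longrightarrow> int_valued (smult (of_int z) f)"
  by (simp add: int_valued_def)

text \<open>An integer-valued polynomial whose values are divisible by \<open>p\<close> has Newton coefficients divisible by \<open>p\<close>.\<close>

lemma hyp_Hpoly_cong: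
  assumes p: "(of_nat p :: 'k::field) = 0"
    and f: "int_valued f" "int_valued g"
    and eq: "\<And>n::nat. \<exists>x y. poly f (of_nat n) = of_int x \<and> poly g (of_nat n) = of_int y \<and> [x = y] (mod int p)"
  shows "(hyp (Hpoly f) :: 'k hyperalg) = hyp (Hpoly g)"
proof -
  have "\<exists>z. poly (f - g) (of_nat n) = of_int (int p * z)" for n :: nat
  proof -
    obtain x y where "poly f (of_nat n) = of_int x" "poly g (of_nat n) = of_int y" "[x = y] (mod int p)"
      using eq by blast
    moreover from this(3) obtain z where "x - y = int p * z" by (auto simp: cong_iff_dvd_diff)
    then have "(of_int x - of_int y :: complex) = of_int (int p * z)" by (metis of_int_diff)
    ultimately show ?thesis by auto
  qed
  then obtain u where u: "u \<in> uea_Z_set" "Hpoly (f - g) = uea_const (of_int (int p)) * u"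
    using Hpoly_dvd by blast
  have "f = (f - g) + g" by simp
  then have "Hpoly f = uea_const (of_int (int p)) * u + Hpoly g"
    using u(2) by (metis Hpoly_add)
  then have "hyp (Hpoly f) = (hyp_scalar (of_int (int p)) * hyp u + hyp (Hpoly g) :: 'k hyperalg)"
    by (simp only: hyp_add hyp_of_int uea_Z_set_of_int u(1) Hpoly_mem f)
  then show ?thesis using p by (simp add: hyp_scalar_0)
qed

lemma poly_binom_poly_of_int:
  "poly (binom_poly (of_int c) t) (of_nat n) = of_int (ibinom (int n + c) t)"
  by (simp add: of_int_ibinom)

lemma Hbinom_vandermonde:
  "Hbinom b t = (\<Sum>j\<le>t. uea_const (of_int (ibinom b (t - j))) * Hbinom 0 j)"
proof -
  have "binom_poly (of_int b) t = (\<Sum>j\<le>t. smult (of_int (ibinom b (t - j))) (binom_poly 0 j))"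
    unfolding poly_eq_poly_eq_iff[symmetric]
  proof
    fix x :: complex
    have "poly (binom_poly (of_int b) t) x = (\<Sum>j\<le>t. (x gchoose j) * (of_int b gchoose (t - j)))"
      by (simp add: gbinomial_Vandermonde[symmetric] atLeast0AtMost)
    then show "poly (binom_poly (of_int b) t) x = poly (\<Sum>j\<le>t. smult (of_int (ibinom b (t - j))) (binom_poly 0 j)) x"
      by (simp add: poly_sum of_int_ibinom mult.commute)
  qed
  then show ?thesis by (simp add: Hbinom_eq_Hpoly Hpoly_sum Hpoly_smult)
qed

text \<open>The commutation relations already hold in the integral form and are carried over by
  \<open>hyp\<close>. The two relations for the idempotents hold only modulo \<open>p\<close>;
  \<open>hyp_Hpoly_cong\<close> reduces them to congruences between values of polynomials at natural
  numbers.\<close>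

lemma hyperalg_divided_sl2:
  assumes char: "CHAR('k::field) = p" and p: "p > 0"
  shows "divided_sl2 (hyp_scalar :: 'k \<Rightarrow> 'k hyperalg) hX hY hH p"
proof
  have pr: "prime p" using char p prime_CHAR_semidom[where 'a = 'k] by simp
  have p0: "(of_nat p :: 'k) = 0" using char by (metis of_nat_CHAR)
  show "CHAR('k) = p" "p > 0" by fact+
  show "hyp_scalar 1 = (1 :: 'k hyperalg)" by (rule hyp_scalar_1)
  show "hyp_scalar (c + d) = hyp_scalar c + hyp_scalar d" for c d :: 'k by (rule hyp_scalar_add)
  show "hyp_scalar (c * d) = hyp_scalar c * hyp_scalar d" for c d :: 'k by (rule hyp_scalar_mult)
  show "hyp_scalar c * hX n = hX n * hyp_scalar c" for c :: 'k and n
    unfolding hX_def by (rule hyp_scalar_commute)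
  show "hyp_scalar c * hY n = hY n * hyp_scalar c" for c :: 'k and n
    unfolding hY_def by (rule hyp_scalar_commute)
  show "hyp_scalar c * hH b t = hH b t * hyp_scalar c" for c :: 'k and b t
    unfolding hH_def by (rule hyp_scalar_commute)
  show "hX 0 = (1 :: 'k hyperalg)" "hY 0 = (1 :: 'k hyperalg)"
    by (simp_all add: hX_def hY_def hyp_1)
  show "hH b 0 = (1 :: 'k hyperalg)" for b by (simp add: hH_def Hbinom_def hyp_1)
  have mult: "hyp (divpow u m) * hyp (divpow u n) = (hyp_scalar (of_nat ((m + n) choose m)) * hyp (divpow u (m + n)) :: 'k hyperalg)"
    if "\<And>n. divpow u n \<in> uea_Z_set" for u m n
    using hyp_of_int[OF that[of "m + n"], of "int ((m + n) choose m)"] divpow_mult[of u m n]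
    by (simp add: hyp_mult[OF that that, symmetric])
  show "hX m * hX n = (hyp_scalar (of_nat ((m + n) choose m)) * hX (m + n) :: 'k hyperalg)" for m n
    unfolding hX_def by (intro mult divpow_mem)
  show "hY m * hY n = (hyp_scalar (of_nat ((m + n) choose m)) * hY (m + n) :: 'k hyperalg)" for m n
    unfolding hY_def by (intro mult divpow_mem)
  show "hX n * hY m = (\<Sum>t\<le>min m n. hY (m - t) * hH (2 * int t - int m - int n) t * hX (n - t) :: 'k hyperalg)" for m n
    unfolding hX_def hY_def hH_def
    by (simp only: hyp_mult[symmetric] divpow_mem Hbinom_mem uea_Z_set_closed(6) hyp_sum[symmetric] divpow_UX_UY)
  show "hH b t * hX n = (hX n * hH (b + 2 * int n) t :: 'k hyperalg)" for b t n
    unfolding hX_def hH_def by (simp only: hyp_mult[symmetric] divpow_mem Hbinom_mem Hbinom_divpow_UX)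
  show "hH b t * hY n = (hY n * hH (b - 2 * int n) t :: 'k hyperalg)" for b t n
    unfolding hY_def hH_def by (simp only: hyp_mult[symmetric] divpow_mem Hbinom_mem Hbinom_divpow_UY)
  show "hH b t = (\<Sum>j\<le>t. hyp_scalar (of_int (ibinom b (t - j))) * hH 0 j :: 'k hyperalg)" for b t
    unfolding hH_def
    by (simp only: hyp_of_int[symmetric] Hbinom_mem uea_Z_set_of_int hyp_sum[symmetric] Hbinom_vandermonde[of b t])
  show "hH b t * hH (- a - 1) (p ^ s - 1) = (hyp_scalar (of_int (ibinom (a + b) t)) * hH (- a - 1) (p ^ s - 1) :: 'k hyperalg)"
    if t: "t < p ^ s" for t s b a
  proof -
    define q where "q = p ^ s"
    let ?f = "binom_poly (of_int b) t" and ?g = "binom_poly (of_int (- a - 1)) (q - 1)"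
    \<comment> \<open>If \<open>n\<close> and \<open>a\<close> agree modulo \<open>q\<close>, the
      two binomials over \<open>t < q\<close> agree modulo \<open>p\<close>; otherwise the common
      factor vanishes.\<close>
    have "[ibinom (int n + b) t * ibinom (int n + (- a - 1)) (q - 1) = ibinom (a + b) t * ibinom (int n + (- a - 1)) (q - 1)] (mod int p)" for n
    proof (cases "int q dvd int n - a")
      case True
      then have "(int n + b) mod int q = (a + b) mod int q"
        by (simp add: mod_eq_dvd_iff)
      then have "[ibinom (int n + b) t = ibinom (a + b) t] (mod int p)"
        using cong_trans[OF ibinom_cong_mod[OF pr q_def t[folded q_def], of "int n + b"]]
          cong_sym[OF ibinom_cong_mod[OF pr q_def t[folded q_def], of "a + b"]] by simp
      then show ?thesis by (intro cong_mult cong_refl)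
    next
      case False
      then have 0: "[ibinom (int n + (- a - 1)) (q - 1) = 0] (mod int p)"
        using ibinom_indicator[OF pr q_def, of "int n - a"] by (simp add: algebra_simps)
      have "[x * ibinom (int n + (- a - 1)) (q - 1) = 0] (mod int p)" for x
        using cong_mult[OF cong_refl 0, of x] by simp
      then show ?thesis using cong_trans cong_sym by blast
    qed
    then have "\<exists>x y. poly (?f * ?g) (of_nat n) = of_int x \<and>
        poly (smult (of_int (ibinom (a + b) t)) ?g) (of_nat n) = of_int y \<and> [x = y] (mod int p)" for n
      by (intro exI[of _ "ibinom (int n + b) t * ibinom (int n + (- a - 1)) (q - 1)"]
          exI[of _ "ibinom (a + b) t * ibinom (int n + (- a - 1)) (q - 1)"])
        (simp add: poly_binom_poly_of_int del: poly_binom_poly of_int_diff of_int_minus)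
    from hyp_Hpoly_cong[OF p0 _ _ this]
    have "(hyp (Hpoly (?f * ?g)) :: 'k hyperalg) = hyp (Hpoly (smult (of_int (ibinom (a + b) t)) ?g))"
      by (simp add: int_valued_mult int_valued_binom_poly int_valued_smult_of_int del: of_int_diff of_int_minus)
    then show ?thesis
      unfolding hH_def q_def Hpoly_mult Hpoly_smult Hbinom_eq_Hpoly[symmetric]
      by (simp only: hyp_mult Hbinom_mem hyp_of_int)
  qed
  show "(\<Sum>a<p ^ s. hH (- int a - 1) (p ^ s - 1)) = (1 :: 'k hyperalg)" for s
  proof -
    define q where "q = p ^ s"
    have q0: "q > 0" using p by (simp add: q_def)
    let ?f = "\<Sum>a<q. binom_poly (of_int (- int a - 1)) (q - 1)"
    \<comment> \<open>At each \<open>n\<close> exactly one of the indicators is 1, that of the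
      residue of \<open>n\<close>.\<close>
    have "[(\<Sum>a<q. ibinom (int n + (- int a - 1)) (q - 1)) = 1] (mod int p)" for n
    proof -
      have "[(\<Sum>a<q. ibinom (int n + (- int a - 1)) (q - 1)) = (\<Sum>a<q. if a = n mod q then 1 else 0)] (mod int p)"
      proof (rule cong_sum)
        fix a assume "a \<in> {..<q}"
        then have "int q dvd int n - int a \<longleftrightarrow> a = n mod q"
          by (auto simp: mod_eq_dvd_iff[symmetric] zmod_int[symmetric])
        then show "[ibinom (int n + (- int a - 1)) (q - 1) = (if a = n mod q then 1 else 0)] (mod int p)"
          using ibinom_indicator[OF pr q_def, of "int n - int a"] by (simp add: algebra_simps)
      qed
      then show ?thesis using q0 by simp
    qed
    then have "\<exists>x y. poly ?f (of_nat n) = of_int x \<and> poly 1 (of_nat n) = (of_int y :: complex) \<and> [x = y] (mod int p)" for n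
      by (intro exI[of _ "\<Sum>a<q. ibinom (int n + (- int a - 1)) (q - 1)"] exI[of _ 1])
        (simp add: poly_sum poly_binom_poly_of_int del: poly_binom_poly of_int_diff of_int_minus)
    from hyp_Hpoly_cong[OF p0 _ _ this]
    have "(hyp (Hpoly ?f) :: 'k hyperalg) = hyp (Hpoly 1)"
      by (simp add: int_valued_sum int_valued_binom_poly del: of_int_diff of_int_minus) (simp add: int_valued_def)
    then show ?thesis
      unfolding hH_def q_def Hpoly_sum Hbinom_eq_Hpoly[symmetric]
      by (simp add: hyp_sum Hbinom_mem hyp_1)
  qed
qed

theorem theorem4p1:
  fixes p r :: nat
  assumes "CHAR('k::alg_closed_field) = p" and "p > 0" and "r \<ge> 1"
  shows
    "(odd p \<longrightarrow> (\<forall>\<nu> :: nat \<Rightarrow> nat.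
        (\<forall>l<r. 1 \<le> \<nu> l \<and> \<nu> l \<le> (p - 1) div 2) \<longrightarrow>
        ideal_gen (hyperalg_sub p r :: 'k hyperalg set)
          ({hnu p (\<nu> i) i * hX (p ^ i) ^ (p - \<nu> i) | i. i \<le> r - 1}
         \<union> {hY (p ^ i) ^ (p - \<nu> i) * hnu p (\<nu> i) i | i. i \<le> r - 1})
        = jacobson_radical (hyperalg_sub p r)))
   \<and> (p = 2 \<longrightarrow>
        ideal_gen (hyperalg_sub p r :: 'k hyperalg set)
          ({mu p (int m) (i + 1) * hX m * hX (2 ^ i) | i m. i \<le> r - 1 \<and> m \<le> 2 ^ i - 1}
         \<union> {hY (2 ^ i) * hY m * mu p (int m) (i + 1) | i m. i \<le> r - 1 \<and> m \<le> 2 ^ i - 1})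
        = jacobson_radical (hyperalg_sub p r))"
proof -
  interpret divided_sl2 "hyp_scalar :: 'k \<Rightarrow> 'k hyperalg" hX hY hH p
    by (rule hyperalg_divided_sl2[OF assms(1,2)])
  have U: "hyperalg_sub p r = U r" by (simp only: hyperalg_sub_def U_def)
  have i: "i \<le> r - 1 \<longleftrightarrow> i < r" for i using assms(3) by auto
  have m: "m \<le> 2 ^ i - 1 \<longleftrightarrow> m < 2 ^ i" for m i :: nat
  proof -
    have "(2::nat) ^ i > 0" by simp
    then show ?thesis by linarith
  qed
  show ?thesis
  proof (intro conjI impI allI)
    fix \<nu> :: "nat \<Rightarrow> nat"
    assume "odd p" and "\<forall>l<r. 1 \<le> \<nu> l \<and> \<nu> l \<le> (p - 1) div 2"
    then have nu: "1 \<le> \<nu> l \<and> 2 * \<nu> l < p" if "l < r" for l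
    proof -
      have "1 \<le> \<nu> l" "\<nu> l \<le> (p - 1) div 2" using \<open>\<forall>l<r. 1 \<le> \<nu> l \<and> \<nu> l \<le> (p - 1) div 2\<close> that by auto
      then show ?thesis using assms(2) by linarith
    qed
    have h: "(hnu p (\<nu> i) i :: 'k hyperalg) = h (\<nu> i) i" for i by (simp only: hnu_def h_def)
    show "ideal_gen (hyperalg_sub p r :: 'k hyperalg set)
          ({hnu p (\<nu> i) i * hX (p ^ i) ^ (p - \<nu> i) | i. i \<le> r - 1}
         \<union> {hY (p ^ i) ^ (p - \<nu> i) * hnu p (\<nu> i) i | i. i \<le> r - 1})
        = jacobson_radical (hyperalg_sub p r)"
      using jacobson_radical_odd[of r \<nu>] nu unfolding U i h odd_generators_def by blast
  next
    assume p: "p = 2"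
    have mu: "(mu p (int m) (i + 1) :: 'k hyperalg) = e (Suc i) (int m)" for m i by (simp add: mu_def e_def)
    show "ideal_gen (hyperalg_sub p r :: 'k hyperalg set)
          ({mu p (int m) (i + 1) * hX m * hX (2 ^ i) | i m. i \<le> r - 1 \<and> m \<le> 2 ^ i - 1}
         \<union> {hY (2 ^ i) * hY m * mu p (int m) (i + 1) | i m. i \<le> r - 1 \<and> m \<le> 2 ^ i - 1})
        = jacobson_radical (hyperalg_sub p r)"
      using jacobson_radical_even[OF p, of r] unfolding U i m mu even_generators_def by (simp only: p)
  qed
qed

end
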